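(* For $\epsilon>0$ and $t\in\mathbb{R}$ let $X^{(\epsilon)}_t:=\epsilon^{-1/2}(X_{1+\epsilon t}-X_1)$. Let $U^{(1)}$ and $U^{(2)}$ be two standard Brownian motions defined on an extension of $(\Omega,\mathcal{F},\mathbb{P})$ which are independent of each other and of $\mathcal{F}$ (i.e. $U^{(1)},U^{(2)},\mathcal{F}$ are mutually independent). Then, as $\epsilon\downarrow 0$, $$\big((X^{(\epsilon)}_{-t})_{t\geq0},(X^{(\epsilon)}_t)_{t\geq0}\big)\ \text{ converges stably to }\ \big(\sigma(X_1)U^{(1)},\sigma(X_1)U^{(2)}\big).$$
   Context: Setting. $(X,W)$ is a weak solution of the SDE $\mathrm{d}X_t=\mu(X_t)\,\mathrm{d}t+\sigma(X_t)\,\mathrm{d}W_t$, $X_0=x_0\in\mathbb{R}$, on a filtered probability space $(\Omega,\mathcal{F},(\mathcal{F}_t)_{t\ge0},\mathbb{P})$ satisfying the usual conditions, where $X$ is $(\mathcal{F}_t)$-adapted, $W$ is a standard $(\mathcal{F}_t)$-Brownian motion, and $X,W$ have continuous paths for all $\omega\in\Omega$. The range of $X$ is the set of $x\in\mathbb{R}$ with $\mathbb{P}(X_t=x\text{ for some }t\in[0,\infty))>0$. It is assumed that $\mu:\mathbb{R}\to\mathbb{R}$ is locally bounded, and that $\sigma:\mathbb{R}\to[0,\infty)$ is continuous and strictly positive on the range of $X$. Path space. Processes indexed by $[0,\infty)$ are viewed as random elements of $D[0,\infty)$, the space of real-valued càdlàg functions on $[0,\infty)$ with the Skorokhod topology and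 its Borel $\sigma$-algebra; pairs of processes are random elements of $D[0,\infty)\times D[0,\infty)$ with the product topology. Convention: $X_s:=X_0$ for $s<0$. Stable convergence. An extension of $(\Omega,\mathcal{F},\mathbb{P})$ is a product space $(\Omega\times\Omega',\mathcal{F}\otimes\mathcal{F}')$ with a probability measure $\tilde{\mathbb{P}}$ satisfying $\tilde{\mathbb{P}}(A\times\Omega')=\mathbb{P}(A)$ for $A\in\mathcal{F}$; random variables on $\Omega$ are viewed on the extension via $Z(\omega,\omega'):=Z(\omega)$. Random variables $Z_n$ on $(\Omega,\mathcal{F},\mathbb{P})$ with values in a Polish space converge stably to $Z$ defined on an extension if $\mathbb{E}[f(Z_n)V]\to\tilde{\mathbb{E}}[f(Z)V]$ for all bounded continuous $f$ and all bounded $\mathcal{F}$-measurable $V$. Stable convergence of $Z^{(\epsilon)}$ as $\epsilon\downarrow0$ means the same with $\epsilon\downarrow 0$ in place of $n\to\infty$. *)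

theory Defs
  imports "HOL-Probability.Probability"
begin

section \<open>The Skorokhod space\<close>

text \<open>Elements of \<open>D[0,\<infinity>)\<close> are represented by functions on all of \<open>\<real>\<close>
  that are set to \<open>0\<close> on the negative half-line.\<close>

typedef cadlag =
  "{f :: real \<Rightarrow> real.
      (\<forall>t\<ge>0. (f \<longlongrightarrow> f t) (at_right t)) \<and>
      (\<forall>t>0. \<exists>l. (f \<longlongrightarrow> l) (at_left t)) \<and>
      (\<forall>t<0. f t = 0)}"
  by (rule exI[of _ "\<lambda>_. 0"]) auto

text \<open>Time changes: increasing bijections of \<open>[0,\<infinity>)\<close>, hence automatically continuous
  with value \<open>0\<close> at \<open>0\<close>.\<close>

definition time_change :: "(real \<Rightarrow> real) \<Rightarrow> bool" where
  "time_change l \<longleftrightarrow> strict_mono_on {0..} l \<and> l ` {0..} = {0..}"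

definition skorokhod_nhd :: "cadlag \<Rightarrow> real \<Rightarrow> real \<Rightarrow> cadlag set" where
  "skorokhod_nhd x T e =
     {y. \<exists>l. time_change l \<and> (\<forall>s\<ge>0. \<bar>l s - s\<bar> < e) \<and>
             (\<forall>s\<in>{0..T}. \<bar>Rep_cadlag y (l s) - Rep_cadlag x s\<bar> < e)}"

text \<open>The Skorokhod (J1) topology is metrizable, and \<open>x\<^sub>n\<close> converges to \<open>x\<close> iff there are time
  changes \<open>l\<^sub>n\<close> such that \<open>l\<^sub>n - id\<close> tends to \<open>0\<close> uniformly on \<open>[0,\<infinity>)\<close> and \<open>x\<^sub>n \<circ> l\<^sub>n - x\<close> tends
  to \<open>0\<close> uniformly on every \<open>[0,T]\<close> (Jacod and Shiryaev, Limit Theorems for Stochastic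
  Processes, VI.1.14). This says that \<open>x\<^sub>n\<close> is eventually in each \<open>skorokhod_nhd x T e\<close>.
  These sets shrink as \<open>T\<close> grows and \<open>e\<close> decreases, so the (sequentially) open
  sets are exactly those described below.\<close>

instantiation cadlag :: topological_space
begin

definition open_cadlag :: "cadlag set \<Rightarrow> bool" where
  "open_cadlag S \<longleftrightarrow> (\<forall>x\<in>S. \<exists>T>0. \<exists>e>0. skorokhod_nhd x T e \<subseteq> S)"

lemma skorokhod_nhd_mono:
  assumes "T \<le> T'" "e' \<le> e"
  shows "skorokhod_nhd x T' e' \<subseteq> skorokhod_nhd x T e"
  using assms unfolding skorokhod_nhd_def by clarsimp (meson atLeastAtMost_iff less_le_trans order_trans)

instance
proof
  show "open (UNIV :: cadlag set)"
    by (auto simp: open_cadlag_def intro: zero_less_one)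
next
  fix S S' :: "cadlag set"
  assume S: "open S" "open S'"
  show "open (S \<inter> S')"
    unfolding open_cadlag_def
  proof
    fix x assume "x \<in> S \<inter> S'"
    then obtain T e T' e' where h: "T > 0" "e > 0" "skorokhod_nhd x T e \<subseteq> S"
      "T' > 0" "e' > 0" "skorokhod_nhd x T' e' \<subseteq> S'"
      using S unfolding open_cadlag_def by blast
    have "skorokhod_nhd x (max T T') (min e e') \<subseteq> S \<inter> S'"
      using h(3,6) skorokhod_nhd_mono[of T "max T T'" "min e e'" e x]
        skorokhod_nhd_mono[of T' "max T T'" "min e e'" e' x] by auto
    moreover have "max T T' > 0" "min e e' > 0"
      using h by auto
    ultimately show "\<exists>T>0. \<exists>e>0. skorokhod_nhd x T e \<subseteq> S \<inter> S'"
      by blast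
  qed
next
  fix K :: "cadlag set set"
  assume "\<forall>S\<in>K. open S"
  then show "open (\<Union>K)"
    unfolding open_cadlag_def by (meson Union_iff Union_upper order_trans)
qed

end

text \<open>A process, viewed as a map into \<open>D[0,\<infinity>)\<close>. This is only meaningful
  if all paths of the process are cadlag.\<close>

definition sample_path :: "(real \<Rightarrow> 'a \<Rightarrow> real) \<Rightarrow> 'a \<Rightarrow> cadlag" where
  "sample_path Y \<omega> = Abs_cadlag (\<lambda>t. if 0 \<le> t then Y t \<omega> else 0)"

lemma Rep_sample_path:
  assumes "continuous_on {0..} (\<lambda>t. Y t \<omega>)" "0 \<le> t"
  shows "Rep_cadlag (sample_path Y \<omega>) t = Y t \<omega>"
proof -
  let ?f = "\<lambda>t. if 0 \<le> t then Y t \<omega> else 0"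
  have lim: "((\<lambda>t. Y t \<omega>) \<longlongrightarrow> Y s \<omega>) (at s within {0..})" if "0 \<le> s" for s
    using assms(1) that by (auto simp: continuous_on_def)
  have "(?f \<longlongrightarrow> ?f s) (at_right s)" if "0 \<le> s" for s
  proof -
    have "((\<lambda>t. Y t \<omega>) \<longlongrightarrow> Y s \<omega>) (at_right s)"
      by (rule tendsto_within_subset[OF lim[OF that]]) (use that in auto)
    moreover have "eventually (\<lambda>t. Y t \<omega> = ?f t) (at_right s)"
      using that by (auto simp: eventually_at_filter)
    ultimately show ?thesis
      using that by (auto intro: Lim_transform_eventually)
  qed
  moreover have "\<exists>l. (?f \<longlongrightarrow> l) (at_left s)" if "0 < s" for s
  proof -
    have "((\<lambda>t. Y t \<omega>) \<longlongrightarrow> Y s \<omega>) (at s)"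
      using lim[of s] that at_within_interior[of s "{0..}"] by simp
    then have "((\<lambda>t. Y t \<omega>) \<longlongrightarrow> Y s \<omega>) (at_left s)"
      by (rule tendsto_within_subset) auto
    moreover have "eventually (\<lambda>t. Y t \<omega> = ?f t) (at_left s)"
      using eventually_at_left_real[OF that] by eventually_elim auto
    ultimately show ?thesis
      by (blast intro: Lim_transform_eventually)
  qed
  ultimately show ?thesis
    using assms(2) unfolding sample_path_def by (subst Abs_cadlag_inverse) auto
qed


section \<open>Filtrations and Brownian motion\<close>

text \<open>Only times \<open>t \<ge> 0\<close> matter, for filtrations as well as for processes.\<close>

definition usual_conditions :: "'a measure \<Rightarrow> (real \<Rightarrow> 'a measure) \<Rightarrow> bool" where
  "usual_conditions M F \<longleftrightarrow>
     prob_space M \<and> complete_measure M \<and>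
     (\<forall>t\<ge>0. subalgebra M (F t)) \<and>
     (\<forall>s\<ge>0. \<forall>t\<ge>s. sets (F s) \<subseteq> sets (F t)) \<and>
     (\<forall>t\<ge>0. sets (F t) = (\<Inter>u\<in>{t<..}. sets (F u))) \<and>
     null_sets M \<subseteq> sets (F 0)"

definition adapted :: "(real \<Rightarrow> 'a measure) \<Rightarrow> (real \<Rightarrow> 'a \<Rightarrow> real) \<Rightarrow> bool" where
  "adapted F Y \<longleftrightarrow> (\<forall>t\<ge>0. Y t \<in> borel_measurable (F t))"

definition continuous_paths :: "'a measure \<Rightarrow> (real \<Rightarrow> 'a \<Rightarrow> real) \<Rightarrow> bool" where
  "continuous_paths M Y \<longleftrightarrow> (\<forall>\<omega>\<in>space M. continuous_on {0..} (\<lambda>t. Y t \<omega>))"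

definition generated_by :: "'a set \<Rightarrow> (real \<Rightarrow> 'a \<Rightarrow> real) \<Rightarrow> real set \<Rightarrow> 'a measure" where
  "generated_by \<Omega> Y I = sigma \<Omega> (\<Union>t\<in>I. {Y t -` A \<inter> \<Omega> | A. A \<in> sets borel})"

definition brownian_motion_wrt ::
    "'a measure \<Rightarrow> (real \<Rightarrow> 'a measure) \<Rightarrow> (real \<Rightarrow> 'a \<Rightarrow> real) \<Rightarrow> bool" where
  "brownian_motion_wrt M F B \<longleftrightarrow>
     adapted F B \<and> continuous_paths M B \<and> (AE \<omega> in M. B 0 \<omega> = 0) \<and>
     (\<forall>s\<ge>0. \<forall>t>s.
        distributed M lborel (\<lambda>\<omega>. B t \<omega> - B s \<omega>) (normal_density 0 (sqrt (t - s))) \<and>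
        prob_space.indep_set M
          {(\<lambda>\<omega>. B t \<omega> - B s \<omega>) -` A \<inter> space M | A. A \<in> sets borel} (sets (F s)))"

definition standard_brownian_motion :: "'a measure \<Rightarrow> (real \<Rightarrow> 'a \<Rightarrow> real) \<Rightarrow> bool" where
  "standard_brownian_motion M B \<longleftrightarrow>
     brownian_motion_wrt M (\<lambda>t. generated_by (space M) B {0..t}) B"


section \<open>The Ito integral and weak solutions\<close>

text \<open>A simple process is \<open>\<Sum>i<n. \<xi>\<^sub>i 1\<^bsub>(\<tau>\<^sub>i, \<tau>\<^sub>i\<^sub>+\<^sub>1]\<^esub>\<close> with deterministic times and bounded,
  \<open>F\<^bsub>\<tau>\<^sub>i\<^esub>\<close>-measurable coefficients.\<close>

definition simple_integrand ::
    "(real \<Rightarrow> 'a measure) \<Rightarrow> nat \<Rightarrow> (nat \<Rightarrow> real) \<Rightarrow> (nat \<Rightarrow> 'a \<Rightarrow> real) \<Rightarrow> bool" where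
  "simple_integrand F n \<tau> \<xi> \<longleftrightarrow>
     0 \<le> \<tau> 0 \<and> (\<forall>i<n. \<tau> i < \<tau> (Suc i)) \<and>
     (\<forall>i<n. \<xi> i \<in> borel_measurable (F (\<tau> i)) \<and> (\<exists>K. \<forall>\<omega>\<in>space (F (\<tau> i)). \<bar>\<xi> i \<omega>\<bar> \<le> K))"

definition simple_process ::
    "nat \<Rightarrow> (nat \<Rightarrow> real) \<Rightarrow> (nat \<Rightarrow> 'a \<Rightarrow> real) \<Rightarrow> real \<Rightarrow> 'a \<Rightarrow> real" where
  "simple_process n \<tau> \<xi> t \<omega> = (\<Sum>i<n. \<xi> i \<omega> * indicator {\<tau> i<..\<tau> (Suc i)} t)"

definition simple_integral ::
    "(real \<Rightarrow> 'a \<Rightarrow> real) \<Rightarrow> nat \<Rightarrow> (nat \<Rightarrow> real) \<Rightarrow> (nat \<Rightarrow> 'a \<Rightarrow> real) \<Rightarrow> real \<Rightarrow> 'a \<Rightarrow> real" where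
  "simple_integral W n \<tau> \<xi> t \<omega> =
     (\<Sum>i<n. \<xi> i \<omega> * (W (min t (\<tau> (Suc i))) \<omega> - W (min t (\<tau> i)) \<omega>))"

definition progressively_measurable ::
    "(real \<Rightarrow> 'a measure) \<Rightarrow> (real \<Rightarrow> 'a \<Rightarrow> real) \<Rightarrow> bool" where
  "progressively_measurable F H \<longleftrightarrow>
     (\<forall>t\<ge>0. (\<lambda>(s, \<omega>). H s \<omega>) \<in> borel_measurable (restrict_space borel {0..t} \<Otimes>\<^sub>M F t))"

text \<open>\<open>ito_integral M F W H J\<close> says that \<open>J\<close> is a continuous version of the process
  \<open>t \<mapsto> \<integral>\<^sub>0\<^sup>t H dW\<close>, where \<open>H\<close> is progressively measurable with \<open>\<integral>\<^sub>0\<^sup>T H\<^sup>2 ds < \<infinity>\<close> almost surely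
  for all \<open>T\<close>: it is the limit, uniformly on compacts in probability, of the elementary
  integrals of simple processes approximating \<open>H\<close> in \<open>L\<^sup>2([0,T])\<close> in probability.
  It is a relation because the integral is determined only up to indistinguishability.\<close>

definition ito_integral ::
    "'a measure \<Rightarrow> (real \<Rightarrow> 'a measure) \<Rightarrow> (real \<Rightarrow> 'a \<Rightarrow> real) \<Rightarrow>
     (real \<Rightarrow> 'a \<Rightarrow> real) \<Rightarrow> (real \<Rightarrow> 'a \<Rightarrow> real) \<Rightarrow> bool" where
  "ito_integral M F W H J \<longleftrightarrow>
     progressively_measurable F H \<and>
     (AE \<omega> in M. \<forall>T\<ge>0. (\<integral>\<^sup>+s\<in>{0..T}. ennreal ((H s \<omega>)\<^sup>2) \<partial>lborel) < \<infinity>) \<and>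
     adapted F J \<and> continuous_paths M J \<and>
     (\<exists>n \<tau> \<xi>. (\<forall>k :: nat. simple_integrand F (n k) (\<tau> k) (\<xi> k)) \<and>
        (\<forall>T\<ge>0. \<forall>\<delta>>0.
           (\<lambda>k. measure M {\<omega> \<in> space M.
              (\<integral>\<^sup>+s\<in>{0..T}. ennreal ((simple_process (n k) (\<tau> k) (\<xi> k) s \<omega> - H s \<omega>)\<^sup>2) \<partial>lborel)
                > ennreal \<delta>}) \<longlonglongrightarrow> 0) \<and>
        (\<forall>T\<ge>0. \<forall>\<delta>>0.
           (\<lambda>k. measure M {\<omega> \<in> space M.
              \<exists>t\<in>{0..T}. \<bar>simple_integral W (n k) (\<tau> k) (\<xi> k) t \<omega> - J t \<omega>\<bar> > \<delta>}) \<longlonglongrightarrow> 0))"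

text \<open>The assumption that \<open>s \<mapsto> \<mu> (X s \<omega>)\<close> is Lebesgue integrable on bounded intervals
  is automatic if \<open>\<mu>\<close> is Borel measurable and locally bounded.\<close>

definition weak_solution ::
    "'a measure \<Rightarrow> (real \<Rightarrow> 'a measure) \<Rightarrow> (real \<Rightarrow> real) \<Rightarrow> (real \<Rightarrow> real) \<Rightarrow> real \<Rightarrow>
     (real \<Rightarrow> 'a \<Rightarrow> real) \<Rightarrow> (real \<Rightarrow> 'a \<Rightarrow> real) \<Rightarrow> bool" where
  "weak_solution M F \<mu> \<sigma> x0 X W \<longleftrightarrow>
     usual_conditions M F \<and> brownian_motion_wrt M F W \<and>
     adapted F X \<and> continuous_paths M X \<and> (AE \<omega> in M. X 0 \<omega> = x0) \<and>
     (\<exists>J. ito_integral M F W (\<lambda>t \<omega>. \<sigma> (X t \<omega>)) J \<and>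
        (AE \<omega> in M. \<forall>t\<ge>0.
           (\<lambda>s. \<mu> (X s \<omega>)) absolutely_integrable_on {0..t} \<and>
           X t \<omega> = x0 + integral {0..t} (\<lambda>s. \<mu> (X s \<omega>)) + J t \<omega>))"

definition process_range :: "'a measure \<Rightarrow> (real \<Rightarrow> 'a \<Rightarrow> real) \<Rightarrow> real set" where
  "process_range M X = {x. measure M {\<omega> \<in> space M. \<exists>t\<ge>0. X t \<omega> = x} > 0}"

definition locally_bounded :: "(real \<Rightarrow> real) \<Rightarrow> bool" where
  "locally_bounded g \<longleftrightarrow> (\<forall>x. \<exists>r>0. bounded (g ` ball x r))"

text \<open>The \<open>max\<close> implements the convention \<open>X\<^sub>s = X\<^sub>0\<close> for \<open>s < 0\<close>.\<close>

definition zoomed :: "(real \<Rightarrow> 'a \<Rightarrow> real) \<Rightarrow> real \<Rightarrow> real \<Rightarrow> 'a \<Rightarrow> real" where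
  "zoomed X \<epsilon> t \<omega> = \<epsilon> powr (- 1 / 2) * (X (max 0 (1 + \<epsilon> * t)) \<omega> - X 1 \<omega>)"


section \<open>Extensions and stable convergence\<close>

text \<open>Only the measurable space underlying \<open>N\<close> is used, not its measure.\<close>

definition is_extension :: "'a measure \<Rightarrow> 'b measure \<Rightarrow> ('a \<times> 'b) measure \<Rightarrow> bool" where
  "is_extension M N P \<longleftrightarrow>
     prob_space P \<and> sets P = sets (M \<Otimes>\<^sub>M N) \<and>
     (\<forall>A\<in>sets M. emeasure P (A \<times> space N) = emeasure M A)"

text \<open>Stable convergence of the random variables \<open>Z \<epsilon>\<close> on \<open>M\<close> to \<open>Z0\<close>, defined on the
  extension \<open>P\<close>, as \<open>\<epsilon>\<close> decreases to \<open>0\<close>.\<close>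

definition converges_stably_at_0 ::
    "'a measure \<Rightarrow> ('a \<times> 'b) measure \<Rightarrow> (real \<Rightarrow> 'a \<Rightarrow> 'c::topological_space) \<Rightarrow>
     ('a \<times> 'b \<Rightarrow> 'c) \<Rightarrow> bool" where
  "converges_stably_at_0 M P Z Z0 \<longleftrightarrow>
     (\<forall>\<epsilon>>0. Z \<epsilon> \<in> borel_measurable M) \<and> Z0 \<in> borel_measurable P \<and>
     (\<forall>(f :: 'c \<Rightarrow> real) V.
        continuous_on UNIV f \<and> bounded (range f) \<and>
        V \<in> borel_measurable M \<and> bounded (V ` space M) \<longrightarrow>
        ((\<lambda>\<epsilon>. \<integral>\<omega>. f (Z \<epsilon> \<omega>) * V \<omega> \<partial>M) \<longlongrightarrow> (\<integral>p. f (Z0 p) * V (fst p) \<partial>P)) (at_right 0))"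

end

theory Submission
  imports Defs
begin

text \<open>Near time 1 the diffusion is \<open>X\<^sub>1 + \<sigma>(X\<^sub>1) (W - W\<^sub>1)\<close> up to an error that is negligible after
  rescaling: the drift over a window of length \<open>\<epsilon>\<close> is of order \<open>\<epsilon>\<close>, and, as \<open>s \<mapsto> \<sigma>(X\<^sub>s)\<close> is almost
  surely continuous, Lenglart's inequality makes the integral of \<open>\<sigma>(X\<^sub>s) - \<sigma>(X\<^bsub>1 - \<epsilon> T\<^esub>)\<close> against \<open>W\<close>
  small compared with \<open>\<epsilon>\<^bsup>1/2\<^esup>\<close>. It remains to show that the rescaled Brownian paths on both sides
  of time 1 converge stably to Brownian motions independent of the whole \<open>\<sigma>\<close>-algebra. Their law does
  not depend on \<open>\<epsilon>\<close>. After cutting out a small window around time 1, functionals of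
  these paths at scales \<open>\<epsilon>'\<close> much smaller than \<open>\<epsilon>\<close> depend on disjoint sets of increments, so the centred
  functionals along a lacunary sequence of scales are orthogonal and, by Bessel's inequality,
  asymptotically uncorrelated with every bounded random variable.
  As all paths are continuous, this can be done in a metric space of continuous paths, which embeds
  continuously into the Skorokhod space, and it suffices to test with Lipschitz functions.\<close>

section \<open>The space of continuous paths\<close>

text \<open>The coefficient \<open>\<sigma> (X 1)\<close> depends on the very increments of
  \<open>W\<close> just before time 1 that form the first component of the limit, so at fixed
  \<epsilon> coefficient and noise are not independent. Mixing against every bounded random variable
  removes this obstacle: the coefficient is rounded to finitely many values, and the indicator of
  each value is absorbed into the test variable. The Ito integral can only be estimated forwards in
  time. Hence both sides of time 1 are compared with the coefficient frozen at the left end of the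
  window [1 - \<epsilon> m, 1 + \<epsilon> m], and only afterwards with its value at time 1. The
  integer m is at once the rescaled length of the window, the bound on rescaled Brownian increments
  and the inverse of the error; the rounding error has to be 1/m^2 because it is multiplied by
  increments of order m. Equality of laws and independence are reduced to dyadic grids: polygons
  through the grid converge to the path, and their increments are independent Gaussians.\<close>

typedef cpath = "{x :: real \<Rightarrow> real. continuous_on UNIV x \<and> (\<forall>t<0. x t = x 0)}"
  morphisms at_time Abs_cpath
  by (rule exI[of _ "\<lambda>_. 0"]) auto

definition path_of :: "(real \<Rightarrow> real) \<Rightarrow> cpath" where
  "path_of g = Abs_cpath (\<lambda>t. g (max 0 t))"

lemma at_time_path_of:
  assumes "continuous_on {0..} g"
  shows "at_time (path_of g) t = g (max 0 t)"
proof -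
  have "continuous_on UNIV (\<lambda>t. g (max 0 t))"
    by (rule continuous_on_compose2[OF assms]) (auto intro!: continuous_intros)
  then show ?thesis
    unfolding path_of_def by (subst Abs_cpath_inverse) auto
qed

lemma continuous_on_at_time: "continuous_on S (at_time x)"
  using at_time[of x] by (auto intro: continuous_on_subset)

lemma continuous_at_time_comp [continuous_intros]:
  "continuous_on S f \<Longrightarrow> continuous_on S (\<lambda>t. at_time x (f t))"
  by (rule continuous_on_compose2[OF continuous_on_at_time[of UNIV x]]) auto

lemma at_time_neg: "t \<le> 0 \<Longrightarrow> at_time x t = at_time x 0"
  using at_time[of x] by (cases "t = 0") auto

text \<open>Constancy on the negative half-line makes the values on [0,\<infinity>) determine the
  path, although continuity is stated on the whole real line.\<close>

lemma cpath_eqI: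
  assumes "\<And>t. 0 \<le> t \<Longrightarrow> at_time x t = at_time y t"
  shows "x = y"
proof -
  have "at_time x t = at_time y t" for t
    using assms[of t] assms[of 0] at_time_neg[of t x] at_time_neg[of t y] by (cases "0 \<le> t") auto
  then show ?thesis
    by (metis at_time_inject ext)
qed

section \<open>The metric of locally uniform convergence\<close>

lemma min_abs_triangle:
  fixes a b c r :: real
  assumes "0 \<le> r"
  shows "min \<bar>a - b\<bar> r \<le> min \<bar>a - c\<bar> r + min \<bar>b - c\<bar> r"
  using assms by (auto simp: min_def)

instantiation cpath :: metric_space
begin

text \<open>This metric induces uniform convergence on compact subsets of \<open>[0,\<infinity>)\<close>.\<close>

definition dist_cpath :: "cpath \<Rightarrow> cpath \<Rightarrow> real" where
  "dist_cpath x y = (SUP t\<in>{0..}. min \<bar>at_time x t - at_time y t\<bar> (1 / (1 + t)))"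

definition uniformity_cpath :: "(cpath \<times> cpath) filter" where
  "uniformity_cpath = (INF e\<in>{0<..}. principal {(x, y). dist x y < e})"

definition open_cpath :: "cpath set \<Rightarrow> bool" where
  "open_cpath S \<longleftrightarrow> (\<forall>x\<in>S. \<forall>\<^sub>F (x', y) in uniformity. x' = x \<longrightarrow> y \<in> S)"

lemma dist_cpath_bdd: "bdd_above ((\<lambda>t. min \<bar>at_time x t - at_time y t\<bar> (1 / (1 + t))) ` {0..})"
  by (rule bdd_aboveI2[where M = 1]) (auto intro!: min.coboundedI2)

lemma dist_cpath_ge:
  "0 \<le> t \<Longrightarrow> min \<bar>at_time x t - at_time y t\<bar> (1 / (1 + t)) \<le> dist x y"
  unfolding dist_cpath_def by (rule cSUP_upper[OF _ dist_cpath_bdd]) auto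

lemma dist_cpath_leI:
  "(\<And>t. 0 \<le> t \<Longrightarrow> min \<bar>at_time x t - at_time y t\<bar> (1 / (1 + t)) \<le> r) \<Longrightarrow> dist x y \<le> r"
  unfolding dist_cpath_def by (rule cSUP_least) auto

instance
proof
  fix x y z :: cpath
  show "(dist x y = 0) = (x = y)"
  proof
    assume d: "dist x y = 0"
    show "x = y"
    proof (rule cpath_eqI)
      fix t :: real assume "0 \<le> t"
      then have "min \<bar>at_time x t - at_time y t\<bar> (1 / (1 + t)) \<le> 0" "0 < 1 / (1 + t)"
        using dist_cpath_ge[of t x y] d by auto
      then show "at_time x t = at_time y t"
        by (auto simp: min_le_iff_disj)
    qed
  next
    assume "x = y"
    moreover have "dist x x \<le> 0"
      by (rule dist_cpath_leI) (auto simp: min_def)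
    moreover have "0 \<le> dist x x"
      using dist_cpath_ge[of 0 x x] by simp
    ultimately show "dist x y = 0" by simp
  qed
  show "dist x y \<le> dist x z + dist y z"
  proof (rule dist_cpath_leI)
    fix t :: real assume t: "0 \<le> t"
    have "min \<bar>at_time x t - at_time y t\<bar> (1 / (1 + t))
        \<le> min \<bar>at_time x t - at_time z t\<bar> (1 / (1 + t)) + min \<bar>at_time y t - at_time z t\<bar> (1 / (1 + t))"
      using t by (intro min_abs_triangle) auto
    also have "\<dots> \<le> dist x z + dist y z"
      by (intro add_mono dist_cpath_ge t)
    finally show "min \<bar>at_time x t - at_time y t\<bar> (1 / (1 + t)) \<le> dist x z + dist y z" .
  qed
qed (auto simp: uniformity_cpath_def open_cpath_def)

end

lemma dist_cpath_le_1: "dist (x :: cpath) y \<le> 1"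
  by (rule dist_cpath_leI) (auto intro!: min.coboundedI2)

text \<open>After time T the cutoff in the metric is at most 1/(1+T), whatever the paths do there;
  only [0,T] has to be controlled.\<close>

lemma dist_cpath_max:
  assumes "\<And>t. t \<in> {0..T} \<Longrightarrow> \<bar>at_time x t - at_time y t\<bar> \<le> r" "0 \<le> T"
  shows "dist x y \<le> max r (1 / (1 + T))"
proof (rule dist_cpath_leI)
  fix t :: real assume "0 \<le> t"
  show "min \<bar>at_time x t - at_time y t\<bar> (1 / (1 + t)) \<le> max r (1 / (1 + T))"
  proof (cases "t \<le> T")
    case True
    then show ?thesis using assms(1)[of t] \<open>0 \<le> t\<close> by auto
  next
    case False
    then have "1 / (1 + t) \<le> 1 / (1 + T)" using assms(2) by (intro divide_left_mono) auto
    then show ?thesis by auto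
  qed
qed

text \<open>The cutoff at t \<le> T is at least 1/(1+T), so when the distance is smaller, the
  minimum in the metric must be attained by the path difference.\<close>

lemma abs_at_time_diff_le_dist:
  assumes "0 \<le> t" "t \<le> T" "dist x y < 1 / (1 + T)"
  shows "\<bar>at_time x t - at_time y t\<bar> \<le> dist x y"
proof -
  have "1 / (1 + T) \<le> 1 / (1 + t)" using assms by (intro divide_left_mono) auto
  then show ?thesis
    using dist_cpath_ge[of t x y] assms by (auto simp: min_le_iff_disj)
qed

lemma tendsto_cpathI:
  assumes "\<And>T e. 0 \<le> T \<Longrightarrow> 0 < e \<Longrightarrow> eventually (\<lambda>i. \<forall>t\<in>{0..T}. \<bar>at_time (f i) t - at_time x t\<bar> \<le> e) F"
  shows "(f \<longlongrightarrow> x) F"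
proof (rule tendstoI)
  fix e :: real assume e: "0 < e"
  define T where "T = 2 / e"
  have T: "0 \<le> T" "1 / (1 + T) < e"
    using e by (auto simp: T_def field_simps intro!: add_pos_pos)
  have "eventually (\<lambda>i. \<forall>t\<in>{0..T}. \<bar>at_time (f i) t - at_time x t\<bar> \<le> e / 2) F"
    by (intro assms) (use T(1) e in auto)
  then show "eventually (\<lambda>i. dist (f i) x < e) F"
  proof eventually_elim
    case (elim i)
    then have "dist (f i) x \<le> max (e / 2) (1 / (1 + T))"
      using T(1) by (intro dist_cpath_max) auto
    then show ?case using T e by auto
  qed
qed

lemma continuous_on_eval: "continuous_on UNIV (\<lambda>x. at_time x t)"
proof -
  have *: "continuous_on UNIV (\<lambda>x. at_time x t)" if t: "0 \<le> t" for t
    unfolding continuous_on_iff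
  proof (intro ballI allI impI)
    fix x :: cpath and e :: real assume "0 < e"
    show "\<exists>d>0. \<forall>x'\<in>UNIV. dist x' x < d \<longrightarrow> dist (at_time x' t) (at_time x t) < e"
    proof (intro exI[of _ "min e (1 / (1 + t))"] conjI ballI impI)
      show "0 < min e (1 / (1 + t))" using \<open>0 < e\<close> t by auto
      fix x' assume "dist x' x < min e (1 / (1 + t))"
      then show "dist (at_time x' t) (at_time x t) < e"
        using abs_at_time_diff_le_dist[OF t order_refl, of x' x] by (auto simp: dist_real_def)
    qed
  qed
  show ?thesis
  proof (cases "0 \<le> t")
    case False
    then have "at_time x t = at_time x 0" for x by (intro at_time_neg) auto
    then show ?thesis using *[of 0] by simp
  qed (rule *)
qed

subsection \<open>Polygonal approximation\<close>

definition ramp :: "real \<Rightarrow> real" where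
  "ramp u = max 0 (min 1 u)"

text \<open>Parametrised by the starting value \<open>v 0\<close> and the increments
  \<open>v (Suc k)\<close> over cells of length 2^-n instead of by vertices: Brownian increments are
  independent, and the polygon is linear in this vector. After the last cell it is constant.\<close>

definition polygon :: "nat \<Rightarrow> nat \<Rightarrow> (nat \<Rightarrow> real) \<Rightarrow> cpath" where
  "polygon n N v = path_of (\<lambda>t. v 0 + (\<Sum>k<N. v (Suc k) * ramp (2 ^ n * t - real k)))"

definition grid_increments :: "nat \<Rightarrow> cpath \<Rightarrow> nat \<Rightarrow> real" where
  "grid_increments n x k =
     (case k of 0 \<Rightarrow> at_time x 0 | Suc j \<Rightarrow> at_time x (real (Suc j) / 2 ^ n) - at_time x (real j / 2 ^ n))"

lemma at_time_polygon:
  "at_time (polygon n N v) t = v 0 + (\<Sum>k<N. v (Suc k) * ramp (2 ^ n * max 0 t - real k))"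
  unfolding polygon_def ramp_def by (subst at_time_path_of) (auto intro!: continuous_intros)

lemma at_time_polygon_grid_increments:
  assumes "0 \<le> t" and j: "j = nat \<lfloor>2 ^ n * t\<rfloor>" and "j < N"
  defines "\<theta> \<equiv> 2 ^ n * t - real j"
  shows "at_time (polygon n N (grid_increments n x)) t
    = at_time x (real j / 2 ^ n) + \<theta> * (at_time x (real (Suc j) / 2 ^ n) - at_time x (real j / 2 ^ n))"
    and "0 \<le> \<theta>" "\<theta> \<le> 1"
proof -
  show \<theta>: "0 \<le> \<theta>" "\<theta> \<le> 1"
    using assms(1) by (auto simp: \<theta>_def j) linarith
  let ?g = "grid_increments n x"
  \<comment> \<open>Cells to the left of t have a full ramp, the cell of t contributes the fraction
    \<theta>, later cells contribute nothing. The full cells then telescope to the value at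
    j/2^n.\<close>
  have "(\<Sum>k<N. ?g (Suc k) * ramp (2 ^ n * t - real k))
      = (\<Sum>k<N. if k < j then ?g (Suc k) else if k = j then ?g (Suc k) * \<theta> else 0)"
  proof (rule sum.cong[OF refl])
    fix k assume "k \<in> {..<N}"
    consider "k < j" | "k = j" | "j < k" by linarith
    then show "?g (Suc k) * ramp (2 ^ n * t - real k)
      = (if k < j then ?g (Suc k) else if k = j then ?g (Suc k) * \<theta> else 0)"
    proof cases
      case 1
      then have "2 ^ n * t - real k \<ge> 1" using \<theta> by (simp add: \<theta>_def)
      then show ?thesis using 1 by (simp add: ramp_def)
    next
      case 2
      then show ?thesis using \<theta> by (simp add: ramp_def \<theta>_def)
    next
      case 3
      then have "2 ^ n * t - real k \<le> 0" using \<theta> by (simp add: \<theta>_def)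
      then show ?thesis using 3 by (simp add: ramp_def)
    qed
  qed
  also have "\<dots> = (\<Sum>k<j. ?g (Suc k)) + ?g (Suc j) * \<theta>"
  proof -
    have "{..<N} = {..<j} \<union> {j} \<union> {Suc j..<N}" using \<open>j < N\<close> by auto
    then have "(\<Sum>k<N. if k < j then ?g (Suc k) else if k = j then ?g (Suc k) * \<theta> else 0)
      = (\<Sum>k\<in>{..<j} \<union> {j} \<union> {Suc j..<N}. if k < j then ?g (Suc k) else if k = j then ?g (Suc k) * \<theta> else 0)"
      by simp
    also have "\<dots> = (\<Sum>k<j. ?g (Suc k)) + ?g (Suc j) * \<theta>"
      by (subst sum.union_disjoint; (subst sum.union_disjoint)?) auto
    finally show ?thesis .
  qed
  also have "(\<Sum>k<j. ?g (Suc k)) = at_time x (real j / 2 ^ n) - at_time x 0"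
    by (induction j) (auto simp: grid_increments_def)
  finally show "at_time (polygon n N ?g) t
    = at_time x (real j / 2 ^ n) + \<theta> * (at_time x (real (Suc j) / 2 ^ n) - at_time x (real j / 2 ^ n))"
    using \<open>0 \<le> t\<close> by (simp add: at_time_polygon grid_increments_def field_simps max_absorb2)
qed

lemma at_time_modulus:
  assumes "0 < e"
  shows "eventually (\<lambda>n. \<forall>s\<in>{0..T}. \<forall>u\<in>{0..T}. \<bar>s - u\<bar> \<le> 1 / 2 ^ n \<longrightarrow> \<bar>at_time x s - at_time x u\<bar> \<le> e) sequentially"
proof -
  have "uniformly_continuous_on {0..T} (at_time x)"
    by (intro compact_uniformly_continuous continuous_on_at_time) auto
  then obtain d where d: "0 < d" "\<And>s u. s \<in> {0..T} \<Longrightarrow> u \<in> {0..T} \<Longrightarrow> dist u s < d \<Longrightarrow> dist (at_time x u) (at_time x s) < e"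
    unfolding uniformly_continuous_on_def using assms by metis
  have "(\<lambda>n. (1 / 2 :: real) ^ n) \<longlonglongrightarrow> 0"
    by (intro LIMSEQ_power_zero) auto
  then have "eventually (\<lambda>n. (1 / 2 :: real) ^ n < d) sequentially"
    using d(1) by (rule order_tendstoD)
  then show ?thesis
  proof eventually_elim
    case (elim n)
    show ?case
      using d(2) elim by (force simp: dist_real_def power_divide abs_minus_commute less_imp_le)
  qed
qed

text \<open>The n 2^n cells of mesh 2^-n cover [0,n], hence eventually every [0,T], while uniform
  continuity on a compact interval controls the interpolation error.\<close>

lemma polygon_tendsto:
  "(\<lambda>n. polygon n (n * 2 ^ n) (grid_increments n x)) \<longlonglongrightarrow> x"
proof (rule tendsto_cpathI)
  fix T e :: real assume T: "0 \<le> T" and e: "0 < e"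
  obtain m :: nat where m: "T < real m" using reals_Archimedean2 by blast
  \<comment> \<open>The interval is enlarged because the right end of the cell containing t may lie
    beyond T.\<close>
  have "eventually (\<lambda>n. \<forall>s\<in>{0..T + 2}. \<forall>u\<in>{0..T + 2}. \<bar>s - u\<bar> \<le> 1 / 2 ^ n \<longrightarrow> \<bar>at_time x s - at_time x u\<bar> \<le> e / 2) sequentially"
    using e by (intro at_time_modulus) auto
  moreover have "eventually (\<lambda>n. n \<ge> m) sequentially"
    by (rule eventually_ge_at_top)
  ultimately show "eventually (\<lambda>n. \<forall>t\<in>{0..T}. \<bar>at_time (polygon n (n * 2 ^ n) (grid_increments n x)) t - at_time x t\<bar> \<le> e) sequentially"
  proof eventually_elim
    case (elim n)
    show ?case
    proof
      fix t assume t: "t \<in> {0..T}"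
      define j where "j = nat \<lfloor>2 ^ n * t\<rfloor>"
      have tn: "t < real n" using t m elim(2) by auto
      then have "2 ^ n * t < real (n * 2 ^ n)" by simp
      then have jN: "j < n * 2 ^ n"
        using t by (simp add: j_def nat_less_iff floor_less_iff)
      have "0 \<le> t" using t by simp
      define \<theta> where "\<theta> = 2 ^ n * t - real j"
      note poly = at_time_polygon_grid_increments[OF \<open>0 \<le> t\<close> j_def jN, folded \<theta>_def]
      have "real j / 2 ^ n = t - \<theta> / 2 ^ n"
        by (simp add: \<theta>_def field_simps)
      moreover have "0 \<le> \<theta> / 2 ^ n" "\<theta> / 2 ^ n \<le> 1 / 2 ^ n"
        using poly(2,3) by (auto intro: divide_right_mono)
      ultimately have jt: "\<bar>real j / 2 ^ n - t\<bar> \<le> 1 / 2 ^ n" "real j / 2 ^ n \<le> t" by auto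
      have Sj: "real (Suc j) / 2 ^ n = real j / 2 ^ n + 1 / 2 ^ n" by (simp add: add_divide_distrib)
      have le1: "(1::real) / 2 ^ n \<le> 1" by simp
      have "\<bar>at_time x (real j / 2 ^ n) - at_time x t\<bar> \<le> e / 2"
        using elim(1) jt t by auto
      moreover have "\<bar>at_time x (real (Suc j) / 2 ^ n) - at_time x (real j / 2 ^ n)\<bar> \<le> e / 2"
      proof -
        have "real (Suc j) / 2 ^ n \<in> {0..T + 2}" "real j / 2 ^ n \<in> {0..T + 2}"
          "\<bar>real (Suc j) / 2 ^ n - real j / 2 ^ n\<bar> \<le> 1 / 2 ^ n"
          using jt t le1 unfolding Sj atLeastAtMost_iff by (linarith | simp)+
        then show ?thesis using elim(1) by blast
      qed
      then have "\<theta> * \<bar>at_time x (real (Suc j) / 2 ^ n) - at_time x (real j / 2 ^ n)\<bar> \<le> 1 * (e / 2)"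
        using poly(2,3) by (intro mult_mono) auto
      then have "\<bar>\<theta> * (at_time x (real (Suc j) / 2 ^ n) - at_time x (real j / 2 ^ n))\<bar> \<le> e / 2"
        using poly(2) by (simp add: abs_mult)
      ultimately show "\<bar>at_time (polygon n (n * 2 ^ n) (grid_increments n x)) t - at_time x t\<bar> \<le> e"
        unfolding poly(1) by linarith
    qed
  qed
qed


text \<open>Ramps take values in [0,1], so the distance of two polygons is at most a sum of finitely
  many coordinate differences, which is continuous for the product topology.\<close>

lemma continuous_on_polygon: "continuous_on UNIV (polygon n N)"
proof -
  define \<delta> where "\<delta> = (\<lambda>v u. \<bar>v 0 - u 0\<bar> + (\<Sum>k<N. \<bar>v (Suc k) - u (Suc k)\<bar>) :: real)"
  have le: "dist (polygon n N v) (polygon n N u) \<le> \<delta> v u" for v u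
  proof (rule dist_cpath_leI, rule min.coboundedI1)
    fix t :: real
    have "\<bar>(v 0 + (\<Sum>k<N. v (Suc k) * ramp (2 ^ n * max 0 t - real k)))
        - (u 0 + (\<Sum>k<N. u (Suc k) * ramp (2 ^ n * max 0 t - real k)))\<bar>
      = \<bar>v 0 - u 0 + (\<Sum>k<N. (v (Suc k) - u (Suc k)) * ramp (2 ^ n * max 0 t - real k))\<bar>"
      by (simp add: left_diff_distrib sum_subtractf)
    also have "\<dots> \<le> \<bar>v 0 - u 0\<bar> + \<bar>\<Sum>k<N. (v (Suc k) - u (Suc k)) * ramp (2 ^ n * max 0 t - real k)\<bar>"
      by (rule abs_triangle_ineq)
    also have "\<dots> \<le> \<bar>v 0 - u 0\<bar> + (\<Sum>k<N. \<bar>(v (Suc k) - u (Suc k)) * ramp (2 ^ n * max 0 t - real k)\<bar>)"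
      by (intro add_left_mono sum_abs)
    also have "\<dots> \<le> \<delta> v u"
      unfolding \<delta>_def abs_mult
      by (intro add_left_mono sum_mono mult_right_le_one_le) (auto simp: ramp_def)
    finally show "\<bar>at_time (polygon n N v) t - at_time (polygon n N u) t\<bar> \<le> \<delta> v u"
      unfolding at_time_polygon .
  qed
  have "((\<lambda>v. polygon n N v) \<longlongrightarrow> polygon n N u) (at u)" for u
  proof (rule metric_tendsto_imp_tendsto[where f = "\<lambda>v. \<delta> v u" and a = 0])
    have "continuous_on UNIV (\<lambda>v. \<delta> v u)"
      unfolding \<delta>_def by (intro continuous_intros continuous_on_product_coordinates)
    then have "((\<lambda>v. \<delta> v u) \<longlongrightarrow> \<delta> u u) (at u)"
      by (auto simp: continuous_on_def)
    then show "((\<lambda>v. \<delta> v u) \<longlongrightarrow> 0) (at u)" by (simp add: \<delta>_def)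
    show "\<forall>\<^sub>F v in at u. dist (polygon n N v) (polygon n N u) \<le> dist (\<delta> v u) 0"
      using le by (auto intro!: always_eventually order_trans[OF le])
  qed
  then show ?thesis by (auto simp: continuous_on_def)
qed

text \<open>Images of a countable dense set of increment vectors under the polygon maps are dense.
  Second countability makes the Borel sets of pairs of paths agree with the product sigma-algebra,
  as the independence arguments require.\<close>

instance cpath :: second_countable_topology
proof
  obtain D :: "(nat \<Rightarrow> real) set" where D: "countable D" "\<And>X. open X \<Longrightarrow> X \<noteq> {} \<Longrightarrow> \<exists>d\<in>D. d \<in> X"
    using countable_dense_exists by blast
  define E where "E = (\<Union>n. polygon n (n * 2 ^ n) ` D)"
  have E: "countable E" unfolding E_def using D(1) by auto
  have dense: "\<exists>e\<in>E. dist x e < r" if "0 < r" for x r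
  proof -
    have "eventually (\<lambda>n. dist (polygon n (n * 2 ^ n) (grid_increments n x)) x < r / 2) sequentially"
      by (rule tendstoD[OF polygon_tendsto]) (use that in simp)
    then obtain n where n: "dist (polygon n (n * 2 ^ n) (grid_increments n x)) x < r / 2"
      by (auto simp: eventually_sequentially)
    let ?X = "polygon n (n * 2 ^ n) -` ball (polygon n (n * 2 ^ n) (grid_increments n x)) (r / 2)"
    have "open ?X"
      by (intro open_vimage continuous_on_polygon) auto
    moreover have "grid_increments n x \<in> ?X" using that by simp
    ultimately obtain d where "d \<in> D" "d \<in> ?X" using D(2)[of ?X] by blast
    moreover from \<open>d \<in> ?X\<close> have "dist x (polygon n (n * 2 ^ n) d) < r"
      using n dist_triangle[of x "polygon n (n * 2 ^ n) d" "polygon n (n * 2 ^ n) (grid_increments n x)"]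
      by (simp add: dist_commute)
    ultimately show ?thesis by (auto simp: E_def)
  qed
  define B where "B = (\<lambda>(e, k). ball e (1 / real (Suc k))) ` (E \<times> (UNIV :: nat set))"
  have "topological_basis B"
  proof (rule topological_basisI)
    fix S :: "cpath set" and x assume "open S" "x \<in> S"
    then obtain r where r: "0 < r" "ball x r \<subseteq> S" by (meson openE)
    then obtain k where k: "1 / real (Suc k) < r / 2" using nat_approx_posE[of "r / 2"] by auto
    obtain e where e: "e \<in> E" "dist x e < 1 / real (Suc k)" using dense[of "1 / real (Suc k)" x] by auto
    have "ball e (1 / real (Suc k)) \<subseteq> ball x r"
    proof
      fix y assume "y \<in> ball e (1 / real (Suc k))"
      then show "y \<in> ball x r"
        using dist_triangle[of x y e] e k by simp
    qed
    then show "\<exists>b\<in>B. x \<in> b \<and> b \<subseteq> S"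
      using e r by (intro bexI[of _ "ball e (1 / real (Suc k))"]) (auto simp: B_def dist_commute)
  qed (auto simp: B_def)
  moreover have "countable B" using E by (auto simp: B_def)
  ultimately show "\<exists>B :: cpath set set. countable B \<and> open = generate_topology B"
    using topological_basis_imp_subbasis by auto
qed

subsection \<open>Measurability and laws\<close>

lemma borel_measurable_at_time [measurable]: "(\<lambda>x. at_time x t) \<in> borel_measurable borel"
  by (rule borel_measurable_continuous_onI[OF continuous_on_eval])

text \<open>A path is the limit of its polygons, and each polygon is a continuous function of the
  grid increments, which are differences of evaluations.\<close>

lemma measurable_cpathI:
  assumes [measurable]: "\<And>t. 0 \<le> t \<Longrightarrow> (\<lambda>\<omega>. at_time (Y \<omega>) t) \<in> borel_measurable M"
  shows "Y \<in> borel_measurable M"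
proof (rule borel_measurable_LIMSEQ_metric)
  show "(\<lambda>\<omega>. polygon n (n * 2 ^ n) (grid_increments n (Y \<omega>))) \<in> borel_measurable M" for n
  proof (rule measurable_compose[OF _ borel_measurable_continuous_onI[OF continuous_on_polygon]])
    show "(\<lambda>\<omega>. grid_increments n (Y \<omega>)) \<in> borel_measurable M"
    proof (rule measurable_coordinatewise_then_product)
      show "(\<lambda>\<omega>. grid_increments n (Y \<omega>) k) \<in> borel_measurable M" for k
        by (cases k) (simp_all add: grid_increments_def)
    qed
  qed
  show "(\<lambda>n. polygon n (n * 2 ^ n) (grid_increments n (Y \<omega>))) \<longlonglongrightarrow> Y \<omega>" for \<omega>
    by (rule polygon_tendsto)
qed

lemma measurable_path_of:
  assumes "\<And>t. 0 \<le> t \<Longrightarrow> g t \<in> borel_measurable M"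
    and "\<And>\<omega>. \<omega> \<in> space M \<Longrightarrow> continuous_on {0..} (\<lambda>t. g t \<omega>)"
  shows "(\<lambda>\<omega>. path_of (\<lambda>t. g t \<omega>)) \<in> borel_measurable M"
  by (rule measurable_cpathI, subst measurable_cong[OF at_time_path_of])
    (auto intro: assms)

section \<open>Identification of laws on the path space\<close>

text \<open>Approximates open sets from below by continuous functions. The whole space is excluded
  because the distance to the empty set is 0 by convention.\<close>

lemma infdist_ge_ind_tendsto:
  fixes S :: "'b :: metric_space set"
  assumes "open S" "S \<noteq> UNIV"
  shows "(\<lambda>k. min 1 (real k * infdist x (- S))) \<longlonglongrightarrow> indicator S x"
proof (cases "x \<in> S")
  case True
  then have pos: "0 < infdist x (- S)"
    using assms by (subst infdist_pos_not_in_closed) auto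
  obtain m :: nat where m: "1 / infdist x (- S) < real m" using reals_Archimedean2 by blast
  have "eventually (\<lambda>k. min 1 (real k * infdist x (- S)) = 1) sequentially"
    using eventually_ge_at_top[of m]
  proof eventually_elim
    case (elim k)
    then have "1 / infdist x (- S) \<le> real k" using m by linarith
    then show ?case using pos by (simp add: field_simps)
  qed
  then show ?thesis using True by (simp add: tendsto_eventually)
qed simp

text \<open>Dominated convergence carries the equality of integrals over to open sets, which are an
  intersection-stable generator of the Borel sets.\<close>

lemma measure_eqI_continuous:
  fixes \<mu> \<nu> :: "'b :: metric_space measure"
  assumes fin: "finite_measure \<mu>" "finite_measure \<nu>"
    and sets: "sets \<mu> = sets borel" "sets \<nu> = sets borel"
    and eq: "\<And>f :: 'b \<Rightarrow> real. continuous_on UNIV f \<Longrightarrow> (\<And>x. 0 \<le> f x) \<Longrightarrow> (\<And>x. f x \<le> 1) \<Longrightarrow>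
      (\<integral>x. f x \<partial>\<mu>) = (\<integral>x. f x \<partial>\<nu>)"
  shows "\<mu> = \<nu>"
proof -
  interpret \<mu>: finite_measure \<mu> by fact
  interpret \<nu>: finite_measure \<nu> by fact
  note [measurable_cong] = sets
  have sp: "space \<mu> = UNIV" "space \<nu> = UNIV"
    using sets_eq_imp_space_eq[OF sets(1)] sets_eq_imp_space_eq[OF sets(2)] by auto
  have "measure \<mu> UNIV = measure \<nu> UNIV"
    using eq[of "\<lambda>_. 1"] by (simp add: sp)
  then have UNIV: "emeasure \<mu> UNIV = emeasure \<nu> UNIV"
    by (simp add: \<mu>.emeasure_eq_measure \<nu>.emeasure_eq_measure)
  have "emeasure \<mu> S = emeasure \<nu> S" if "open S" for S
  proof (cases "S = UNIV")
    case False
    let ?f = "\<lambda>k x. min 1 (real k * infdist x (- S))"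
    have meas: "?f k \<in> borel_measurable borel" for k
      by (intro borel_measurable_continuous_onI continuous_intros)
    have [measurable]: "S \<in> sets borel" using that by simp
    have lim: "(\<lambda>k. \<integral>x. ?f k x \<partial>\<rho>) \<longlonglongrightarrow> (\<integral>x. indicator S x \<partial>\<rho>)"
      if "finite_measure \<rho>" and s[measurable_cong]: "sets \<rho> = sets borel" for \<rho>
    proof (rule integral_dominated_convergence[where w = "\<lambda>_. 1"])
      interpret finite_measure \<rho> by fact
      show "?f k \<in> borel_measurable \<rho>" for k using meas measurable_cong_sets[OF s refl] by blast
      show "integrable \<rho> (\<lambda>_. 1 :: real)" by simp
      show "AE x in \<rho>. norm (?f k x) \<le> 1" for k
        by (auto intro!: AE_I2 simp: infdist_nonneg abs_le_iff)
    qed (use infdist_ge_ind_tendsto[OF \<open>open S\<close> False] in auto)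
    have "(\<lambda>k. \<integral>x. ?f k x \<partial>\<mu>) = (\<lambda>k. \<integral>x. ?f k x \<partial>\<nu>)"
      by (intro ext eq continuous_intros) (auto simp: infdist_nonneg)
    then have "(\<integral>x. indicator S x \<partial>\<mu>) = (\<integral>x. indicator S x \<partial>\<nu> :: real)"
      using lim[OF fin(1) sets(1)] lim[OF fin(2) sets(2)] LIMSEQ_unique by metis
    then have "measure \<mu> S = measure \<nu> S"
      by simp
    then show ?thesis
      by (simp add: \<mu>.emeasure_eq_measure \<nu>.emeasure_eq_measure)
  qed (use UNIV in simp)
  then show ?thesis
    by (intro measure_eqI_generator_eq[where E = "{S. open S}" and \<Omega> = UNIV and A = "\<lambda>_. UNIV"])
      (auto simp: Int_stable_def sets borel_def)
qed

text \<open>For paths that start at 0 and are frozen after T, the polygons are functions of the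
  finitely many increments before T. Integrals of bounded continuous functions are therefore limits
  of integrals that depend only on the laws of the increment vectors.\<close>

lemma distr_cpath_eqI:
  assumes prob: "prob_space M" "prob_space M'"
    and Y [measurable]: "Y \<in> borel_measurable M" and Y' [measurable]: "Y' \<in> borel_measurable M'"
    and start: "\<And>\<omega>. at_time (Y \<omega>) 0 = 0" "\<And>\<omega>. at_time (Y' \<omega>) 0 = 0"
    and stop: "\<And>\<omega> t. real T \<le> t \<Longrightarrow> at_time (Y \<omega>) t = at_time (Y \<omega>) (real T)"
      "\<And>\<omega> t. real T \<le> t \<Longrightarrow> at_time (Y' \<omega>) t = at_time (Y' \<omega>) (real T)"
    and grid: "\<And>n. distr M (PiM {..<T * 2 ^ n} (\<lambda>_. borel))
        (\<lambda>\<omega>. \<lambda>k\<in>{..<T * 2 ^ n}. at_time (Y \<omega>) (real (Suc k) / 2 ^ n) - at_time (Y \<omega>) (real k / 2 ^ n))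
      = distr M' (PiM {..<T * 2 ^ n} (\<lambda>_. borel))
        (\<lambda>\<omega>. \<lambda>k\<in>{..<T * 2 ^ n}. at_time (Y' \<omega>) (real (Suc k) / 2 ^ n) - at_time (Y' \<omega>) (real k / 2 ^ n))"
  shows "distr M borel Y = distr M' borel Y'"
proof (rule measure_eqI_continuous)
  interpret M: prob_space M by fact
  interpret M': prob_space M' by fact
  show "finite_measure (distr M borel Y)" "finite_measure (distr M' borel Y')"
    using Y Y' by (auto intro: M.finite_measure_distr M'.finite_measure_distr)
  fix f :: "cpath \<Rightarrow> real"
  assume f: "continuous_on UNIV f" "\<And>x. 0 \<le> f x" "\<And>x. f x \<le> 1"
  have f_meas [measurable]: "f \<in> borel_measurable borel"
    by (rule borel_measurable_continuous_onI[OF f(1)])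
  let ?I = "\<lambda>n. {..<T * 2 ^ n}"
  \<comment> \<open>\<open>q n\<close> evaluates f at the polygon rebuilt from an increment vector.
    It starts at 0 like the paths, and the default 0 outside the index set keeps every coordinate
    measurable.\<close>
  define q where "q = (\<lambda>n v. f (polygon n (T * 2 ^ n) (\<lambda>j. case j of 0 \<Rightarrow> 0 | Suc k \<Rightarrow> if k \<in> ?I n then v k else 0)))"
  have q [measurable]: "q n \<in> borel_measurable (PiM (?I n) (\<lambda>_. borel))" for n
  proof -
    have inner: "(\<lambda>v j. case j of 0 \<Rightarrow> 0 | Suc k \<Rightarrow> if k \<in> ?I n then v k else 0) \<in> borel_measurable (PiM (?I n) (\<lambda>_. borel :: real measure))"
    proof (rule measurable_coordinatewise_then_product)
      show "(\<lambda>v. case j of 0 \<Rightarrow> 0 | Suc k \<Rightarrow> if k \<in> ?I n then v k else 0) \<in> borel_measurable (PiM (?I n) (\<lambda>_. borel :: real measure))" for j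
      proof (cases j)
        case (Suc k)
        then show ?thesis
          using measurable_component_singleton[of k "?I n" "\<lambda>_. borel :: real measure"]
          by (cases "k < T * 2 ^ n") auto
      qed simp
    qed
    have poly: "polygon n (T * 2 ^ n) \<in> borel_measurable borel"
      by (rule borel_measurable_continuous_onI[OF continuous_on_polygon])
    show ?thesis
      unfolding q_def by (rule measurable_compose[OF inner measurable_compose[OF poly f_meas]])
  qed
  have lim: "(\<lambda>n. q n (\<lambda>k\<in>?I n. at_time y (real (Suc k) / 2 ^ n) - at_time y (real k / 2 ^ n))) \<longlonglongrightarrow> f y"
    if y: "at_time y 0 = 0" "\<And>t. real T \<le> t \<Longrightarrow> at_time y t = at_time y (real T)" for y
  proof -
    have "isCont f y" using f(1) by (simp add: continuous_on_eq_continuous_at)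
    then have "(\<lambda>n. f (polygon n (n * 2 ^ n) (grid_increments n y))) \<longlonglongrightarrow> f y"
      by (rule isCont_tendsto_compose[OF _ polygon_tendsto])
    \<comment> \<open>As soon as n \<ge> T, the polygon over [0,n] adds to the one over [0,T] only
      increments after T, and these vanish.\<close>
    moreover have "eventually (\<lambda>n. f (polygon n (n * 2 ^ n) (grid_increments n y))
      = q n (\<lambda>k\<in>?I n. at_time y (real (Suc k) / 2 ^ n) - at_time y (real k / 2 ^ n))) sequentially"
      using eventually_ge_at_top[of T]
    proof eventually_elim
      case (elim n)
      have zero: "grid_increments n y (Suc k) = 0" if "T * 2 ^ n \<le> k" for k
      proof -
        have "real (T * 2 ^ n) \<le> real k" using that by (simp only: of_nat_le_iff)
        then have "real T \<le> real k / 2 ^ n" by (simp add: field_simps)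
        moreover have "real k / 2 ^ n \<le> real (Suc k) / 2 ^ n" by (intro divide_right_mono) auto
        ultimately have "at_time y (real k / 2 ^ n) = at_time y (real T)" "at_time y (real (Suc k) / 2 ^ n) = at_time y (real T)"
          by (intro y(2); linarith)+
        then show ?thesis by (simp add: grid_increments_def)
      qed
      have "polygon n (n * 2 ^ n) (grid_increments n y) = polygon n (T * 2 ^ n)
        (\<lambda>j. case j of 0 \<Rightarrow> 0 | Suc k \<Rightarrow> if k \<in> ?I n
          then (\<lambda>k\<in>?I n. at_time y (real (Suc k) / 2 ^ n) - at_time y (real k / 2 ^ n)) k else 0)"
      proof (rule cpath_eqI)
        fix t :: real assume "0 \<le> t"
        have "(\<Sum>k<n * 2 ^ n. grid_increments n y (Suc k) * ramp (2 ^ n * max 0 t - real k))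
          = (\<Sum>k<T * 2 ^ n. grid_increments n y (Suc k) * ramp (2 ^ n * max 0 t - real k))"
          using elim zero by (intro sum.mono_neutral_right) auto
        then show "at_time (polygon n (n * 2 ^ n) (grid_increments n y)) t = at_time (polygon n (T * 2 ^ n)
            (\<lambda>j. case j of 0 \<Rightarrow> 0 | Suc k \<Rightarrow> if k \<in> ?I n
              then (\<lambda>k\<in>?I n. at_time y (real (Suc k) / 2 ^ n) - at_time y (real k / 2 ^ n)) k else 0)) t"
          unfolding at_time_polygon by (auto simp: grid_increments_def y(1) intro!: sum.cong)
      qed
      then show ?case by (simp only: q_def)
    qed
    ultimately show ?thesis by (rule Lim_transform_eventually)
  qed
  have q01: "norm (q n v) \<le> 1" for n v
    using f(2,3) by (simp add: q_def)
  have conv: "(\<lambda>n. \<integral>v. q n v \<partial>distr K (PiM (?I n) (\<lambda>_. borel)) (\<lambda>\<omega>. \<lambda>k\<in>?I n. at_time (Z \<omega>) (real (Suc k) / 2 ^ n) - at_time (Z \<omega>) (real k / 2 ^ n)))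
      \<longlonglongrightarrow> (\<integral>x. f x \<partial>distr K borel Z)"
    if K: "prob_space K" and Z [measurable]: "Z \<in> borel_measurable K"
      and Z0: "\<And>\<omega>. at_time (Z \<omega>) 0 = 0" "\<And>\<omega> t. real T \<le> t \<Longrightarrow> at_time (Z \<omega>) t = at_time (Z \<omega>) (real T)" for K and Z :: "'x \<Rightarrow> cpath"
  proof -
    interpret K: prob_space K by fact
    have "(\<lambda>n. \<integral>\<omega>. q n (\<lambda>k\<in>?I n. at_time (Z \<omega>) (real (Suc k) / 2 ^ n) - at_time (Z \<omega>) (real k / 2 ^ n)) \<partial>K)
      \<longlonglongrightarrow> (\<integral>\<omega>. f (Z \<omega>) \<partial>K)"
      by (rule integral_dominated_convergence[where w = "\<lambda>_. 1"]) (use q01 lim[OF Z0] in auto)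
    then show ?thesis
      by (subst integral_distr; simp)+
  qed
  show "(\<integral>x. f x \<partial>distr M borel Y) = (\<integral>x. f x \<partial>distr M' borel Y')"
    using conv[OF prob(1) Y start(1) stop(1)] conv[OF prob(2) Y' start(2) stop(2)] unfolding grid
    by (rule LIMSEQ_unique)
qed auto

section \<open>Brownian motion\<close>

text \<open>General enough to cover both \<open>W\<close> with the given filtration and the two
  limit motions with the filtrations that they generate.\<close>

locale filtered_brownian_motion = prob_space M for M :: "'a measure" +
  fixes F :: "real \<Rightarrow> 'a measure" and B :: "real \<Rightarrow> 'a \<Rightarrow> real"
  assumes subalg: "\<And>t. 0 \<le> t \<Longrightarrow> subalgebra M (F t)"
    and filtration_mono: "\<And>s t. 0 \<le> s \<Longrightarrow> s \<le> t \<Longrightarrow> sets (F s) \<subseteq> sets (F t)"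
    and bm: "brownian_motion_wrt M F B"
begin

lemma space_F: "0 \<le> t \<Longrightarrow> space (F t) = space M"
  using subalg by (auto simp: subalgebra_def)

lemma sets_F_sets: "0 \<le> t \<Longrightarrow> A \<in> sets (F t) \<Longrightarrow> A \<in> sets M"
  using subalg by (auto simp: subalgebra_def)

lemma subalg_F: "0 \<le> s \<Longrightarrow> s \<le> t \<Longrightarrow> subalgebra (F t) (F s)"
  using filtration_mono[of s t] space_F[of s] space_F[of t] by (auto simp: subalgebra_def)

lemma measurable_F_mono: "0 \<le> s \<Longrightarrow> s \<le> t \<Longrightarrow> f \<in> measurable (F s) N \<Longrightarrow> f \<in> measurable (F t) N"
  using measurable_from_subalg[OF subalg_F] by blast

lemma measurable_F_M: "0 \<le> s \<Longrightarrow> f \<in> measurable (F s) N \<Longrightarrow> f \<in> measurable M N"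
  using measurable_from_subalg[OF subalg] by blast

lemma B_measurable_F: "0 \<le> s \<Longrightarrow> s \<le> t \<Longrightarrow> B s \<in> borel_measurable (F t)"
  using bm measurable_F_mono[of s t "B s" borel] by (auto simp: brownian_motion_wrt_def adapted_def)

lemma B_measurable [measurable (raw)]: "0 \<le> s \<Longrightarrow> B s \<in> borel_measurable M"
  using B_measurable_F[of s s] measurable_F_M by auto

lemma B_continuous: "\<omega> \<in> space M \<Longrightarrow> continuous_on {0..} (\<lambda>t. B t \<omega>)"
  using bm by (auto simp: brownian_motion_wrt_def continuous_paths_def)

lemma B_continuous_comp:
  assumes "\<omega> \<in> space M" "continuous_on S g" "\<And>t. t \<in> S \<Longrightarrow> 0 \<le> g t"
  shows "continuous_on S (\<lambda>t. B (g t) \<omega>)"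
  by (rule continuous_on_compose2[OF B_continuous[OF assms(1)] assms(2)]) (use assms(3) in auto)

lemma increment_distributed:
  "0 \<le> s \<Longrightarrow> s < t \<Longrightarrow> distributed M lborel (\<lambda>\<omega>. B t \<omega> - B s \<omega>) (normal_density 0 (sqrt (t - s)))"
  using bm by (auto simp: brownian_motion_wrt_def)

lemma increment_indep_prob:
  assumes "0 \<le> s" "s < t" "A \<in> sets (F s)" "S \<in> sets borel"
  shows "prob (A \<inter> ((\<lambda>\<omega>. B t \<omega> - B s \<omega>) -` S \<inter> space M)) = prob A * prob ((\<lambda>\<omega>. B t \<omega> - B s \<omega>) -` S \<inter> space M)"
proof -
  have "indep_set {(\<lambda>\<omega>. B t \<omega> - B s \<omega>) -` A \<inter> space M | A. A \<in> sets borel} (sets (F s))"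
    using bm assms by (auto simp: brownian_motion_wrt_def)
  from indep_setD[OF this _ assms(3), of "(\<lambda>\<omega>. B t \<omega> - B s \<omega>) -` S \<inter> space M"] assms(4) show ?thesis
    by (auto simp: Int_commute mult.commute)
qed

text \<open>The event A of the past is carried through the induction, so the joint law of the
  increments and their independence of \<open>F (t 0)\<close> come out together. Measurability at
  time \<open>t n\<close> is part of the claim because the next increment is split off from events
  of \<open>F (t n)\<close>.\<close>

lemma grid_increments_prob:
  assumes "0 \<le> t 0" "\<And>k. k < n \<Longrightarrow> t k < t (Suc k)" "A \<in> sets (F (t 0))"
    and S: "\<And>k. k < n \<Longrightarrow> S k \<in> sets borel"
  shows "prob {\<omega>\<in>A. \<forall>k<n. B (t (Suc k)) \<omega> - B (t k) \<omega> \<in> S k}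
    = prob A * (\<Prod>k<n. prob ((\<lambda>\<omega>. B (t (Suc k)) \<omega> - B (t k) \<omega>) -` S k \<inter> space M))
    \<and> {\<omega>\<in>A. \<forall>k<n. B (t (Suc k)) \<omega> - B (t k) \<omega> \<in> S k} \<in> sets (F (t n)) \<and> 0 \<le> t n"
  using assms(2) S
proof (induction n)
  case 0
  show ?case using assms(1,3) by simp
next
  case (Suc n)
  let ?E = "{\<omega>\<in>A. \<forall>k<n. B (t (Suc k)) \<omega> - B (t k) \<omega> \<in> S k}"
  let ?D = "(\<lambda>\<omega>. B (t (Suc n)) \<omega> - B (t n) \<omega>) -` S n \<inter> space M"
  have IH: "prob ?E = prob A * (\<Prod>k<n. prob ((\<lambda>\<omega>. B (t (Suc k)) \<omega> - B (t k) \<omega>) -` S k \<inter> space M))"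
    "?E \<in> sets (F (t n))" "0 \<le> t n"
    using Suc.IH[OF Suc.prems(1)[OF less_SucI] Suc.prems(2)[OF less_SucI]] by blast+
  have lt: "t n < t (Suc n)" by (rule Suc.prems(1)) simp
  have E: "{\<omega>\<in>A. \<forall>k<Suc n. B (t (Suc k)) \<omega> - B (t k) \<omega> \<in> S k} = ?E \<inter> ?D"
    using sets.sets_into_space[OF sets_F_sets[OF assms(1,3)]] unfolding All_less_Suc by auto
  have t': "0 \<le> t (Suc n)" using IH(3) lt by simp
  have S': "S n \<in> sets borel" by (rule Suc.prems(2)) simp
  have "(\<lambda>\<omega>. B (t (Suc n)) \<omega> - B (t n) \<omega>) \<in> borel_measurable (F (t (Suc n)))"
    using IH(3) lt by (intro borel_measurable_diff B_measurable_F) auto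
  from measurable_sets[OF this S'] have D: "?D \<in> sets (F (t (Suc n)))"
    by (simp only: space_F[OF t'])
  have "?E \<in> sets (F (t (Suc n)))"
    by (rule subsetD[OF filtration_mono[OF IH(3) less_imp_le[OF lt]] IH(2)])
  then have "?E \<inter> ?D \<in> sets (F (t (Suc n)))"
    using D by (rule sets.Int)
  moreover have "prob (?E \<inter> ?D) = prob ?E * prob ?D"
    by (rule increment_indep_prob[OF IH(3) lt IH(2) S'])
  moreover have "prob ?E * prob ?D = prob A * (\<Prod>k<Suc n. prob ((\<lambda>\<omega>. B (t (Suc k)) \<omega> - B (t k) \<omega>) -` S k \<inter> space M))"
    unfolding IH(1) prod.lessThan_Suc by (rule mult.assoc)
  ultimately show ?case
    using t' unfolding E by metis
qed

end

text \<open>The parameter is the variance, which is proportional to the mesh of a grid, whereas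
  \<open>normal_density\<close> takes the standard deviation.\<close>

definition gauss :: "real \<Rightarrow> real measure" where
  "gauss v = density lborel (normal_density 0 (sqrt v))"

lemma prob_space_gauss: "0 < v \<Longrightarrow> prob_space (gauss v)"
  unfolding gauss_def by (rule prob_space_normal_density) simp

lemma sets_gauss [measurable_cong, simp]: "sets (gauss v) = sets borel"
  by (simp add: gauss_def)

lemma distr_eq_PiM_gauss:
  fixes N :: nat
  assumes Q: "prob_space Q" and v: "0 < v"
    and D [measurable]: "\<And>k. k < N \<Longrightarrow> D k \<in> borel_measurable Q"
    and eq: "\<And>S. (\<And>k. k < N \<Longrightarrow> S k \<in> sets borel) \<Longrightarrow>
      measure Q {\<omega>\<in>space Q. \<forall>k<N. D k \<omega> \<in> S k} = (\<Prod>k<N. measure (gauss v) (S k))"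
  shows "distr Q (PiM {..<N} (\<lambda>_. borel)) (\<lambda>\<omega>. \<lambda>k\<in>{..<N}. D k \<omega>) = PiM {..<N} (\<lambda>_. gauss v)"
proof -
  interpret Q: prob_space Q by fact
  interpret G: prob_space "gauss v" by (rule prob_space_gauss[OF v])
  interpret PG: product_sigma_finite "\<lambda>_ :: nat. gauss v" ..
  have meas: "(\<lambda>\<omega>. \<lambda>k\<in>{..<N}. D k \<omega>) \<in> measurable Q (PiM {..<N} (\<lambda>_. borel))"
    by (rule measurable_restrict) auto
  show ?thesis
  proof (rule PG.PiM_eqI)
    show "sets (distr Q (PiM {..<N} (\<lambda>_. borel)) (\<lambda>\<omega>. \<lambda>k\<in>{..<N}. D k \<omega>)) = sets (PiM {..<N} (\<lambda>_. gauss v))"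
      by (simp cong: sets_PiM_cong)
    fix S :: "nat \<Rightarrow> real set"
    assume S: "\<And>i. i \<in> {..<N} \<Longrightarrow> S i \<in> sets (gauss v)"
    have "emeasure (distr Q (PiM {..<N} (\<lambda>_. borel)) (\<lambda>\<omega>. \<lambda>k\<in>{..<N}. D k \<omega>)) (PiE {..<N} S)
      = emeasure Q ((\<lambda>\<omega>. \<lambda>k\<in>{..<N}. D k \<omega>) -` PiE {..<N} S \<inter> space Q)"
      using S by (intro emeasure_distr meas sets_PiM_I_finite) auto
    also have "(\<lambda>\<omega>. \<lambda>k\<in>{..<N}. D k \<omega>) -` PiE {..<N} S \<inter> space Q = {\<omega>\<in>space Q. \<forall>k<N. D k \<omega> \<in> S k}"
      by (auto simp: vimage_def Pi_iff)
    also have "emeasure Q \<dots> = ennreal (\<Prod>k<N. measure (gauss v) (S k))"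
      using S by (subst Q.emeasure_eq_measure, subst eq) auto
    also have "\<dots> = (\<Prod>k\<in>{..<N}. emeasure (gauss v) (S k))"
      by (simp add: prod_ennreal G.emeasure_eq_measure)
    finally show "emeasure (distr Q (PiM {..<N} (\<lambda>_. borel)) (\<lambda>\<omega>. \<lambda>k\<in>{..<N}. D k \<omega>)) (PiE {..<N} S)
      = (\<Prod>i\<in>{..<N}. emeasure (gauss v) (S i))" .
  qed simp
qed

context filtered_brownian_motion
begin

lemma scaled_increment_gauss:
  assumes "0 \<le> s" "0 < h" "\<alpha> \<noteq> 0" "S \<in> sets borel"
  shows "prob ((\<lambda>\<omega>. \<alpha> * (B (s + h) \<omega> - B s \<omega>)) -` S \<inter> space M) = measure (gauss (\<alpha>\<^sup>2 * h)) S"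
proof -
  have "distributed M lborel (\<lambda>\<omega>. 0 + \<alpha> * (B (s + h) \<omega> - B s \<omega>)) (normal_density (0 + \<alpha> * 0) (\<bar>\<alpha>\<bar> * sqrt h))"
    by (rule normal_density_affine[OF _ _ assms(3)]) (use increment_distributed[of s "s + h"] assms in auto)
  moreover have "\<bar>\<alpha>\<bar> * sqrt h = sqrt (\<alpha>\<^sup>2 * h)" by (simp add: real_sqrt_mult)
  ultimately have d: "distributed M lborel (\<lambda>\<omega>. \<alpha> * (B (s + h) \<omega> - B s \<omega>)) (normal_density 0 (sqrt (\<alpha>\<^sup>2 * h)))"
    by simp
  have "measure (gauss (\<alpha>\<^sup>2 * h)) S = measure (distr M lborel (\<lambda>\<omega>. \<alpha> * (B (s + h) \<omega> - B s \<omega>))) S"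
    unfolding gauss_def distributed_distr_eq_density[OF d] ..
  also have "\<dots> = prob ((\<lambda>\<omega>. \<alpha> * (B (s + h) \<omega> - B s \<omega>)) -` S \<inter> space M)"
    using assms(4) distributed_measurable[OF d] by (intro measure_distr) auto
  finally show ?thesis by simp
qed

text \<open>The factor \<alpha> carries both the normalisation by \<epsilon> and the sign that time
  reversal produces.\<close>

lemma scaled_grid_increments_prob:
  assumes c: "0 \<le> c" "0 < h" "\<alpha> \<noteq> 0" "A \<in> sets (F c)" and S: "\<And>k. k < n \<Longrightarrow> S k \<in> sets borel"
  shows "prob {\<omega>\<in>A. \<forall>k<n. \<alpha> * (B (c + real (Suc k) * h) \<omega> - B (c + real k * h) \<omega>) \<in> S k}
    = prob A * (\<Prod>k<n. measure (gauss (\<alpha>\<^sup>2 * h)) (S k))"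
proof -
  let ?t = "\<lambda>k. c + real k * h"
  let ?S = "\<lambda>k. (\<lambda>x. \<alpha> * x) -` S k"
  have S': "?S k \<in> sets borel" if "k < n" for k
    using S[OF that] measurable_sets[of "\<lambda>x. \<alpha> * x" borel borel "S k"] by simp
  have "prob {\<omega>\<in>A. \<forall>k<n. \<alpha> * (B (?t (Suc k)) \<omega> - B (?t k) \<omega>) \<in> S k}
    = prob {\<omega>\<in>A. \<forall>k<n. B (?t (Suc k)) \<omega> - B (?t k) \<omega> \<in> ?S k}"
    by simp
  also have "\<dots> = prob A * (\<Prod>k<n. prob ((\<lambda>\<omega>. B (?t (Suc k)) \<omega> - B (?t k) \<omega>) -` ?S k \<inter> space M))"
    by (rule grid_increments_prob[of ?t, THEN conjunct1])
      (use c S' in \<open>simp_all add: distrib_right\<close>)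
  also have "(\<Prod>k<n. prob ((\<lambda>\<omega>. B (?t (Suc k)) \<omega> - B (?t k) \<omega>) -` ?S k \<inter> space M))
    = (\<Prod>k<n. measure (gauss (\<alpha>\<^sup>2 * h)) (S k))"
  proof (rule prod.cong[OF refl])
    fix k assume "k \<in> {..<n}"
    then show "prob ((\<lambda>\<omega>. B (?t (Suc k)) \<omega> - B (?t k) \<omega>) -` ?S k \<inter> space M) = measure (gauss (\<alpha>\<^sup>2 * h)) (S k)"
      using scaled_increment_gauss[of "?t k" h \<alpha> "S k"] c S
      by (simp add: distrib_right add.assoc add.commute[of h] vimage_def)
  qed
  finally show ?thesis .
qed

section \<open>Rescaled windows of the Brownian path\<close>

text \<open>Stopping at T leaves only a window of length \<epsilon> T of the Brownian path, so that
  windows of different scales can be separated. The zero path outside \<open>space M\<close> lets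
  the facts on start and stop hold for every argument.\<close>

definition path_after :: "real \<Rightarrow> real \<Rightarrow> real \<Rightarrow> 'a \<Rightarrow> cpath" where
  "path_after c \<epsilon> T \<omega> =
     (if \<omega> \<in> space M then path_of (\<lambda>t. (B (c + \<epsilon> * min t T) \<omega> - B c \<omega>) / sqrt \<epsilon>) else path_of (\<lambda>_. 0))"

definition path_before :: "real \<Rightarrow> real \<Rightarrow> real \<Rightarrow> 'a \<Rightarrow> cpath" where
  "path_before c \<epsilon> T \<omega> =
     (if \<omega> \<in> space M then path_of (\<lambda>t. (B (c - \<epsilon> * min t T) \<omega> - B c \<omega>) / sqrt \<epsilon>) else path_of (\<lambda>_. 0))"

lemma at_time_path_after:
  assumes "0 \<le> c" "0 < \<epsilon>" "0 \<le> T" "\<omega> \<in> space M"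
  shows "at_time (path_after c \<epsilon> T \<omega>) t = (B (c + \<epsilon> * min (max 0 t) T) \<omega> - B c \<omega>) / sqrt \<epsilon>"
proof -
  have "continuous_on {0..} (\<lambda>t. B (c + \<epsilon> * min t T) \<omega>)"
    using assms by (intro B_continuous_comp) (auto intro!: continuous_intros)
  then have "continuous_on {0..} (\<lambda>t. (B (c + \<epsilon> * min t T) \<omega> - B c \<omega>) / sqrt \<epsilon>)"
    using assms by (intro continuous_on_divide continuous_on_diff continuous_on_const) auto
  then show ?thesis using assms by (simp add: path_after_def at_time_path_of)
qed

lemma at_time_path_before:
  assumes "\<epsilon> * T \<le> c" "0 < \<epsilon>" "0 \<le> T" "\<omega> \<in> space M"
  shows "at_time (path_before c \<epsilon> T \<omega>) t = (B (c - \<epsilon> * min (max 0 t) T) \<omega> - B c \<omega>) / sqrt \<epsilon>"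
proof -
  have "\<epsilon> * min t T \<le> c" for t
    using assms by (intro order_trans[OF mult_left_mono[of "min t T" T]]) auto
  then have "continuous_on {0..} (\<lambda>t. B (c - \<epsilon> * min t T) \<omega>)"
    using assms by (intro B_continuous_comp) (auto intro!: continuous_intros)
  then have "continuous_on {0..} (\<lambda>t. (B (c - \<epsilon> * min t T) \<omega> - B c \<omega>) / sqrt \<epsilon>)"
    using assms by (intro continuous_on_divide continuous_on_diff continuous_on_const) auto
  then show ?thesis using assms by (simp add: path_before_def at_time_path_of)
qed

lemma at_time_path_of_const: "at_time (path_of (\<lambda>_. a)) t = a"
  by (subst at_time_path_of) auto

lemma path_after_measurable:
  assumes "0 \<le> c" "0 < \<epsilon>" "0 \<le> T" "c + \<epsilon> * T \<le> u"
  shows "path_after c \<epsilon> T \<in> borel_measurable (F u)"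
proof (rule measurable_cpathI)
  fix t :: real assume "0 \<le> t"
  have le: "c + \<epsilon> * min t T \<le> u"
    using assms by (intro order_trans[OF add_left_mono[OF mult_left_mono[of "min t T" T]]]) auto
  have "0 \<le> \<epsilon> * T" using assms by simp
  then have u: "0 \<le> u" and cu: "c \<le> u" using assms by linarith+
  have [measurable]: "B (c + \<epsilon> * min t T) \<in> borel_measurable (F u)" "B c \<in> borel_measurable (F u)"
    using le cu assms \<open>0 \<le> t\<close> by (auto intro!: B_measurable_F)
  have "(\<lambda>\<omega>. (B (c + \<epsilon> * min t T) \<omega> - B c \<omega>) / sqrt \<epsilon>) \<in> borel_measurable (F u)" by simp
  then show "(\<lambda>\<omega>. at_time (path_after c \<epsilon> T \<omega>) t) \<in> borel_measurable (F u)"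
    using \<open>0 \<le> t\<close> assms u by (subst measurable_cong[OF at_time_path_after]) (auto simp: space_F)
qed

lemma path_before_measurable:
  assumes "\<epsilon> * T \<le> c" "0 < \<epsilon>" "0 \<le> T"
  shows "path_before c \<epsilon> T \<in> borel_measurable (F c)"
proof (rule measurable_cpathI)
  fix t :: real assume "0 \<le> t"
  have le: "\<epsilon> * min t T \<le> c"
    using assms by (intro order_trans[OF mult_left_mono[of "min t T" T]]) auto
  have c: "0 \<le> c" using assms mult_nonneg_nonneg[of \<epsilon> T] by linarith
  have [measurable]: "B (c - \<epsilon> * min t T) \<in> borel_measurable (F c)" "B c \<in> borel_measurable (F c)"
    using le assms \<open>0 \<le> t\<close> c by (auto intro!: B_measurable_F)
  have "(\<lambda>\<omega>. (B (c - \<epsilon> * min t T) \<omega> - B c \<omega>) / sqrt \<epsilon>) \<in> borel_measurable (F c)" by simp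
  then show "(\<lambda>\<omega>. at_time (path_before c \<epsilon> T \<omega>) t) \<in> borel_measurable (F c)"
    using \<open>0 \<le> t\<close> assms c by (subst measurable_cong[OF at_time_path_before]) (auto simp: space_F)
qed

text \<open>Conditioning on any event A of \<open>F c\<close> with positive probability gives the
  same Gaussian vector. Independence of the past is read off from this by comparison with the
  unconditioned law.\<close>

lemma path_after_grid_distr:
  assumes c: "0 \<le> c" "0 < \<epsilon>" and A: "A \<in> sets (F c)" "prob A \<noteq> 0"
  shows "distr (uniform_measure M A) (PiM {..<T * 2 ^ n} (\<lambda>_. borel))
      (\<lambda>\<omega>. \<lambda>k\<in>{..<T * 2 ^ n}. at_time (path_after c \<epsilon> (real T) \<omega>) (real (Suc k) / 2 ^ n)
        - at_time (path_after c \<epsilon> (real T) \<omega>) (real k / 2 ^ n))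
    = PiM {..<T * 2 ^ n} (\<lambda>_. gauss (1 / 2 ^ n))"
proof (rule distr_eq_PiM_gauss)
  note [measurable] = measurable_F_M[OF _ path_after_measurable[OF c _ order_refl]]
  have AM [measurable]: "A \<in> sets M" using A(1) c by (auto intro: sets_F_sets)
  have A0: "emeasure M A \<noteq> 0" "emeasure M A \<noteq> \<infinity>" using A(2) by (auto simp: emeasure_eq_measure)
  show "prob_space (uniform_measure M A)" by (rule prob_space_uniform_measure[OF A0])
  let ?D = "\<lambda>k \<omega>. at_time (path_after c \<epsilon> (real T) \<omega>) (real (Suc k) / 2 ^ n)
        - at_time (path_after c \<epsilon> (real T) \<omega>) (real k / 2 ^ n)"
  have pm [measurable]: "path_after c \<epsilon> (real T) \<in> borel_measurable M"
    using c by (intro measurable_F_M[OF _ path_after_measurable[OF c _ order_refl]]) auto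
  have D [measurable]: "?D k \<in> borel_measurable M" for k
    by measurable
  then show "?D k \<in> borel_measurable (uniform_measure M A)" for k by simp
  fix S :: "nat \<Rightarrow> real set" assume S [measurable]: "\<And>k. k < T * 2 ^ n \<Longrightarrow> S k \<in> sets borel"
  define E where "E = (\<lambda>k \<omega>. (1 / sqrt \<epsilon>) * (B (c + real (Suc k) * (\<epsilon> / 2 ^ n)) \<omega> - B (c + real k * (\<epsilon> / 2 ^ n)) \<omega>))"
  have D_eq: "?D k \<omega> = E k \<omega>"
    if "\<omega> \<in> space M" "k < T * 2 ^ n" for k \<omega>
  proof -
    have "real (Suc k) \<le> real (T * 2 ^ n)" using that(2) by (simp only: of_nat_le_iff)
    then have le: "real (Suc k) / 2 ^ n \<le> real T" by (simp add: field_simps)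
    have le2: "real k / 2 ^ n \<le> real (Suc k) / 2 ^ n" by (intro divide_right_mono) auto
    have "min (max 0 (real (Suc k) / 2 ^ n)) (real T) = real (Suc k) / 2 ^ n"
      "min (max 0 (real k / 2 ^ n)) (real T) = real k / 2 ^ n"
      using le le2 by (auto simp: min_def max_def)
    then show ?thesis
      using that c by (simp add: E_def at_time_path_after diff_divide_distrib[symmetric] mult.commute)
  qed
  have "{\<omega>\<in>space M. \<forall>k<T * 2 ^ n. ?D k \<omega> \<in> S k} \<in> sets M" by measurable
  then have "measure (uniform_measure M A) {\<omega>\<in>space M. \<forall>k<T * 2 ^ n. ?D k \<omega> \<in> S k}
    = prob (A \<inter> {\<omega>\<in>space M. \<forall>k<T * 2 ^ n. ?D k \<omega> \<in> S k}) / prob A"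
    using A0 by simp
  also have "A \<inter> {\<omega>\<in>space M. \<forall>k<T * 2 ^ n. ?D k \<omega> \<in> S k} = {\<omega>\<in>A. \<forall>k<T * 2 ^ n. E k \<omega> \<in> S k}"
  proof -
    have "(\<forall>k<T * 2 ^ n. ?D k \<omega> \<in> S k) = (\<forall>k<T * 2 ^ n. E k \<omega> \<in> S k)" if "\<omega> \<in> space M" for \<omega>
      using D_eq[OF that] by metis
    then show ?thesis using sets.sets_into_space[OF AM] by blast
  qed
  also have "prob \<dots> = prob A * (\<Prod>k<T * 2 ^ n. measure (gauss ((1 / sqrt \<epsilon>)\<^sup>2 * (\<epsilon> / 2 ^ n))) (S k))"
    unfolding E_def using c A S by (intro scaled_grid_increments_prob) auto
  also have "(1 / sqrt \<epsilon>)\<^sup>2 * (\<epsilon> / 2 ^ n) = 1 / 2 ^ n" using c by (simp add: power_divide)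
  finally show "measure (uniform_measure M A) {\<omega>\<in>space (uniform_measure M A). \<forall>k<T * 2 ^ n. ?D k \<omega> \<in> S k}
    = (\<Prod>k<T * 2 ^ n. measure (gauss (1 / 2 ^ n)) (S k))"
    using A by simp
qed simp

text \<open>Backward increments are forward increments in reverse order with the opposite sign. The
  sign disappears in the square of \<alpha>, and the order does not matter for a product of equal
  factors, so the forward statement applies with the grid started at c - \<epsilon> T.\<close>

lemma path_before_grid_distr:
  assumes c: "\<epsilon> * real T \<le> c" "0 < \<epsilon>"
  shows "distr M (PiM {..<T * 2 ^ n} (\<lambda>_. borel))
      (\<lambda>\<omega>. \<lambda>k\<in>{..<T * 2 ^ n}. at_time (path_before c \<epsilon> (real T) \<omega>) (real (Suc k) / 2 ^ n)
        - at_time (path_before c \<epsilon> (real T) \<omega>) (real k / 2 ^ n))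
    = PiM {..<T * 2 ^ n} (\<lambda>_. gauss (1 / 2 ^ n))"
proof (rule distr_eq_PiM_gauss)
  show "prob_space M" by (rule prob_space_axioms)
  let ?D = "\<lambda>k \<omega>. at_time (path_before c \<epsilon> (real T) \<omega>) (real (Suc k) / 2 ^ n)
        - at_time (path_before c \<epsilon> (real T) \<omega>) (real k / 2 ^ n)"
  have "0 \<le> \<epsilon> * real T" using c by simp
  then have c0: "0 \<le> c" using c by linarith
  have [measurable]: "path_before c \<epsilon> (real T) \<in> borel_measurable M"
    using c c0 by (intro measurable_F_M[OF _ path_before_measurable[OF c]]) auto
  show "?D k \<in> borel_measurable M" for k by measurable
  fix S :: "nat \<Rightarrow> real set" assume S: "\<And>k. k < T * 2 ^ n \<Longrightarrow> S k \<in> sets borel"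
  define N where "N = T * 2 ^ n"
  define a where "a = c - \<epsilon> * real T"
  define h where "h = \<epsilon> / 2 ^ n"
  have aN: "a + real N * h = c" by (simp add: a_def N_def h_def)
  define E where "E = (\<lambda>k \<omega>. (- 1 / sqrt \<epsilon>) * (B (a + real (Suc k) * h) \<omega> - B (a + real k * h) \<omega>))"
  \<comment> \<open>Cell k counted backwards from c is cell \<open>N - Suc k\<close> counted
    forwards from a.\<close>
  have D_eq: "?D k \<omega> = E (N - Suc k) \<omega>"
    if "\<omega> \<in> space M" "k < N" for k \<omega>
  proof -
    have "real (Suc k) \<le> real (T * 2 ^ n)" using that(2) by (simp only: of_nat_le_iff N_def)
    then have le: "real (Suc k) / 2 ^ n \<le> real T" by (simp add: field_simps)
    have le2: "real k / 2 ^ n \<le> real (Suc k) / 2 ^ n" by (intro divide_right_mono) auto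
    have min: "min (max 0 (real (Suc k) / 2 ^ n)) (real T) = real (Suc k) / 2 ^ n"
      "min (max 0 (real k / 2 ^ n)) (real T) = real k / 2 ^ n"
      using le le2 by (auto simp: min_def max_def)
    have t: "c - \<epsilon> * (real (Suc k) / 2 ^ n) = a + real (N - Suc k) * h"
      "c - \<epsilon> * (real k / 2 ^ n) = a + real (Suc (N - Suc k)) * h"
      using that(2) by (simp_all add: aN[symmetric] of_nat_diff h_def algebra_simps add_divide_distrib diff_divide_distrib)
    have "at_time (path_before c \<epsilon> (real T) \<omega>) (real (Suc k) / 2 ^ n) = (B (a + real (N - Suc k) * h) \<omega> - B c \<omega>) / sqrt \<epsilon>"
      "at_time (path_before c \<epsilon> (real T) \<omega>) (real k / 2 ^ n) = (B (a + real (Suc (N - Suc k)) * h) \<omega> - B c \<omega>) / sqrt \<epsilon>"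
      by (subst at_time_path_before[OF c of_nat_0_le_iff that(1)], unfold min t, rule refl)+
    moreover have "(x - y) / s - (z - y) / s = (- 1 / s) * (z - x)" for x y z s :: real
      by (simp add: diff_divide_distrib)
    ultimately show ?thesis by (simp only: E_def)
  qed
  have a0: "0 \<le> a" using c by (simp add: a_def)
  have [measurable]: "space M \<in> sets (F a)" using a0 sets.top[of "F a"] space_F[of a] by simp
  have "{\<omega>\<in>space M. \<forall>k<N. ?D k \<omega> \<in> S k} = {\<omega>\<in>space M. \<forall>k<N. E k \<omega> \<in> S (N - Suc k)}"
  proof -
    have "(\<forall>k<N. ?D k \<omega> \<in> S k) = (\<forall>k<N. E (N - Suc k) \<omega> \<in> S k)" if "\<omega> \<in> space M" for \<omega>
      using D_eq[OF that] by metis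
    moreover have "(\<forall>k<N. E (N - Suc k) \<omega> \<in> S k) = (\<forall>k<N. E k \<omega> \<in> S (N - Suc k))" for \<omega>
    proof -
      have "N - Suc k < N" "N - Suc (N - Suc k) = k" if "k < N" for k using that by auto
      then show ?thesis by metis
    qed
    ultimately show ?thesis by blast
  qed
  then have "prob {\<omega>\<in>space M. \<forall>k<N. ?D k \<omega> \<in> S k} = prob {\<omega>\<in>space M. \<forall>k<N. E k \<omega> \<in> S (N - Suc k)}"
    by (rule arg_cong)
  also have "\<dots> = prob (space M) * (\<Prod>k<N. measure (gauss ((- 1 / sqrt \<epsilon>)\<^sup>2 * h)) (S (N - Suc k)))"
    unfolding E_def using c a0 S by (intro scaled_grid_increments_prob) (auto simp: h_def N_def)
  also have "\<dots> = (\<Prod>k<N. measure (gauss ((- 1 / sqrt \<epsilon>)\<^sup>2 * h)) (S k))"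
    by (subst prod.nat_diff_reindex) (simp add: prob_space)
  also have "(- 1 / sqrt \<epsilon>)\<^sup>2 * h = 1 / 2 ^ n" using c by (simp add: power_divide h_def)
  finally show "prob {\<omega>\<in>space M. \<forall>k<T * 2 ^ n. ?D k \<omega> \<in> S k} = (\<Prod>k<T * 2 ^ n. measure (gauss (1 / 2 ^ n)) (S k))"
    by (simp add: N_def)
qed simp

lemma path_after_start_stop:
  assumes "0 \<le> c" "0 < \<epsilon>"
  shows "at_time (path_after c \<epsilon> (real T) \<omega>) 0 = 0"
    and "real T \<le> t \<Longrightarrow> at_time (path_after c \<epsilon> (real T) \<omega>) t = at_time (path_after c \<epsilon> (real T) \<omega>) (real T)"
  using assms
  by (cases "\<omega> \<in> space M"; simp add: at_time_path_after; simp add: path_after_def at_time_path_of_const)+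

lemma path_before_start_stop:
  assumes "\<epsilon> * real T \<le> c" "0 < \<epsilon>"
  shows "at_time (path_before c \<epsilon> (real T) \<omega>) 0 = 0"
    and "real T \<le> t \<Longrightarrow> at_time (path_before c \<epsilon> (real T) \<omega>) t = at_time (path_before c \<epsilon> (real T) \<omega>) (real T)"
  using assms
  by (cases "\<omega> \<in> space M"; simp add: at_time_path_before; simp add: path_before_def at_time_path_of_const)+

lemma path_after_measurable_M:
  assumes "0 \<le> c" "0 < \<epsilon>" "0 \<le> T"
  shows "path_after c \<epsilon> T \<in> borel_measurable M"
  using assms by (intro measurable_F_M[OF _ path_after_measurable[OF _ _ _ order_refl]]) auto

lemma path_before_measurable_M:
  assumes "\<epsilon> * T \<le> c" "0 < \<epsilon>" "0 \<le> T"
  shows "path_before c \<epsilon> T \<in> borel_measurable M"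
proof -
  have "0 \<le> \<epsilon> * T" using assms by simp
  then have "0 \<le> c" using assms by linarith
  then show ?thesis using assms by (intro measurable_F_M[OF _ path_before_measurable]) auto
qed

lemma space_sets_F: "0 \<le> c \<Longrightarrow> space M \<in> sets (F c)"
  using sets.top[of "F c"] by (simp add: space_F)

text \<open>Lets the unconditioned law be treated as the conditioned one with the whole space as
  event.\<close>

lemma uniform_measure_space: "uniform_measure M (space M) = M"
proof (rule measure_eqI)
  interpret U: prob_space "uniform_measure M (space M)"
    by (rule prob_space_uniform_measure) (simp_all add: emeasure_space_1)
  fix A assume "A \<in> sets (uniform_measure M (space M))"
  then have A: "A \<in> sets M" by simp
  then have "measure (uniform_measure M (space M)) A = prob (space M \<inter> A) / prob (space M)"
    by (intro measure_uniform_measure) (simp_all add: emeasure_space_1)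
  then have "measure (uniform_measure M (space M)) A = prob A"
    using sets.sets_into_space[OF A] by (simp add: prob_space Int_absorb1)
  then show "emeasure (uniform_measure M (space M)) A = emeasure M A"
    by (simp only: U.emeasure_eq_measure emeasure_eq_measure)
qed simp

text \<open>Conditioning on A leaves the law of the later path unchanged, and this is independence.
  Null events are treated apart because conditioning on them is meaningless.\<close>

lemma path_after_indep:
  assumes c: "0 \<le> c" "0 < \<epsilon>" and A: "A \<in> sets (F c)" and S: "S \<in> sets borel"
  shows "prob (A \<inter> (path_after c \<epsilon> (real T) -` S \<inter> space M)) = prob A * prob (path_after c \<epsilon> (real T) -` S \<inter> space M)"
proof (cases "prob A = 0")
  case True
  have [measurable]: "path_after c \<epsilon> (real T) \<in> borel_measurable M" "A \<in> sets M"
    using c A by (auto intro: path_after_measurable_M sets_F_sets)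
  have "prob (A \<inter> (path_after c \<epsilon> (real T) -` S \<inter> space M)) \<le> prob A"
    using S by (intro finite_measure_mono) auto
  then show ?thesis
    using True measure_nonneg[of M "A \<inter> (path_after c \<epsilon> (real T) -` S \<inter> space M)"] by simp
next
  case False
  have [measurable]: "path_after c \<epsilon> (real T) \<in> borel_measurable M" and AM [measurable]: "A \<in> sets M"
    using c A by (auto intro: path_after_measurable_M sets_F_sets)
  have A0: "emeasure M A \<noteq> 0" "emeasure M A \<noteq> \<infinity>" using False by (auto simp: emeasure_eq_measure)
  have "distr (uniform_measure M A) borel (path_after c \<epsilon> (real T)) = distr M borel (path_after c \<epsilon> (real T))"
  proof (rule distr_cpath_eqI)
    show "prob_space (uniform_measure M A)" by (rule prob_space_uniform_measure[OF A0])
    show "prob_space M" by (rule prob_space_axioms)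
    fix n
    show "distr (uniform_measure M A) (PiM {..<T * 2 ^ n} (\<lambda>_. borel))
      (\<lambda>\<omega>. \<lambda>k\<in>{..<T * 2 ^ n}. at_time (path_after c \<epsilon> (real T) \<omega>) (real (Suc k) / 2 ^ n)
        - at_time (path_after c \<epsilon> (real T) \<omega>) (real k / 2 ^ n))
      = distr M (PiM {..<T * 2 ^ n} (\<lambda>_. borel))
      (\<lambda>\<omega>. \<lambda>k\<in>{..<T * 2 ^ n}. at_time (path_after c \<epsilon> (real T) \<omega>) (real (Suc k) / 2 ^ n)
        - at_time (path_after c \<epsilon> (real T) \<omega>) (real k / 2 ^ n))"
      unfolding path_after_grid_distr[OF c A False]
      using path_after_grid_distr[OF c space_sets_F, of T n] c by (simp add: prob_space uniform_measure_space)
  qed (auto intro: path_after_start_stop[OF c])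
  then have "measure (distr (uniform_measure M A) borel (path_after c \<epsilon> (real T))) S
    = measure (distr M borel (path_after c \<epsilon> (real T))) S" by simp
  moreover have "measure (distr (uniform_measure M A) borel (path_after c \<epsilon> (real T))) S
    = measure (uniform_measure M A) (path_after c \<epsilon> (real T) -` S \<inter> space M)"
    using S by (subst measure_distr) auto
  moreover have "\<dots> = prob (A \<inter> (path_after c \<epsilon> (real T) -` S \<inter> space M)) / prob A"
    using S by (intro measure_uniform_measure A0) auto
  moreover have "measure (distr M borel (path_after c \<epsilon> (real T))) S = prob (path_after c \<epsilon> (real T) -` S \<inter> space M)"
    using S by (subst measure_distr) auto
  ultimately show ?thesis
    using False by (simp add: divide_eq_eq mult.commute)
qed

end

text \<open>The grid law mentions neither the motion nor the base point nor the scale. The two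
  motions may live on different probability spaces, as \<open>W\<close> and the limit motions
  do.\<close>

lemma path_after_distr_eq:
  assumes "filtered_brownian_motion M F B" "filtered_brownian_motion M' F' B'"
    and "0 \<le> c" "0 < \<epsilon>" "0 \<le> c'" "0 < \<epsilon>'"
  shows "distr M borel (filtered_brownian_motion.path_after M B c \<epsilon> (real T))
    = distr M' borel (filtered_brownian_motion.path_after M' B' c' \<epsilon>' (real T))"
proof -
  interpret B: filtered_brownian_motion M F B by fact
  interpret B': filtered_brownian_motion M' F' B' by fact
  show ?thesis
  proof (rule distr_cpath_eqI)
    show "prob_space M" "prob_space M'" by (rule B.prob_space_axioms B'.prob_space_axioms)+
    fix n
    show "distr M (PiM {..<T * 2 ^ n} (\<lambda>_. borel))
      (\<lambda>\<omega>. \<lambda>k\<in>{..<T * 2 ^ n}. at_time (B.path_after c \<epsilon> (real T) \<omega>) (real (Suc k) / 2 ^ n)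
        - at_time (B.path_after c \<epsilon> (real T) \<omega>) (real k / 2 ^ n))
      = distr M' (PiM {..<T * 2 ^ n} (\<lambda>_. borel))
      (\<lambda>\<omega>. \<lambda>k\<in>{..<T * 2 ^ n}. at_time (B'.path_after c' \<epsilon>' (real T) \<omega>) (real (Suc k) / 2 ^ n)
        - at_time (B'.path_after c' \<epsilon>' (real T) \<omega>) (real k / 2 ^ n))"
      using B.path_after_grid_distr[OF assms(3,4) B.space_sets_F, of T n]
        B'.path_after_grid_distr[OF assms(5,6) B'.space_sets_F, of T n] assms
      by (simp add: B.prob_space B'.prob_space B.uniform_measure_space B'.uniform_measure_space)
  qed (use assms in \<open>auto intro: B.path_after_start_stop B'.path_after_start_stop
      B.path_after_measurable_M B'.path_after_measurable_M\<close>)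
qed

text \<open>Time reversal: a backward window has the law of a forward one. This is why the limit to
  the left of time 1 is again a Brownian motion.\<close>

lemma path_before_distr_eq:
  assumes "filtered_brownian_motion M F B" "filtered_brownian_motion M' F' B'"
    and "\<epsilon> * real T \<le> c" "0 < \<epsilon>" "0 \<le> c'" "0 < \<epsilon>'"
  shows "distr M borel (filtered_brownian_motion.path_before M B c \<epsilon> (real T))
    = distr M' borel (filtered_brownian_motion.path_after M' B' c' \<epsilon>' (real T))"
proof -
  interpret B: filtered_brownian_motion M F B by fact
  interpret B': filtered_brownian_motion M' F' B' by fact
  show ?thesis
  proof (rule distr_cpath_eqI)
    show "prob_space M" "prob_space M'" by (rule B.prob_space_axioms B'.prob_space_axioms)+
    fix n
    show "distr M (PiM {..<T * 2 ^ n} (\<lambda>_. borel))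
      (\<lambda>\<omega>. \<lambda>k\<in>{..<T * 2 ^ n}. at_time (B.path_before c \<epsilon> (real T) \<omega>) (real (Suc k) / 2 ^ n)
        - at_time (B.path_before c \<epsilon> (real T) \<omega>) (real k / 2 ^ n))
      = distr M' (PiM {..<T * 2 ^ n} (\<lambda>_. borel))
      (\<lambda>\<omega>. \<lambda>k\<in>{..<T * 2 ^ n}. at_time (B'.path_after c' \<epsilon>' (real T) \<omega>) (real (Suc k) / 2 ^ n)
        - at_time (B'.path_after c' \<epsilon>' (real T) \<omega>) (real k / 2 ^ n))"
      using B.path_before_grid_distr[OF assms(3,4), of n]
        B'.path_after_grid_distr[OF assms(5,6) B'.space_sets_F, of T n] assms
      by (simp add: B'.prob_space B'.uniform_measure_space)
  qed (use assms in \<open>auto intro: B.path_before_start_stop B'.path_after_start_stop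
      B.path_before_measurable_M B'.path_after_measurable_M\<close>)
qed

section \<open>Mixing of small Brownian increments\<close>

context prob_space
begin

lemma indep_var_subalgebra:
  assumes sub: "subalgebra M \<A>" "subalgebra M \<G>"
    and indep: "\<And>a b. a \<in> sets \<A> \<Longrightarrow> b \<in> sets \<G> \<Longrightarrow> prob (a \<inter> b) = prob a * prob b"
    and f: "f \<in> measurable \<A> S" and g: "g \<in> measurable \<G> T"
  shows "indep_var S f T g"
proof -
  have sp: "space \<A> = space M" "space \<G> = space M" and le: "sets \<A> \<subseteq> sets M" "sets \<G> \<subseteq> sets M"
    using sub by (auto simp: subalgebra_def)
  have "sigma_sets (space M) {f -` A \<inter> space M |A. A \<in> sets S} \<subseteq> sets \<A>"
    using f sets.sigma_sets_subset[of "{f -` A \<inter> space M |A. A \<in> sets S}" \<A>] sp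
    by (auto simp: measurable_def)
  moreover have "sigma_sets (space M) {g -` A \<inter> space M |A. A \<in> sets T} \<subseteq> sets \<G>"
    using g sets.sigma_sets_subset[of "{g -` A \<inter> space M |A. A \<in> sets T}" \<G>] sp
    by (auto simp: measurable_def)
  ultimately show ?thesis
    unfolding indep_var_eq indep_sets2_eq
    using le indep measurable_from_subalg[OF sub(1) f] measurable_from_subalg[OF sub(2) g] by blast
qed

lemma integrable_bounded_random_variable:
  fixes Y :: "'a \<Rightarrow> real"
  assumes "Y \<in> borel_measurable M" "\<And>\<omega>. \<omega> \<in> space M \<Longrightarrow> \<bar>Y \<omega>\<bar> \<le> K"
  shows "integrable M Y"
  by (rule integrable_const_bound[of _ K]) (use assms in auto)

text \<open>Bessel's inequality for orthogonal variables that are not normalised: only the uniform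
  bound K enters, as a bound K^2 on their second moments.\<close>

lemma Bessel_orthogonal_bounded:
  fixes Y :: "nat \<Rightarrow> 'a \<Rightarrow> real"
  assumes Y: "\<And>i. Y i \<in> borel_measurable M" "\<And>i \<omega>. \<omega> \<in> space M \<Longrightarrow> \<bar>Y i \<omega>\<bar> \<le> K" and K: "0 < K"
    and orth: "\<And>i j. i < j \<Longrightarrow> expectation (\<lambda>\<omega>. Y i \<omega> * Y j \<omega>) = 0"
    and V: "V \<in> borel_measurable M" "\<And>\<omega>. \<omega> \<in> space M \<Longrightarrow> \<bar>V \<omega>\<bar> \<le> K'"
  shows "(\<Sum>i<n. (expectation (\<lambda>\<omega>. Y i \<omega> * V \<omega>))\<^sup>2) \<le> K\<^sup>2 * expectation (\<lambda>\<omega>. (V \<omega>)\<^sup>2)"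
proof -
  note [measurable] = Y(1) V(1)
  define a where "a = (\<lambda>i. expectation (\<lambda>\<omega>. Y i \<omega> * V \<omega>))"
  \<comment> \<open>Residual after subtracting from V the multiples a_i/K^2 of the Y_i. Each
    subtraction lowers the second moment by 2 a_i^2/K^2 and gives back at most a_i^2/K^2; there is
    no division by the second moment of Y_i, which might vanish.\<close>
  define R where "R = (\<lambda>n \<omega>. V \<omega> - (\<Sum>i<n. a i / K\<^sup>2 * Y i \<omega>))"
  have R_bound: "\<bar>R n \<omega>\<bar> \<le> K' + (\<Sum>i<n. \<bar>a i / K\<^sup>2\<bar> * K)" if "\<omega> \<in> space M" for n \<omega>
  proof -
    have "\<bar>\<Sum>i<n. a i / K\<^sup>2 * Y i \<omega>\<bar> \<le> (\<Sum>i<n. \<bar>a i / K\<^sup>2 * Y i \<omega>\<bar>)" by (rule sum_abs)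
    also have "\<dots> \<le> (\<Sum>i<n. \<bar>a i / K\<^sup>2\<bar> * K)"
      unfolding abs_mult using Y(2)[OF that] by (intro sum_mono mult_left_mono) auto
    finally show ?thesis using V(2)[OF that] by (simp add: R_def)
  qed
  have R_meas [measurable]: "R n \<in> borel_measurable M" for n
    unfolding R_def by measurable
  have int_YV: "integrable M (\<lambda>\<omega>. Y i \<omega> * V \<omega>)" for i
    by (rule integrable_bounded_random_variable[of _ "K * K'"])
      (use Y(2) V(2) K in \<open>auto simp: abs_mult intro!: mult_mono\<close>)
  have int_YY: "integrable M (\<lambda>\<omega>. Y i \<omega> * Y j \<omega>)" for i j
    by (rule integrable_bounded_random_variable[of _ "K * K"])
      (use Y(2) K in \<open>auto simp: abs_mult intro!: mult_mono\<close>)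
  have int_RR: "integrable M (\<lambda>\<omega>. (R n \<omega>)\<^sup>2)" for n
  proof (rule integrable_bounded_random_variable)
    fix \<omega> assume "\<omega> \<in> space M"
    then show "\<bar>(R n \<omega>)\<^sup>2\<bar> \<le> (K' + (\<Sum>i<n. \<bar>a i / K\<^sup>2\<bar> * K))\<^sup>2"
      using power_mono[OF R_bound, of \<omega> n 2] by simp
  qed simp
  have RY_eq: "(\<lambda>\<omega>. R n \<omega> * Y n \<omega>) = (\<lambda>\<omega>. Y n \<omega> * V \<omega> - (\<Sum>i<n. a i / K\<^sup>2 * (Y i \<omega> * Y n \<omega>)))" for n
    by (auto simp: R_def algebra_simps sum_distrib_left)
  have int_RY: "integrable M (\<lambda>\<omega>. R n \<omega> * Y n \<omega>)" for n
    unfolding RY_eq by (intro Bochner_Integration.integrable_diff Bochner_Integration.integrable_sum integrable_mult_right int_YV int_YY)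
  have RY: "expectation (\<lambda>\<omega>. R n \<omega> * Y n \<omega>) = a n" for n
    unfolding RY_eq using int_YV int_YY orth
    by (simp add: Bochner_Integration.integral_diff Bochner_Integration.integral_sum a_def)
  have "expectation (\<lambda>\<omega>. (R n \<omega>)\<^sup>2) + (\<Sum>i<n. (a i)\<^sup>2) / K\<^sup>2 \<le> expectation (\<lambda>\<omega>. (V \<omega>)\<^sup>2)" for n
  proof (induction n)
    case 0
    then show ?case by (simp add: R_def)
  next
    case (Suc n)
    have "(\<lambda>\<omega>. (R (Suc n) \<omega>)\<^sup>2) = (\<lambda>\<omega>. (R n \<omega>)\<^sup>2 - 2 * (a n / K\<^sup>2) * (R n \<omega> * Y n \<omega>) + (a n / K\<^sup>2)\<^sup>2 * (Y n \<omega> * Y n \<omega>))"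
      by (auto simp: R_def power2_eq_square algebra_simps)
    then have "expectation (\<lambda>\<omega>. (R (Suc n) \<omega>)\<^sup>2) = expectation (\<lambda>\<omega>. (R n \<omega>)\<^sup>2) - 2 * (a n / K\<^sup>2) * a n
        + (a n / K\<^sup>2)\<^sup>2 * expectation (\<lambda>\<omega>. Y n \<omega> * Y n \<omega>)"
      using int_RR int_RY int_YY by (simp add: RY)
    also have "\<dots> \<le> expectation (\<lambda>\<omega>. (R n \<omega>)\<^sup>2) - 2 * (a n / K\<^sup>2) * a n + (a n / K\<^sup>2)\<^sup>2 * K\<^sup>2"
    proof -
      have "expectation (\<lambda>\<omega>. Y n \<omega> * Y n \<omega>) \<le> expectation (\<lambda>\<omega>. K\<^sup>2)"
      proof (rule integral_mono)
        fix \<omega> assume "\<omega> \<in> space M"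
        then have "\<bar>Y n \<omega>\<bar> * \<bar>Y n \<omega>\<bar> \<le> K * K" using Y(2) K by (intro mult_mono) auto
        then show "Y n \<omega> * Y n \<omega> \<le> K\<^sup>2" by (simp add: power2_eq_square)
      qed (use int_YY in auto)
      then show ?thesis by (intro add_left_mono mult_left_mono) (auto simp: prob_space)
    qed
    also have "\<dots> = expectation (\<lambda>\<omega>. (R n \<omega>)\<^sup>2) - (a n)\<^sup>2 / K\<^sup>2"
      using K by (simp add: power2_eq_square)
    finally show ?case using Suc by (simp add: add_divide_distrib)
  qed
  from this[of n] have "(\<Sum>i<n. (a i)\<^sup>2) / K\<^sup>2 \<le> expectation (\<lambda>\<omega>. (V \<omega>)\<^sup>2)"
    using Bochner_Integration.integral_nonneg[of M "\<lambda>\<omega>. (R n \<omega>)\<^sup>2", OF zero_le_power2] by linarith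
  then show ?thesis
    using K by (simp add: a_def pos_divide_le_eq mult.commute)
qed

text \<open>If the correlations did not tend to \<open>0\<close>, a lacunary sequence of parameters would give an
  orthogonal sequence with correlations bounded away from \<open>0\<close>, contradicting Bessel's inequality.\<close>

lemma lacunary_orthogonal_tendsto_0:
  fixes Y :: "real \<Rightarrow> 'a \<Rightarrow> real"
  assumes Y: "\<And>\<epsilon>. 0 < \<epsilon> \<Longrightarrow> \<epsilon> < b \<Longrightarrow> Y \<epsilon> \<in> borel_measurable M"
      "\<And>\<epsilon> \<omega>. 0 < \<epsilon> \<Longrightarrow> \<epsilon> < b \<Longrightarrow> \<omega> \<in> space M \<Longrightarrow> \<bar>Y \<epsilon> \<omega>\<bar> \<le> K"
    and orth: "\<And>\<epsilon> \<epsilon>'. 0 < \<epsilon>' \<Longrightarrow> \<epsilon>' \<le> \<rho> * \<epsilon> \<Longrightarrow> \<epsilon> < b \<Longrightarrow> expectation (\<lambda>\<omega>. Y \<epsilon> \<omega> * Y \<epsilon>' \<omega>) = 0"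
    and pos: "0 < K" "0 < b" "0 < \<rho>" "\<rho> \<le> 1"
    and V: "V \<in> borel_measurable M" "\<And>\<omega>. \<omega> \<in> space M \<Longrightarrow> \<bar>V \<omega>\<bar> \<le> K'"
  shows "((\<lambda>\<epsilon>. expectation (\<lambda>\<omega>. Y \<epsilon> \<omega> * V \<omega>)) \<longlongrightarrow> 0) (at_right 0)"
proof (rule ccontr)
  define a where "a = (\<lambda>\<epsilon>. expectation (\<lambda>\<omega>. Y \<epsilon> \<omega> * V \<omega>))"
  assume "\<not> ((\<lambda>\<epsilon>. expectation (\<lambda>\<omega>. Y \<epsilon> \<omega> * V \<omega>)) \<longlongrightarrow> 0) (at_right 0)"
  then obtain \<eta> where \<eta>: "0 < \<eta>" "\<not> eventually (\<lambda>\<epsilon>. \<bar>a \<epsilon>\<bar> < \<eta>) (at_right 0)"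
    unfolding tendsto_iff a_def[symmetric] by (auto simp: dist_real_def)
  have ex: "\<exists>\<epsilon>. 0 < \<epsilon> \<and> \<epsilon> < e \<and> \<eta> \<le> \<bar>a \<epsilon>\<bar>" if "0 < e" for e
    using \<eta>(2) that unfolding eventually_at_right_field by (metis not_less)
  \<comment> \<open>The next scale can always be taken below \<rho> times the present one, because
    correlations of size at least \<eta> occur at arbitrarily small parameters.\<close>
  have "\<exists>s. \<forall>n. (0 < s n \<and> s n < b \<and> \<eta> \<le> \<bar>a (s n)\<bar>) \<and> s (Suc n) \<le> \<rho> * s n"
  proof (rule dependent_nat_choice)
    show "\<exists>x. 0 < x \<and> x < b \<and> \<eta> \<le> \<bar>a x\<bar>" using ex[OF pos(2)] by blast
    fix x :: real and n :: nat assume "0 < x \<and> x < b \<and> \<eta> \<le> \<bar>a x\<bar>"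
    moreover obtain y where "0 < y" "y < \<rho> * x" "\<eta> \<le> \<bar>a y\<bar>"
      using ex[of "\<rho> * x"] calculation pos(3) by auto
    moreover have "\<rho> * x \<le> x" using calculation(1) mult_right_mono[OF pos(4), of x] by simp
    ultimately show "\<exists>y. (0 < y \<and> y < b \<and> \<eta> \<le> \<bar>a y\<bar>) \<and> y \<le> \<rho> * x"
      by (intro exI[of _ y]) auto
  qed
  then obtain s where s: "\<And>n. 0 < s n" "\<And>n. s n < b" "\<And>n. \<eta> \<le> \<bar>a (s n)\<bar>" "\<And>n. s (Suc n) \<le> \<rho> * s n"
    by blast
  have dec: "s (Suc n) \<le> s n" for n
    using s(4)[of n] mult_right_mono[OF pos(4) less_imp_le[OF s(1)[of n]]] by simp
  have lac: "s j \<le> \<rho> * s i" if "i < j" for i j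
    using lift_Suc_antimono_le[of s "Suc i" j, OF dec] that s(4)[of i] by (simp add: Suc_le_eq)
  have bessel: "real n * \<eta>\<^sup>2 \<le> K\<^sup>2 * expectation (\<lambda>\<omega>. (V \<omega>)\<^sup>2)" for n
  proof -
    have "real n * \<eta>\<^sup>2 = (\<Sum>i<n. \<eta>\<^sup>2)" by simp
    also have "\<dots> \<le> (\<Sum>i<n. \<bar>a (s i)\<bar>\<^sup>2)" using s(3) \<eta>(1) by (intro sum_mono power_mono) auto
    also have "\<dots> = (\<Sum>i<n. (expectation (\<lambda>\<omega>. Y (s i) \<omega> * V \<omega>))\<^sup>2)" by (simp add: a_def)
    also have "\<dots> \<le> K\<^sup>2 * expectation (\<lambda>\<omega>. (V \<omega>)\<^sup>2)"
    proof (rule Bessel_orthogonal_bounded)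
      show "expectation (\<lambda>\<omega>. Y (s i) \<omega> * Y (s j) \<omega>) = 0" if "i < j" for i j
        by (rule orth[OF s(1) lac[OF that] s(2)])
    qed (rule Y s V pos | assumption)+
    finally show ?thesis .
  qed
  obtain n :: nat where "K\<^sup>2 * expectation (\<lambda>\<omega>. (V \<omega>)\<^sup>2) / \<eta>\<^sup>2 < real n"
    using reals_Archimedean2 by blast
  then have "K\<^sup>2 * expectation (\<lambda>\<omega>. (V \<omega>)\<^sup>2) < real n * \<eta>\<^sup>2"
    using \<eta>(1) by (simp add: pos_divide_less_eq)
  with bessel[of n] show False by linarith
qed

end

section \<open>Removing a small window around the base point\<close>

text \<open>Forgets the first \<delta> units of time and restarts the path from 0, so that only
  increments after time \<delta> enter.\<close>

definition cut :: "real \<Rightarrow> cpath \<Rightarrow> cpath" where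
  "cut \<delta> x = path_of (\<lambda>t. at_time x (max t \<delta>) - at_time x \<delta>)"

lemma at_time_cut: "at_time (cut \<delta> x) t = at_time x (max (max 0 t) \<delta>) - at_time x \<delta>"
  unfolding cut_def by (subst at_time_path_of) (auto intro!: continuous_intros)

lemma cut_measurable [measurable]: "cut \<delta> \<in> borel_measurable borel"
  by (rule measurable_cpathI) (simp add: at_time_cut)

text \<open>By continuity at 0, the value subtracted and the part of the path that is forgotten both
  become uniformly small.\<close>

lemma cut_tendsto:
  assumes "at_time x 0 = 0"
  shows "(\<lambda>n. cut (1 / real (Suc n)) x) \<longlonglongrightarrow> x"
proof (rule tendsto_cpathI)
  fix T e :: real assume "0 \<le> T" "0 < e"
  have "isCont (at_time x) 0"
    using continuous_on_at_time[of UNIV x] by (simp add: continuous_on_eq_continuous_at)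
  then obtain d where d: "0 < d" "\<And>s. \<bar>s\<bar> < d \<Longrightarrow> \<bar>at_time x s\<bar> < e"
    using \<open>0 < e\<close> assms unfolding continuous_at_eps_delta by (auto simp: dist_real_def)
  have "eventually (\<lambda>n. 1 / real (Suc n) < d) sequentially"
    using LIMSEQ_inverse_real_of_nat d(1) by (intro order_tendstoD) (auto simp: inverse_eq_divide)
  then show "eventually (\<lambda>n. \<forall>t\<in>{0..T}. \<bar>at_time (cut (1 / real (Suc n)) x) t - at_time x t\<bar> \<le> e) sequentially"
  proof eventually_elim
    case (elim n)
    show ?case
    proof
      fix t assume t: "t \<in> {0..T}"
      have b: "\<bar>at_time x (1 / real (Suc n))\<bar> < e" using elim by (intro d) auto
      show "\<bar>at_time (cut (1 / real (Suc n)) x) t - at_time x t\<bar> \<le> e"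
      proof (cases "1 / real (Suc n) \<le> t")
        case True
        then show ?thesis using b t by (simp add: at_time_cut max_def)
      next
        case False
        then have "\<bar>at_time x t\<bar> < e" using t elim by (intro d) auto
        then show ?thesis using False t by (simp add: at_time_cut max_def)
      qed
    qed
  qed
qed

context filtered_brownian_motion
begin

text \<open>The sigma-algebra of the increments between c and c + S, encoded through one random path
  so that its independence of the past is inherited from \<open>path_after_indep\<close>.\<close>

definition future :: "real \<Rightarrow> nat \<Rightarrow> 'a measure" where
  "future c S = vimage_algebra (space M) (path_after c 1 (real S)) borel"

lemma subalgebra_future: "0 \<le> c \<Longrightarrow> subalgebra M (future c S)"
  using path_after_measurable_M[of c 1 "real S"]
  by (auto simp: subalgebra_def future_def sets_vimage_algebra2 measurable_sets)

lemma space_future [simp]: "space (future c S) = space M"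
  by (simp add: future_def)

lemma future_increment_measurable:
  assumes "0 \<le> c" "c \<le> s" "s \<le> c + real S" "c \<le> u" "u \<le> c + real S"
  shows "(\<lambda>\<omega>. B s \<omega> - B u \<omega>) \<in> borel_measurable (future c S)"
proof -
  have [measurable]: "path_after c 1 (real S) \<in> borel_measurable (future c S)"
    unfolding future_def by (rule measurable_vimage_algebra1) auto
  have "(\<lambda>\<omega>. at_time (path_after c 1 (real S) \<omega>) (s - c) - at_time (path_after c 1 (real S) \<omega>) (u - c)) \<in> borel_measurable (future c S)"
    by measurable
  then show ?thesis
  proof (rule subst[OF measurable_cong, rotated])
    fix \<omega> assume "\<omega> \<in> space (future c S)"
    then show "at_time (path_after c 1 (real S) \<omega>) (s - c) - at_time (path_after c 1 (real S) \<omega>) (u - c) = B s \<omega> - B u \<omega>"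
      using assms by (simp add: at_time_path_after)
  qed
qed

lemma future_indep:
  assumes "0 \<le> c" "A \<in> sets (F c)" "E \<in> sets (future c S)"
  shows "prob (A \<inter> E) = prob A * prob E"
proof -
  obtain X where "X \<in> sets borel" "E = path_after c 1 (real S) -` X \<inter> space M"
    using assms(3) by (auto simp: future_def sets_vimage_algebra2)
  then show ?thesis using path_after_indep[of c 1 A X S] assms by simp
qed

lemma cut_path_before:
  assumes "\<epsilon> * T \<le> c" "0 < \<epsilon>" "0 \<le> \<delta>" "\<delta> \<le> T" "\<omega> \<in> space M"
  shows "at_time (cut \<delta> (path_before c \<epsilon> T \<omega>)) t
    = (B (c - \<epsilon> * min (max (max 0 t) \<delta>) T) \<omega> - B (c - \<epsilon> * \<delta>) \<omega>) / sqrt \<epsilon>"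
  using assms by (simp add: at_time_cut at_time_path_before diff_divide_distrib max_def)

lemma cut_path_after:
  assumes "0 \<le> c" "0 < \<epsilon>" "0 \<le> \<delta>" "\<delta> \<le> T" "\<omega> \<in> space M"
  shows "at_time (cut \<delta> (path_after c \<epsilon> T \<omega>)) t
    = (B (c + \<epsilon> * min (max (max 0 t) \<delta>) T) \<omega> - B (c + \<epsilon> * \<delta>) \<omega>) / sqrt \<epsilon>"
  using assms by (simp add: at_time_cut at_time_path_after diff_divide_distrib max_def)

text \<open>The outer functional sees increments over [c - \<epsilon> T, c - \<epsilon> \<delta>]
  and [c + \<epsilon> \<delta>, c + \<epsilon> T], the inner one those over
  [c - \<epsilon>' T, c + \<epsilon>' T]. The condition \<epsilon>' T \<le> \<epsilon> \<delta> puts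
  the inner interval into the gap. As the outer increments lie on both sides of it, independence of
  past and future has to be used repeatedly.\<close>

lemma annuli_indep:
  assumes T: "0 < \<delta>" "\<delta> \<le> T" and \<epsilon>: "0 < \<epsilon>" "0 < \<epsilon>'" "\<epsilon>' * T \<le> \<epsilon> * \<delta>" "\<epsilon> * T \<le> c"
    and g: "g \<in> borel_measurable borel" and h: "h \<in> borel_measurable borel"
  shows "indep_var (borel :: real measure) (\<lambda>\<omega>. g (cut \<delta> (path_before c \<epsilon> T \<omega>), cut \<delta> (path_after c \<epsilon> T \<omega>)))
    (borel :: real measure) (\<lambda>\<omega>. h (path_before c \<epsilon>' T \<omega>, path_after c \<epsilon>' T \<omega>))"
proof -
  define a b where "a = c - \<epsilon>' * T" and "b = c + \<epsilon>' * T"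
  have "0 \<le> T" using T by simp
  have pos: "0 < \<epsilon> * \<delta>" "\<epsilon> * \<delta> \<le> \<epsilon> * T" "0 < \<epsilon>' * T" using T \<epsilon> by (auto intro: mult_left_mono)
  then have c: "0 \<le> c" "0 \<le> a" "a \<le> c" "c \<le> b" "0 \<le> b" "\<epsilon>' * T \<le> c"
    using \<epsilon> unfolding a_def b_def by linarith+
  \<comment> \<open>Horizons are integers because independence of the future was proved for integer
    windows; any integer that covers the interval will do.\<close>
  obtain S1 :: nat where S1: "2 * (\<epsilon>' * T) \<le> real S1" using real_arch_simple by blast
  obtain S2 :: nat where S2: "\<epsilon> * T \<le> real S2" using real_arch_simple by blast
  let ?I = "\<lambda>\<omega>. (path_before c \<epsilon>' T \<omega>, path_after c \<epsilon>' T \<omega>)"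
  define \<S> where "\<S> = vimage_algebra (space M) ?I borel"
  have I_F: "?I \<in> borel_measurable (F b)"
    using c \<epsilon> \<open>0 \<le> T\<close>
    by (intro borel_measurable_Pair path_after_measurable measurable_F_mono[OF _ _ path_before_measurable]) (auto simp: b_def)
  have I_future: "?I \<in> borel_measurable (future a S1)"
  proof (intro borel_measurable_Pair measurable_cpathI)
    fix t :: real assume "0 \<le> t"
    have m: "0 \<le> \<epsilon>' * min t T" "\<epsilon>' * min t T \<le> \<epsilon>' * T"
      using \<epsilon> \<open>0 \<le> t\<close> \<open>0 \<le> T\<close> by (auto intro: mult_left_mono)
    have "(\<lambda>\<omega>. (B (c - \<epsilon>' * min t T) \<omega> - B c \<omega>) / sqrt \<epsilon>') \<in> borel_measurable (future a S1)"
      using c m S1 by (intro borel_measurable_divide future_increment_measurable) (auto simp: a_def)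
    then show "(\<lambda>\<omega>. at_time (path_before c \<epsilon>' T \<omega>) t) \<in> borel_measurable (future a S1)"
      using c \<epsilon> \<open>0 \<le> t\<close> \<open>0 \<le> T\<close> by (subst measurable_cong[OF at_time_path_before]) auto
    have "(\<lambda>\<omega>. (B (c + \<epsilon>' * min t T) \<omega> - B c \<omega>) / sqrt \<epsilon>') \<in> borel_measurable (future a S1)"
      using c m S1 by (intro borel_measurable_divide future_increment_measurable) (auto simp: a_def)
    then show "(\<lambda>\<omega>. at_time (path_after c \<epsilon>' T \<omega>) t) \<in> borel_measurable (future a S1)"
      using c \<epsilon> \<open>0 \<le> t\<close> \<open>0 \<le> T\<close> by (subst measurable_cong[OF at_time_path_after]) auto
  qed
  have L: "(\<lambda>\<omega>. cut \<delta> (path_before c \<epsilon> T \<omega>)) \<in> borel_measurable (F a)"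
  proof (rule measurable_cpathI)
    fix t :: real assume "0 \<le> t"
    have "\<epsilon> * \<delta> \<le> \<epsilon> * min (max t \<delta>) T" "\<epsilon> * min (max t \<delta>) T \<le> \<epsilon> * T"
      using \<epsilon> T by (auto intro!: mult_left_mono)
    then have [measurable]: "B (c - \<epsilon> * min (max t \<delta>) T) \<in> borel_measurable (F a)" "B (c - \<epsilon> * \<delta>) \<in> borel_measurable (F a)"
      using \<epsilon> pos unfolding a_def by (intro B_measurable_F; linarith)+
    have "(\<lambda>\<omega>. (B (c - \<epsilon> * min (max t \<delta>) T) \<omega> - B (c - \<epsilon> * \<delta>) \<omega>) / sqrt \<epsilon>) \<in> borel_measurable (F a)" by measurable
    then show "(\<lambda>\<omega>. at_time (cut \<delta> (path_before c \<epsilon> T \<omega>)) t) \<in> borel_measurable (F a)"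
      using c \<epsilon> T \<open>0 \<le> t\<close> by (subst measurable_cong[OF cut_path_before]) (auto simp: space_F)
  qed
  have R: "(\<lambda>\<omega>. cut \<delta> (path_after c \<epsilon> T \<omega>)) \<in> borel_measurable (future b S2)"
  proof (rule measurable_cpathI)
    fix t :: real assume "0 \<le> t"
    have "\<epsilon> * \<delta> \<le> \<epsilon> * min (max t \<delta>) T" "\<epsilon> * min (max t \<delta>) T \<le> \<epsilon> * T"
      using \<epsilon> T by (auto intro!: mult_left_mono)
    then have "(\<lambda>\<omega>. (B (c + \<epsilon> * min (max t \<delta>) T) \<omega> - B (c + \<epsilon> * \<delta>) \<omega>) / sqrt \<epsilon>) \<in> borel_measurable (future b S2)"
      using c \<epsilon> S2 pos unfolding b_def
      by (intro borel_measurable_divide borel_measurable_const future_increment_measurable; linarith)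
    then show "(\<lambda>\<omega>. at_time (cut \<delta> (path_after c \<epsilon> T \<omega>)) t) \<in> borel_measurable (future b S2)"
      using c \<epsilon> T \<open>0 \<le> t\<close> by (subst measurable_cong[OF cut_path_after]) auto
  qed
  \<comment> \<open>Events of the past of a intersected with events of the future of b form an
    intersection-stable generator of a sigma-algebra that sees all outer increments.\<close>
  define G where "G = {A \<inter> C | A C. A \<in> sets (F a) \<and> C \<in> sets (future b S2)}"
  define \<O> where "\<O> = sigma (space M) G"
  have FM: "sets (F a) \<subseteq> sets M" "sets (F b) \<subseteq> sets M" "sets (future b S2) \<subseteq> sets M" "sets (F a) \<subseteq> sets (F b)"
    using subalg[of a] subalg[of b] subalgebra_future[of b S2] c filtration_mono[of a b] by (auto simp: subalgebra_def)
  have G_sets: "G \<subseteq> sets M" using FM unfolding G_def by blast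
  then have G_Pow: "G \<subseteq> Pow (space M)" using sets.space_closed by blast
  have \<S>_sets: "E \<in> sets (F b)" "E \<in> sets (future a S1)" if "E \<in> sets \<S>" for E
  proof -
    have "E \<in> {?I -` X \<inter> space M |X. X \<in> sets borel}"
      using that unfolding \<S>_def by (subst (asm) sets_vimage_algebra2) simp_all
    then obtain X where X: "X \<in> sets borel" "E = ?I -` X \<inter> space M"
      by blast
    then show "E \<in> sets (F b)" "E \<in> sets (future a S1)"
      using measurable_sets[OF I_F X(1)] measurable_sets[OF I_future X(1)] c by (auto simp: space_F)
  qed
  have "indep_set G (sets \<S>)"
    unfolding indep_sets2_eq
  proof (intro conjI ballI G_sets)
    show "sets \<S> \<subseteq> events" using \<S>_sets FM by blast
    fix H E assume "H \<in> G" and E: "E \<in> sets \<S>"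
    then obtain A C where AC: "A \<in> sets (F a)" "C \<in> sets (future b S2)" "H = A \<inter> C" by (auto simp: G_def)
    have Ab: "A \<in> sets (F b)" using AC FM by blast
    \<comment> \<open>The increments after b are split off first, since \<open>A \<inter> E\<close>
      is known at time b; then E, which depends on increments after a, is split off from A.\<close>
    have "H \<inter> E = (A \<inter> E) \<inter> C" using AC by auto
    also have "prob \<dots> = prob (A \<inter> E) * prob C"
      using AC Ab \<S>_sets(1)[OF E] c by (intro future_indep) auto
    also have "prob (A \<inter> E) = prob A * prob E"
      using AC \<S>_sets(2)[OF E] c by (intro future_indep) auto
    also have "prob A * prob E * prob C = (prob A * prob C) * prob E" by simp
    also have "prob A * prob C = prob H"
      unfolding AC using AC Ab c by (intro future_indep[symmetric]) auto
    finally show "prob (H \<inter> E) = prob H * prob E" .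
  qed
  moreover have "Int_stable G"
  proof (rule Int_stableI)
    fix H H' assume "H \<in> G" "H' \<in> G"
    then obtain A C A' C' where "A \<in> sets (F a)" "C \<in> sets (future b S2)" "H = A \<inter> C"
      "A' \<in> sets (F a)" "C' \<in> sets (future b S2)" "H' = A' \<inter> C'" by (auto simp: G_def)
    then show "H \<inter> H' \<in> G"
      unfolding G_def by (intro CollectI exI[of _ "A \<inter> A'"] exI[of _ "C \<inter> C'"]) auto
  qed
  moreover have "Int_stable (sets \<S>)" by (rule sets.Int_stable)
  ultimately have ind: "indep_set (sigma_sets (space M) G) (sigma_sets (space M) (sets \<S>))"
    by (rule indep_set_sigma_sets)
  have sets_\<O>: "sets \<O> = sigma_sets (space M) G" and space_\<O>: "space \<O> = space M"
    using G_Pow by (simp_all add: \<O>_def)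
  have "A \<in> sets \<O>" if "A \<in> sets (F a)" for A
  proof -
    have "A = A \<inter> space M" using that FM sets.sets_into_space[of A M] by blast
    moreover have "space M \<in> sets (future b S2)" using sets.top[of "future b S2"] by simp
    ultimately show ?thesis unfolding sets_\<O> G_def using that by blast
  qed
  then have sub1: "subalgebra \<O> (F a)" using c by (auto simp: subalgebra_def space_\<O> space_F)
  have "C \<in> sets \<O>" if "C \<in> sets (future b S2)" for C
  proof -
    have "C = space M \<inter> C" using that FM sets.sets_into_space[of C M] by blast
    moreover have "space M \<in> sets (F a)" using space_sets_F c by simp
    ultimately show ?thesis unfolding sets_\<O> G_def using that by blast
  qed
  then have sub2: "subalgebra \<O> (future b S2)" by (auto simp: subalgebra_def space_\<O>)
  show ?thesis
  proof (rule indep_var_subalgebra)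
    show "subalgebra M \<O>"
      using sets.sigma_sets_subset[OF G_sets] by (simp add: subalgebra_def space_\<O> sets_\<O>)
    show "subalgebra M \<S>"
      using \<S>_sets FM by (auto simp: subalgebra_def \<S>_def)
    show "prob (x \<inter> y) = prob x * prob y" if "x \<in> sets \<O>" "y \<in> sets \<S>" for x y
      using indep_setD[OF ind, of x y] that by (auto simp: sets_\<O>)
    show "(\<lambda>\<omega>. g (cut \<delta> (path_before c \<epsilon> T \<omega>), cut \<delta> (path_after c \<epsilon> T \<omega>))) \<in> borel_measurable \<O>"
      by (intro measurable_compose[OF borel_measurable_Pair g] measurable_from_subalg[OF sub1 L] measurable_from_subalg[OF sub2 R])
    show "(\<lambda>\<omega>. h (path_before c \<epsilon>' T \<omega>, path_after c \<epsilon>' T \<omega>)) \<in> borel_measurable \<S>"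
      unfolding \<S>_def by (intro measurable_compose[OF measurable_vimage_algebra1 h]) auto
  qed
qed

text \<open>The backward window is known at time c, and the forward window is independent of
  everything known then.\<close>

lemma two_sided_distr:
  assumes "\<epsilon> * real T \<le> c" "0 < \<epsilon>" "0 \<le> c"
  shows "distr M borel (\<lambda>\<omega>. (path_before c \<epsilon> (real T) \<omega>, path_after c \<epsilon> (real T) \<omega>))
    = distr M borel (path_before c \<epsilon> (real T)) \<Otimes>\<^sub>M distr M borel (path_after c \<epsilon> (real T))"
proof -
  have "indep_var borel (path_before c \<epsilon> (real T)) borel (path_after c \<epsilon> (real T))"
  proof (rule indep_var_subalgebra)
    let ?G = "vimage_algebra (space M) (path_after c \<epsilon> (real T)) borel"
    show "subalgebra M (F c)" using subalg assms by simp
    show "subalgebra M ?G"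
      using path_after_measurable_M[OF assms(3,2), of "real T"]
      by (auto simp: subalgebra_def sets_vimage_algebra2 measurable_sets)
    show "prob (x \<inter> y) = prob x * prob y" if "x \<in> sets (F c)" "y \<in> sets ?G" for x y
      using that path_after_indep[OF assms(3,2) that(1), of _ T] by (auto simp: sets_vimage_algebra2)
    show "path_before c \<epsilon> (real T) \<in> borel_measurable (F c)" using assms by (intro path_before_measurable) auto
    show "path_after c \<epsilon> (real T) \<in> borel_measurable ?G" by (rule measurable_vimage_algebra1) auto
  qed
  then show ?thesis by (simp add: indep_var_distribution_eq borel_prod)
qed

lemma two_sided_measurable:
  assumes "\<epsilon> * real T \<le> c" "0 < \<epsilon>" "0 \<le> c"
  shows "(\<lambda>\<omega>. (path_before c \<epsilon> (real T) \<omega>, path_after c \<epsilon> (real T) \<omega>)) \<in> borel_measurable M"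
  using assms by (intro borel_measurable_Pair path_before_measurable_M path_after_measurable_M) auto

text \<open>Scale invariance: the law of the pair is a product of two laws that do not depend on
  \<epsilon>.\<close>

lemma two_sided_expectation_eq:
  fixes h :: "cpath \<times> cpath \<Rightarrow> real"
  assumes h: "h \<in> borel_measurable borel"
    and "\<epsilon> * real T \<le> c" "0 < \<epsilon>" "\<epsilon>' * real T \<le> c" "0 < \<epsilon>'" "0 \<le> c"
  shows "expectation (\<lambda>\<omega>. h (path_before c \<epsilon> (real T) \<omega>, path_after c \<epsilon> (real T) \<omega>))
    = expectation (\<lambda>\<omega>. h (path_before c \<epsilon>' (real T) \<omega>, path_after c \<epsilon>' (real T) \<omega>))"
proof -
  note fbm = filtered_brownian_motion_axioms
  \<comment> \<open>Both backward windows are compared with the forward window of scale 1 at time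
    0.\<close>
  have b: "distr M borel (path_before c \<epsilon> (real T)) = distr M borel (path_before c \<epsilon>' (real T))"
    using path_before_distr_eq[OF fbm fbm assms(2,3), of 0 1] path_before_distr_eq[OF fbm fbm assms(4,5), of 0 1] by simp
  have a: "distr M borel (path_after c \<epsilon> (real T)) = distr M borel (path_after c \<epsilon>' (real T))"
    by (rule path_after_distr_eq[OF fbm fbm]) (use assms in auto)
  have "integral\<^sup>L (distr M borel (\<lambda>\<omega>. (path_before c \<epsilon> (real T) \<omega>, path_after c \<epsilon> (real T) \<omega>))) h
    = integral\<^sup>L (distr M borel (\<lambda>\<omega>. (path_before c \<epsilon>' (real T) \<omega>, path_after c \<epsilon>' (real T) \<omega>))) h"
    by (simp only: two_sided_distr[OF assms(2,3,6)] two_sided_distr[OF assms(4,5,6)] a b)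
  then show ?thesis
    by (simp only: integral_distr[OF two_sided_measurable[OF assms(2,3,6)] h]
        integral_distr[OF two_sided_measurable[OF assms(4,5,6)] h])
qed

text \<open>Full windows at two scales overlap near c, so their functionals need not be orthogonal.
  Testing the cut paths instead makes the lacunary argument applicable, and the mean error of this
  replacement is the same at all scales because the law is.\<close>

lemma two_sided_mixing:
  fixes f :: "cpath \<times> cpath \<Rightarrow> real"
  assumes c: "0 < c" and T: "0 < T" and f: "continuous_on UNIV f" "\<And>x. \<bar>f x\<bar> \<le> K"
    and V: "V \<in> borel_measurable M" "\<And>\<omega>. \<omega> \<in> space M \<Longrightarrow> \<bar>V \<omega>\<bar> \<le> K'"
    and m: "\<And>\<epsilon>. 0 < \<epsilon> \<Longrightarrow> \<epsilon> * real T \<le> c \<Longrightarrow>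
      expectation (\<lambda>\<omega>. f (path_before c \<epsilon> (real T) \<omega>, path_after c \<epsilon> (real T) \<omega>)) = m"
  shows "((\<lambda>\<epsilon>. expectation (\<lambda>\<omega>. f (path_before c \<epsilon> (real T) \<omega>, path_after c \<epsilon> (real T) \<omega>) * V \<omega>))
    \<longlongrightarrow> m * expectation V) (at_right 0)"
proof (rule tendstoI)
  fix r :: real assume r: "0 < r"
  define \<epsilon>0 where "\<epsilon>0 = c / real T"
  have \<epsilon>0: "0 < \<epsilon>0" using c T by (simp add: \<epsilon>0_def)
  have le: "\<epsilon> * real T \<le> c" if "\<epsilon> \<le> \<epsilon>0" for \<epsilon>
    using that T by (simp add: \<epsilon>0_def pos_le_divide_eq)
  have [measurable]: "f \<in> borel_measurable borel" by (rule borel_measurable_continuous_onI[OF f(1)])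
  note [measurable] = V(1)
  define B2 where "B2 = (\<lambda>\<epsilon> \<omega>. (path_before c \<epsilon> (real T) \<omega>, path_after c \<epsilon> (real T) \<omega>))"
  define C where "C = (\<lambda>\<delta> (x, y). (cut \<delta> x, cut \<delta> y))"
  have C [measurable]: "C \<delta> \<in> borel_measurable borel" for \<delta>
    unfolding C_def borel_prod[symmetric] by measurable
  have B2 [measurable]: "B2 \<epsilon> \<in> borel_measurable M" if "0 < \<epsilon>" "\<epsilon> \<le> \<epsilon>0" for \<epsilon>
    unfolding B2_def using two_sided_measurable le that c by auto
  have inv: "expectation (\<lambda>\<omega>. h (B2 \<epsilon> \<omega>)) = expectation (\<lambda>\<omega>. h (B2 \<epsilon>0 \<omega>))"
    if "h \<in> borel_measurable borel" "0 < \<epsilon>" "\<epsilon> \<le> \<epsilon>0" for h :: "cpath \<times> cpath \<Rightarrow> real" and \<epsilon>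
    unfolding B2_def using two_sided_expectation_eq[OF that(1)] le that \<epsilon>0 c by auto
  have K: "0 \<le> K" using f(2)[of undefined] by linarith
  have K': "0 \<le> K'"
    using V(2) not_empty by (meson abs_ge_zero all_not_in_conv order_trans)
  \<comment> \<open>By invariance of the law it suffices to make the error of cutting small at the
    single scale \<open>\<epsilon>0\<close>, the one whose window reaches back exactly to time
    0.\<close>
  have "(\<lambda>n. expectation (\<lambda>\<omega>. \<bar>f (B2 \<epsilon>0 \<omega>) - f (C (1 / real (Suc n)) (B2 \<epsilon>0 \<omega>))\<bar>)) \<longlonglongrightarrow> expectation (\<lambda>\<omega>. 0)"
  proof (rule integral_dominated_convergence[where w = "\<lambda>_. 2 * K"])
    note [measurable] = B2[OF \<epsilon>0 order_refl]
    show "(\<lambda>\<omega>. \<bar>f (B2 \<epsilon>0 \<omega>) - f (C (1 / real (Suc n)) (B2 \<epsilon>0 \<omega>))\<bar>) \<in> borel_measurable M" for n by measurable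
    show "AE \<omega> in M. (\<lambda>n. \<bar>f (B2 \<epsilon>0 \<omega>) - f (C (1 / real (Suc n)) (B2 \<epsilon>0 \<omega>))\<bar>) \<longlonglongrightarrow> 0"
    proof (rule AE_I2)
      fix \<omega> assume "\<omega> \<in> space M"
      have "(\<lambda>n. C (1 / real (Suc n)) (B2 \<epsilon>0 \<omega>)) \<longlonglongrightarrow> B2 \<epsilon>0 \<omega>"
        unfolding C_def B2_def prod.case using \<epsilon>0 le[of \<epsilon>0] c
        by (intro tendsto_Pair cut_tendsto path_before_start_stop path_after_start_stop) auto
      moreover have "isCont f (B2 \<epsilon>0 \<omega>)" using f(1) by (metis continuous_on_eq_continuous_at UNIV_I open_UNIV)
      ultimately have "(\<lambda>n. f (C (1 / real (Suc n)) (B2 \<epsilon>0 \<omega>))) \<longlonglongrightarrow> f (B2 \<epsilon>0 \<omega>)"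
        by (rule isCont_tendsto_compose[rotated])
      then have "(\<lambda>n. \<bar>f (B2 \<epsilon>0 \<omega>) - f (C (1 / real (Suc n)) (B2 \<epsilon>0 \<omega>))\<bar>) \<longlonglongrightarrow> \<bar>f (B2 \<epsilon>0 \<omega>) - f (B2 \<epsilon>0 \<omega>)\<bar>"
        by (intro tendsto_intros)
      then show "(\<lambda>n. \<bar>f (B2 \<epsilon>0 \<omega>) - f (C (1 / real (Suc n)) (B2 \<epsilon>0 \<omega>))\<bar>) \<longlonglongrightarrow> 0" by simp
    qed
    show "AE \<omega> in M. norm \<bar>f (B2 \<epsilon>0 \<omega>) - f (C (1 / real (Suc n)) (B2 \<epsilon>0 \<omega>))\<bar> \<le> 2 * K" for n
    proof (rule AE_I2)
      fix \<omega>
      show "norm \<bar>f (B2 \<epsilon>0 \<omega>) - f (C (1 / real (Suc n)) (B2 \<epsilon>0 \<omega>))\<bar> \<le> 2 * K"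
        using f(2)[of "B2 \<epsilon>0 \<omega>"] f(2)[of "C (1 / real (Suc n)) (B2 \<epsilon>0 \<omega>)"] by simp
    qed
  qed auto
  then have lim0: "(\<lambda>n. expectation (\<lambda>\<omega>. \<bar>f (B2 \<epsilon>0 \<omega>) - f (C (1 / real (Suc n)) (B2 \<epsilon>0 \<omega>))\<bar>)) \<longlonglongrightarrow> 0" by simp
  \<comment> \<open>The denominator K' + 1 remains positive when the bound on V is 0.\<close>
  have "0 < r / (3 * (K' + 1))" using r K' by simp
  from order_tendstoD(2)[OF lim0 this] obtain n where
    n: "expectation (\<lambda>\<omega>. \<bar>f (B2 \<epsilon>0 \<omega>) - f (C (1 / real (Suc n)) (B2 \<epsilon>0 \<omega>))\<bar>) < r / (3 * (K' + 1))"
    by (auto simp: eventually_sequentially)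
  define \<delta> where "\<delta> = 1 / real (Suc n)"
  \<comment> \<open>T is a positive integer and \<delta> is at most 1.\<close>
  have \<delta>: "0 < \<delta>" "\<delta> \<le> real T"
    using T by (auto simp: \<delta>_def divide_simps) (smt (verit) One_nat_def of_nat_1 of_nat_le_iff Suc_leI mult_le_cancel_left1 of_nat_0_le_iff)
  define g where "g = (\<lambda>z. f (C \<delta> z))"
  have [measurable]: "g \<in> borel_measurable borel" unfolding g_def by measurable
  have gK: "\<bar>g z\<bar> \<le> K" for z by (simp add: g_def f(2))
  define e where "e = expectation (\<lambda>\<omega>. \<bar>f (B2 \<epsilon>0 \<omega>) - g (B2 \<epsilon>0 \<omega>)\<bar>)"
  have e: "K' * e < r / 3"
  proof -
    have "e < r / (3 * (K' + 1))" using n by (simp add: e_def g_def \<delta>_def)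
    moreover have "0 \<le> e" unfolding e_def by (rule Bochner_Integration.integral_nonneg) auto
    ultimately have "(K' + 1) * e < (K' + 1) * (r / (3 * (K' + 1)))" using K' by (intro mult_strict_left_mono) auto
    moreover have "K' + 1 \<noteq> 0" using K' by simp
    then have "(K' + 1) * (r / (3 * (K' + 1))) = r / 3" by (simp add: field_simps)
    ultimately have "(K' + 1) * e < r / 3" by (simp only:)
    then show ?thesis using \<open>0 \<le> e\<close> by (simp add: distrib_right)
  qed
  define m' where "m' = expectation (\<lambda>\<omega>. g (B2 \<epsilon>0 \<omega>))"
  have m'K: "\<bar>m'\<bar> \<le> K"
  proof -
    have "\<bar>m'\<bar> \<le> expectation (\<lambda>\<omega>. \<bar>g (B2 \<epsilon>0 \<omega>)\<bar>)" unfolding m'_def by (rule integral_abs_bound)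
    also have "\<dots> \<le> expectation (\<lambda>\<omega>. K)"
      using gK K B2[OF \<epsilon>0 order_refl] by (intro integral_mono integrable_bounded_random_variable[of _ K]) auto
    finally show ?thesis by (simp add: prob_space)
  qed
  have "((\<lambda>\<epsilon>. expectation (\<lambda>\<omega>. (g (B2 \<epsilon> \<omega>) - m') * V \<omega>)) \<longlongrightarrow> 0) (at_right 0)"
  \<comment> \<open>With \<rho> = \<delta>/T the lacunarity condition is exactly the nesting of
    windows in \<open>annuli_indep\<close>. The bound is 2 K + 1 rather than 2 K because it has to
    be positive.\<close>
  proof (rule lacunary_orthogonal_tendsto_0[where b = \<epsilon>0 and K = "2 * K + 1" and \<rho> = "\<delta> / real T"])
    show "(\<lambda>\<omega>. g (B2 \<epsilon> \<omega>) - m') \<in> borel_measurable M" if "0 < \<epsilon>" "\<epsilon> < \<epsilon>0" for \<epsilon>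
    proof -
      note [measurable] = B2[OF that(1) less_imp_le[OF that(2)]]
      show ?thesis by measurable
    qed
    show "\<bar>g (B2 \<epsilon> \<omega>) - m'\<bar> \<le> 2 * K + 1" for \<epsilon> \<omega>
      using gK[of "B2 \<epsilon> \<omega>"] m'K by linarith
    fix \<epsilon> \<epsilon>' assume \<epsilon>: "0 < \<epsilon>'" "\<epsilon>' \<le> \<delta> / real T * \<epsilon>" "\<epsilon> < \<epsilon>0"
    have "0 < \<epsilon>" using \<epsilon> \<delta> T zero_less_mult_pos[of "\<delta> / real T" \<epsilon>] by auto
    have "\<epsilon>' \<le> \<epsilon>" using \<epsilon> \<delta> T \<open>0 < \<epsilon>\<close> mult_left_le_one_le[of \<epsilon> "\<delta> / real T"] by simp
    have [measurable]: "B2 \<epsilon> \<in> borel_measurable M" "B2 \<epsilon>' \<in> borel_measurable M"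
      using \<epsilon> \<open>0 < \<epsilon>\<close> \<open>\<epsilon>' \<le> \<epsilon>\<close> by (auto intro!: B2)
    have bd: "\<bar>g z - m'\<bar> \<le> 2 * K" for z
      using gK[of z] m'K by linarith
    have int: "integrable M (\<lambda>\<omega>. g (B2 \<epsilon> \<omega>) - m')" "integrable M (\<lambda>\<omega>. g (B2 \<epsilon>' \<omega>) - m')"
      "integrable M (\<lambda>\<omega>. g (B2 \<epsilon> \<omega>))"
      by (rule integrable_bounded_random_variable, measurable, rule bd)+
        (rule integrable_bounded_random_variable, measurable, rule gK)
    have "indep_var borel (\<lambda>\<omega>. (\<lambda>z. f z - m') (cut \<delta> (path_before c \<epsilon> (real T) \<omega>), cut \<delta> (path_after c \<epsilon> (real T) \<omega>)))
      borel (\<lambda>\<omega>. (\<lambda>z. g z - m') (path_before c \<epsilon>' (real T) \<omega>, path_after c \<epsilon>' (real T) \<omega>))"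
      using \<delta> \<epsilon> \<open>0 < \<epsilon>\<close> T le[of \<epsilon>] by (intro annuli_indep) (auto simp: field_simps)
    then have iv: "indep_var borel (\<lambda>\<omega>. g (B2 \<epsilon> \<omega>) - m') borel (\<lambda>\<omega>. g (B2 \<epsilon>' \<omega>) - m')"
      by (simp add: g_def C_def B2_def)
    have "expectation (\<lambda>\<omega>. (g (B2 \<epsilon> \<omega>) - m') * (g (B2 \<epsilon>' \<omega>) - m'))
      = expectation (\<lambda>\<omega>. g (B2 \<epsilon> \<omega>) - m') * expectation (\<lambda>\<omega>. g (B2 \<epsilon>' \<omega>) - m')"
      by (rule indep_var_lebesgue_integral[OF iv int(1,2)])
    moreover have "expectation (\<lambda>\<omega>. g (B2 \<epsilon> \<omega>) - m') = 0"
      using inv[of g \<epsilon>] int \<epsilon> \<open>0 < \<epsilon>\<close> by (simp add: prob_space m'_def)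
    ultimately show "expectation (\<lambda>\<omega>. (g (B2 \<epsilon> \<omega>) - m') * (g (B2 \<epsilon>' \<omega>) - m')) = 0" by simp
  qed (use K \<epsilon>0 \<delta> T V in auto)
  from tendstoD[OF this, of "r / 3"] r
  have "eventually (\<lambda>\<epsilon>. \<bar>expectation (\<lambda>\<omega>. (g (B2 \<epsilon> \<omega>) - m') * V \<omega>)\<bar> < r / 3) (at_right 0)"
    by (simp add: dist_real_def)
  moreover have "eventually (\<lambda>\<epsilon>. 0 < \<epsilon> \<and> \<epsilon> < \<epsilon>0) (at_right 0)"
    using eventually_at_right[OF \<epsilon>0] \<epsilon>0 by (auto intro!: exI[of _ \<epsilon>0])
  ultimately show "eventually (\<lambda>\<epsilon>. dist (expectation (\<lambda>\<omega>. f (path_before c \<epsilon> (real T) \<omega>, path_after c \<epsilon> (real T) \<omega>) * V \<omega>))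
    (m * expectation V) < r) (at_right 0)"
  proof eventually_elim
    case (elim \<epsilon>)
    then have \<epsilon>: "0 < \<epsilon>" "\<epsilon> \<le> \<epsilon>0" by auto
    note [measurable] = B2[OF \<epsilon>]
    have intV: "integrable M V" by (rule integrable_bounded_random_variable) (use V in auto)
    have ifV: "integrable M (\<lambda>\<omega>. h (B2 \<epsilon> \<omega>) * V \<omega>)" if "h \<in> borel_measurable borel" "\<And>z. \<bar>h z\<bar> \<le> K" for h
    proof (rule integrable_bounded_random_variable)
      note [measurable] = that(1)
      show "(\<lambda>\<omega>. h (B2 \<epsilon> \<omega>) * V \<omega>) \<in> borel_measurable M" by measurable
      show "\<bar>h (B2 \<epsilon> \<omega>) * V \<omega>\<bar> \<le> K * K'" if "\<omega> \<in> space M" for \<omega>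
        unfolding abs_mult using V(2)[OF that] K by (intro mult_mono \<open>\<And>z. \<bar>h z\<bar> \<le> K\<close>) auto
    qed
    have ih: "integrable M (\<lambda>\<omega>. h (B2 \<epsilon> \<omega>))" if "h \<in> borel_measurable borel" "\<And>z. \<bar>h z\<bar> \<le> K" for h
      by (rule integrable_bounded_random_variable[of _ K]) (use that in auto)
    note if1 = ifV[of f] ifV[of g] ih[of f] ih[of g]
    have e_eq: "expectation (\<lambda>\<omega>. \<bar>f (B2 \<epsilon> \<omega>) - g (B2 \<epsilon> \<omega>)\<bar>) = e"
      unfolding e_def using \<epsilon> by (intro inv) auto
    have iabs: "integrable M (\<lambda>\<omega>. \<bar>f (B2 \<epsilon> \<omega>) - g (B2 \<epsilon> \<omega>)\<bar>)"
      using if1 f(2) gK by auto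
    have 1: "\<bar>expectation (\<lambda>\<omega>. f (B2 \<epsilon> \<omega>) * V \<omega>) - expectation (\<lambda>\<omega>. g (B2 \<epsilon> \<omega>) * V \<omega>)\<bar> \<le> K' * e"
    proof -
      have "expectation (\<lambda>\<omega>. f (B2 \<epsilon> \<omega>) * V \<omega>) - expectation (\<lambda>\<omega>. g (B2 \<epsilon> \<omega>) * V \<omega>)
        = expectation (\<lambda>\<omega>. (f (B2 \<epsilon> \<omega>) - g (B2 \<epsilon> \<omega>)) * V \<omega>)"
        using if1 f(2) gK by (simp add: left_diff_distrib)
      also have "\<bar>\<dots>\<bar> \<le> expectation (\<lambda>\<omega>. \<bar>(f (B2 \<epsilon> \<omega>) - g (B2 \<epsilon> \<omega>)) * V \<omega>\<bar>)"
        by (rule integral_abs_bound)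
      also have "\<dots> \<le> expectation (\<lambda>\<omega>. K' * \<bar>f (B2 \<epsilon> \<omega>) - g (B2 \<epsilon> \<omega>)\<bar>)"
      proof (rule integral_mono)
        show "integrable M (\<lambda>\<omega>. \<bar>(f (B2 \<epsilon> \<omega>) - g (B2 \<epsilon> \<omega>)) * V \<omega>\<bar>)"
          using if1 f(2) gK by (auto simp: left_diff_distrib)
        show "integrable M (\<lambda>\<omega>. K' * \<bar>f (B2 \<epsilon> \<omega>) - g (B2 \<epsilon> \<omega>)\<bar>)" using iabs by auto
        show "\<bar>(f (B2 \<epsilon> \<omega>) - g (B2 \<epsilon> \<omega>)) * V \<omega>\<bar> \<le> K' * \<bar>f (B2 \<epsilon> \<omega>) - g (B2 \<epsilon> \<omega>)\<bar>" if "\<omega> \<in> space M" for \<omega>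
          using V(2)[OF that] by (auto simp: abs_mult mult.commute[of K'] intro!: mult_left_mono)
      qed
      also have "\<dots> = K' * e" using e_eq by simp
      finally show ?thesis .
    qed
    have 2: "\<bar>m' - m\<bar> \<le> e"
    proof -
      have "m = expectation (\<lambda>\<omega>. f (B2 \<epsilon> \<omega>))" unfolding B2_def using m \<epsilon> le by auto
      moreover have "m' = expectation (\<lambda>\<omega>. g (B2 \<epsilon> \<omega>))" unfolding m'_def using \<epsilon> by (intro inv[symmetric]) auto
      ultimately have "\<bar>m' - m\<bar> = \<bar>expectation (\<lambda>\<omega>. f (B2 \<epsilon> \<omega>) - g (B2 \<epsilon> \<omega>))\<bar>"
        using if1 f(2) gK by simp
      also have "\<dots> \<le> expectation (\<lambda>\<omega>. \<bar>f (B2 \<epsilon> \<omega>) - g (B2 \<epsilon> \<omega>)\<bar>)" by (rule integral_abs_bound)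
      finally show ?thesis using e_eq by simp
    qed
    have 3: "\<bar>expectation V\<bar> \<le> K'"
    proof -
      have "\<bar>expectation V\<bar> \<le> expectation (\<lambda>\<omega>. \<bar>V \<omega>\<bar>)" by (rule integral_abs_bound)
      also have "\<dots> \<le> expectation (\<lambda>\<omega>. K')" using V intV by (intro integral_mono) auto
      finally show ?thesis by (simp add: prob_space)
    qed
    \<comment> \<open>The three errors are the replacement of f by g, the remaining correlation of g
      with V, and the difference of the two means; each is below r/3.\<close>
    have "\<bar>(m' - m) * expectation V\<bar> \<le> e * K'"
      unfolding abs_mult using 2 3 by (intro mult_mono) auto
    moreover have "expectation (\<lambda>\<omega>. (g (B2 \<epsilon> \<omega>) - m') * V \<omega>) = expectation (\<lambda>\<omega>. g (B2 \<epsilon> \<omega>) * V \<omega>) - m' * expectation V"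
      using if1 gK intV by (simp add: left_diff_distrib)
    then have "expectation (\<lambda>\<omega>. g (B2 \<epsilon> \<omega>) * V \<omega>) = expectation (\<lambda>\<omega>. (g (B2 \<epsilon> \<omega>) - m') * V \<omega>) + m' * expectation V" by simp
    ultimately have "\<bar>expectation (\<lambda>\<omega>. f (B2 \<epsilon> \<omega>) * V \<omega>) - m * expectation V\<bar> < r"
      using 1 e elim(1) by (auto simp: left_diff_distrib mult.commute[of K'])
    then show ?case by (simp add: dist_real_def B2_def)
  qed
qed

end

section \<open>Maximal inequalities for stochastic integrals\<close>

lemma finite_set_enumerate_increasing:
  fixes D :: "real set"
  assumes "finite D" "D \<noteq> {}"
  obtains N t where "D = t ` {..N :: nat}" "\<And>i j. i < j \<Longrightarrow> j \<le> N \<Longrightarrow> t i < t j"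
proof -
  let ?L = "sorted_list_of_set D"
  define N where "N = length ?L - 1"
  have len: "length ?L = Suc N"
    using assms by (simp add: N_def card_gt_0_iff)
  have "D = set ?L" using assms by simp
  also have "\<dots> = (\<lambda>i. ?L ! i) ` {..N}"
    using len by (auto simp: set_conv_nth less_Suc_eq_le)
  finally have "D = (\<lambda>i. ?L ! i) ` {..N}" .
  moreover have "?L ! i < ?L ! j" if "i < j" "j \<le> N" for i j
    using sorted_wrt_nth_less[of "(<)" ?L i j] that len by simp
  ultimately show ?thesis using that by blast
qed

text \<open>The countable set is chosen before f, so that one set serves all sample paths. The
  strict inequality is what survives the passage to a dense subset.\<close>

lemma ex_Icc_dense:
  fixes a b :: real
  obtains T where "countable T" "T \<subseteq> {a..b}"
    "\<And>f \<delta>. continuous_on {a..b} f \<Longrightarrow> (\<exists>t\<in>{a..b}. \<delta> < (f t :: real)) \<longleftrightarrow> (\<exists>t\<in>T. \<delta> < f t)"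
proof -
  obtain T where T: "countable T" "T \<subseteq> {a..b}" "{a..b} \<subseteq> closure T"
    using separable[of "{a..b}"] by blast
  have cl: "closure T \<subseteq> {a..b}"
    by (rule closure_minimal[OF T(2)]) simp
  have "(\<exists>t\<in>{a..b}. \<delta> < f t) \<longleftrightarrow> (\<exists>t\<in>T. \<delta> < f t)" if f: "continuous_on {a..b} f" for f :: "real \<Rightarrow> real" and \<delta>
  proof
    assume "\<exists>t\<in>{a..b}. \<delta> < f t"
    then obtain t where t: "t \<in> closure T" "\<delta> < f t" using T by blast
    show "\<exists>t\<in>T. \<delta> < f t"
    proof (rule ccontr)
      assume "\<not> (\<exists>t\<in>T. \<delta> < f t)"
      then have "f t \<le> \<delta>"
        by (intro continuous_le_on_closure[OF continuous_on_subset[OF f cl] t(1)]) (auto simp: not_less)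
      then show False using t by simp
    qed
  qed (use T in blast)
  then show ?thesis using that T by blast
qed

lemma measurable_ex_Icc:
  fixes Y :: "real \<Rightarrow> 'a \<Rightarrow> real"
  assumes Y: "\<And>t. t \<in> {a..b} \<Longrightarrow> Y t \<in> borel_measurable M"
    and cont: "\<And>\<omega>. \<omega> \<in> space M \<Longrightarrow> continuous_on {a..b} (\<lambda>t. Y t \<omega>)"
  shows "{\<omega>\<in>space M. \<exists>t\<in>{a..b}. \<delta> < Y t \<omega>} \<in> sets M"
proof -
  obtain T where T: "countable T" "T \<subseteq> {a..b}"
    and ex: "\<And>f \<delta>. continuous_on {a..b} f \<Longrightarrow> (\<exists>t\<in>{a..b}. \<delta> < (f t :: real)) \<longleftrightarrow> (\<exists>t\<in>T. \<delta> < f t)"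
    using ex_Icc_dense[of a b] by blast
  have "{\<omega>\<in>space M. \<exists>t\<in>{a..b}. \<delta> < Y t \<omega>} = (\<Union>t\<in>T. {\<omega>\<in>space M. \<delta> < Y t \<omega>})"
    using ex[OF cont] by auto
  also have "\<dots> \<in> sets M"
  proof (rule sets.countable_UN''[OF T(1)])
    fix t assume "t \<in> T"
    then have [measurable]: "Y t \<in> borel_measurable M" using T(2) Y by blast
    show "{\<omega>\<in>space M. \<delta> < Y t \<omega>} \<in> sets M" by measurable
  qed
  finally show ?thesis .
qed

text \<open>A maximal inequality for finite sets of times passes to the interval along increasing
  finite subsets of a dense set. The ends a and b always belong to these sets because the
  inequalities below are proved for grids that start and stop there.\<close>

lemma (in finite_measure) measure_ex_Icc_le:
  fixes Y :: "real \<Rightarrow> 'a \<Rightarrow> real"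
  assumes Y: "\<And>t. t \<in> {a..b} \<Longrightarrow> Y t \<in> borel_measurable M"
    and cont: "\<And>\<omega>. \<omega> \<in> space M \<Longrightarrow> continuous_on {a..b} (\<lambda>t. Y t \<omega>)"
    and ab: "a \<le> b"
    and le: "\<And>D. finite D \<Longrightarrow> D \<subseteq> {a..b} \<Longrightarrow> a \<in> D \<Longrightarrow> b \<in> D \<Longrightarrow>
      measure M {\<omega>\<in>space M. \<exists>t\<in>D. \<delta> < Y t \<omega>} \<le> c"
  shows "measure M {\<omega>\<in>space M. \<exists>t\<in>{a..b}. \<delta> < Y t \<omega>} \<le> c"
proof -
  obtain T where T: "countable T" "T \<subseteq> {a..b}"
    and ex: "\<And>f \<delta>. continuous_on {a..b} f \<Longrightarrow> (\<exists>t\<in>{a..b}. \<delta> < (f t :: real)) \<longleftrightarrow> (\<exists>t\<in>T. \<delta> < f t)"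
    using ex_Icc_dense[of a b] by blast
  \<comment> \<open>Inserting a provides a nonempty set to enumerate.\<close>
  define q where "q = from_nat_into (insert a T)"
  have q: "range q = insert a T"
    unfolding q_def using T by (intro range_from_nat_into) auto
  have qab: "q i \<in> {a..b}" for i using rangeI[of q i] T ab unfolding q by auto
  define D where "D = (\<lambda>m. {a, b} \<union> q ` {..m :: nat})"
  define A where "A = (\<lambda>m. {\<omega>\<in>space M. \<exists>t\<in>D m. \<delta> < Y t \<omega>})"
  have D: "finite (D m)" "D m \<subseteq> {a..b}" "a \<in> D m" "b \<in> D m" for m
    using qab ab by (auto simp: D_def)
  have "A m \<in> sets M" for m
  proof -
    have "A m = (\<Union>t\<in>D m. {\<omega>\<in>space M. \<delta> < Y t \<omega>})" by (auto simp: A_def)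
    also have "\<dots> \<in> sets M"
    proof (rule sets.finite_UN[OF D(1)])
      fix t assume "t \<in> D m"
      then have [measurable]: "Y t \<in> borel_measurable M" using D(2) Y by blast
      show "{\<omega>\<in>space M. \<delta> < Y t \<omega>} \<in> sets M" by measurable
    qed
    finally show ?thesis .
  qed
  moreover have "incseq A"
    by (rule incseq_SucI) (auto simp: A_def D_def)
  ultimately have "(\<lambda>m. measure M (A m)) \<longlonglongrightarrow> measure M (\<Union>m. A m)"
    by (intro finite_Lim_measure_incseq) auto
  moreover have "measure M (A m) \<le> c" for m
    unfolding A_def by (rule le[OF D])
  ultimately have lim: "measure M (\<Union>m. A m) \<le> c"
    by (intro LIMSEQ_le_const2) auto
  have "(\<Union>m. A m) = {\<omega>\<in>space M. \<exists>t\<in>{a..b}. \<delta> < Y t \<omega>}"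
  proof (intro set_eqI iffI)
    fix \<omega> assume "\<omega> \<in> (\<Union>m. A m)"
    then show "\<omega> \<in> {\<omega>\<in>space M. \<exists>t\<in>{a..b}. \<delta> < Y t \<omega>}"
      using D(2) by (auto simp: A_def)
  next
    fix \<omega> assume \<omega>: "\<omega> \<in> {\<omega>\<in>space M. \<exists>t\<in>{a..b}. \<delta> < Y t \<omega>}"
    then obtain t where t: "t \<in> T" "\<delta> < Y t \<omega>" using ex[OF cont, of \<omega> \<delta>] by blast
    have "t \<in> range q" unfolding q using t by simp
    then obtain m where "t = q m" by blast
    then have "\<omega> \<in> A m" using t \<omega> by (auto simp: A_def D_def)
    then show "\<omega> \<in> (\<Union>m. A m)" by blast
  qed
  then show ?thesis using lim by simp
qed

section \<open>Martingale transforms in discrete time\<close>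

definition time_grid :: "(nat \<Rightarrow> real) \<Rightarrow> nat \<Rightarrow> bool" where
  "time_grid t N \<longleftrightarrow> 0 \<le> t 0 \<and> (\<forall>i j. i < j \<longrightarrow> j \<le> N \<longrightarrow> t i < t j)"

lemma time_grid_less: "time_grid t N \<Longrightarrow> i < j \<Longrightarrow> j \<le> N \<Longrightarrow> t i < t j"
  by (simp add: time_grid_def)

lemma time_grid_le: "time_grid t N \<Longrightarrow> i \<le> j \<Longrightarrow> j \<le> N \<Longrightarrow> t i \<le> t j"
  using time_grid_less[of t N i j] by (cases "i = j") auto

lemma time_grid_nonneg: "time_grid t N \<Longrightarrow> i \<le> N \<Longrightarrow> 0 \<le> t i"
  using time_grid_le[of t N 0 i] by (simp add: time_grid_def)

context filtered_brownian_motion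
begin

lemma increment_moments:
  assumes "0 \<le> s" "s < t"
  shows "integrable M (\<lambda>\<omega>. (B t \<omega> - B s \<omega>)\<^sup>2)" "integrable M (\<lambda>\<omega>. B t \<omega> - B s \<omega>)"
    "expectation (\<lambda>\<omega>. B t \<omega> - B s \<omega>) = 0" "expectation (\<lambda>\<omega>. (B t \<omega> - B s \<omega>)\<^sup>2) = t - s"
proof -
  have pos: "0 < sqrt (t - s)" using assms by simp
  note d = increment_distributed[OF assms]
  show e: "expectation (\<lambda>\<omega>. B t \<omega> - B s \<omega>) = 0"
    by (rule normal_distributed_expectation[OF pos d])
  show v: "expectation (\<lambda>\<omega>. (B t \<omega> - B s \<omega>)\<^sup>2) = t - s"
    using normal_distributed_variance[OF pos d] assms unfolding e by simp
  \<comment> \<open>The integral of a function that is not integrable is 0 by convention, whereas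
    here it equals t - s > 0.\<close>
  show i: "integrable M (\<lambda>\<omega>. (B t \<omega> - B s \<omega>)\<^sup>2)"
  proof (rule ccontr)
    assume "\<not> integrable M (\<lambda>\<omega>. (B t \<omega> - B s \<omega>)\<^sup>2)"
    from not_integrable_integral_eq[OF this] show False using v assms by simp
  qed
  have "(\<lambda>\<omega>. B t \<omega> - B s \<omega>) \<in> borel_measurable M" using assms by simp
  then show "integrable M (\<lambda>\<omega>. B t \<omega> - B s \<omega>)"
    by (rule square_integrable_imp_integrable[OF _ i])
qed

text \<open>With h the identity it annihilates the cross terms of the isometry, with h the square it
  evaluates the diagonal ones.\<close>

lemma increment_product:
  fixes h :: "real \<Rightarrow> real"
  assumes "0 \<le> s" "s < t" and Z: "Z \<in> borel_measurable (F s)" "integrable M Z"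
    and h: "h \<in> borel_measurable borel" "integrable M (\<lambda>\<omega>. h (B t \<omega> - B s \<omega>))"
  shows "integrable M (\<lambda>\<omega>. Z \<omega> * h (B t \<omega> - B s \<omega>))"
    "expectation (\<lambda>\<omega>. Z \<omega> * h (B t \<omega> - B s \<omega>)) = expectation Z * expectation (\<lambda>\<omega>. h (B t \<omega> - B s \<omega>))"
proof -
  let ?D = "\<lambda>\<omega>. B t \<omega> - B s \<omega>"
  let ?G = "vimage_algebra (space M) ?D borel"
  have D: "?D \<in> borel_measurable M" using assms by simp
  have "indep_var borel Z borel (\<lambda>\<omega>. h (?D \<omega>))"
  proof (rule indep_var_subalgebra)
    show "subalgebra M (F s)" using subalg assms by simp
    show "subalgebra M ?G"
      using D by (auto simp: subalgebra_def sets_vimage_algebra2 measurable_sets)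
    show "prob (x \<inter> y) = prob x * prob y" if "x \<in> sets (F s)" "y \<in> sets ?G" for x y
      using that increment_indep_prob[OF assms(1,2) that(1)] by (auto simp: sets_vimage_algebra2)
    show "(\<lambda>\<omega>. h (?D \<omega>)) \<in> borel_measurable ?G"
      by (intro measurable_compose[OF measurable_vimage_algebra1 h(1)]) auto
  qed (rule Z)
  from indep_var_integrable[OF this Z(2) h(2)] indep_var_lebesgue_integral[OF this Z(2) h(2)]
  show "integrable M (\<lambda>\<omega>. Z \<omega> * h (?D \<omega>))"
    "expectation (\<lambda>\<omega>. Z \<omega> * h (?D \<omega>)) = expectation Z * expectation (\<lambda>\<omega>. h (?D \<omega>))" .
qed

definition martingale_transform :: "(nat \<Rightarrow> real) \<Rightarrow> (nat \<Rightarrow> 'a \<Rightarrow> real) \<Rightarrow> nat \<Rightarrow> 'a \<Rightarrow> real" where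
  "martingale_transform t g n \<omega> = (\<Sum>k<n. g k \<omega> * (B (t (Suc k)) \<omega> - B (t k) \<omega>))"

lemma martingale_transform_measurable:
  assumes t: "time_grid t N"
    and g: "\<And>k. k < N \<Longrightarrow> g k \<in> borel_measurable (F (t k))"
    and n: "n \<le> m" "m \<le> N"
  shows "martingale_transform t g n \<in> borel_measurable (F (t m))"
  unfolding martingale_transform_def[abs_def]
proof (rule borel_measurable_sum)
  fix k assume "k \<in> {..<n}"
  then have k: "k < N" "Suc k \<le> m" "k < m" using n by auto
  have le: "t (Suc k) \<le> t m" "t k \<le> t m"
    using k n by (auto intro!: time_grid_le[OF t])
  have nn: "0 \<le> t k" "0 \<le> t (Suc k)" using k by (auto intro!: time_grid_nonneg[OF t])
  show "(\<lambda>\<omega>. g k \<omega> * (B (t (Suc k)) \<omega> - B (t k) \<omega>)) \<in> borel_measurable (F (t m))"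
    using le nn by (intro borel_measurable_times borel_measurable_diff B_measurable_F measurable_F_mono[OF nn(1) le(2) g[OF k(1)]])
qed

text \<open>Cross terms vanish because each increment is centred and independent of what is known at
  its left end. The bound may vary with k, as it does for the truncated integrand in Lenglart's
  inequality.\<close>

lemma martingale_transform_isometry:
  assumes t: "time_grid t N"
    and g: "\<And>k. k < N \<Longrightarrow> g k \<in> borel_measurable (F (t k))"
    and bound: "\<And>k \<omega>. k < N \<Longrightarrow> \<omega> \<in> space M \<Longrightarrow> \<bar>g k \<omega>\<bar> \<le> K k"
    and n: "n \<le> N"
  shows "integrable M (\<lambda>\<omega>. (martingale_transform t g n \<omega>)\<^sup>2) \<and>
    expectation (\<lambda>\<omega>. (martingale_transform t g n \<omega>)\<^sup>2) = (\<Sum>k<n. (t (Suc k) - t k) * expectation (\<lambda>\<omega>. (g k \<omega>)\<^sup>2))"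
  using n
proof (induction n)
  case 0
  show ?case by (simp add: martingale_transform_def)
next
  case (Suc n)
  then have n: "n < N" "n \<le> N" by auto
  let ?I = "martingale_transform t g"
  let ?D = "\<lambda>\<omega>. B (t (Suc n)) \<omega> - B (t n) \<omega>"
  have nn: "0 \<le> t n" "t n < t (Suc n)" using n by (auto intro!: time_grid_nonneg[OF t] time_grid_less[OF t])
  have I_F: "?I n \<in> borel_measurable (F (t n))"
    by (rule martingale_transform_measurable[OF t g order_refl n(2)])
  note [measurable] = measurable_F_M[OF nn(1) I_F] measurable_F_M[OF nn(1) g[OF n(1)]]
  have int2: "integrable M (\<lambda>\<omega>. (?I n \<omega>)\<^sup>2)" using Suc.IH[OF n(2)] by blast
  have int1: "integrable M (?I n)"
    by (rule square_integrable_imp_integrable[OF _ int2]) simp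
  have K: "0 \<le> K n" using bound[OF n(1)] not_empty by (meson abs_ge_zero all_not_in_conv order_trans)
  have intIg: "integrable M (\<lambda>\<omega>. ?I n \<omega> * g n \<omega>)"
  proof (rule Bochner_Integration.integrable_bound)
    show "integrable M (\<lambda>\<omega>. ?I n \<omega> * K n)" using int1 by simp
    show "AE \<omega> in M. norm (?I n \<omega> * g n \<omega>) \<le> norm (?I n \<omega> * K n)"
      using bound[OF n(1)] K by (intro AE_I2) (auto simp: abs_mult intro!: mult_left_mono)
  qed simp
  have intg2: "integrable M (\<lambda>\<omega>. (g n \<omega>)\<^sup>2)"
  proof (rule integrable_bounded_random_variable[of _ "(K n)\<^sup>2"])
    show "\<bar>(g n \<omega>)\<^sup>2\<bar> \<le> (K n)\<^sup>2" if "\<omega> \<in> space M" for \<omega>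
      using power_mono[OF bound[OF n(1) that], of 2] by simp
  qed simp
  note D = increment_moments[OF nn]
  have F_meas: "(\<lambda>\<omega>. ?I n \<omega> * g n \<omega>) \<in> borel_measurable (F (t n))" "(\<lambda>\<omega>. (g n \<omega>)\<^sup>2) \<in> borel_measurable (F (t n))"
    using borel_measurable_times[OF I_F g[OF n(1)]] borel_measurable_power[OF g[OF n(1)]] by auto
  have poly: "(\<lambda>x :: real. x) \<in> borel_measurable borel" "(\<lambda>x :: real. x\<^sup>2) \<in> borel_measurable borel" by simp_all
  have 1: "integrable M (\<lambda>\<omega>. (?I n \<omega> * g n \<omega>) * ?D \<omega>)" "expectation (\<lambda>\<omega>. (?I n \<omega> * g n \<omega>) * ?D \<omega>) = 0"
    using increment_product[OF nn F_meas(1) intIg poly(1) D(2)] D(3) by simp_all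
  have 2: "integrable M (\<lambda>\<omega>. (g n \<omega>)\<^sup>2 * (?D \<omega>)\<^sup>2)"
    "expectation (\<lambda>\<omega>. (g n \<omega>)\<^sup>2 * (?D \<omega>)\<^sup>2) = expectation (\<lambda>\<omega>. (g n \<omega>)\<^sup>2) * (t (Suc n) - t n)"
    using increment_product[OF nn F_meas(2) intg2 poly(2) D(1)] D(4) by simp_all
  have eq: "(\<lambda>\<omega>. (?I (Suc n) \<omega>)\<^sup>2) = (\<lambda>\<omega>. (?I n \<omega>)\<^sup>2 + 2 * ((?I n \<omega> * g n \<omega>) * ?D \<omega>) + (g n \<omega>)\<^sup>2 * (?D \<omega>)\<^sup>2)"
  proof
    fix \<omega>
    have "?I (Suc n) \<omega> = ?I n \<omega> + g n \<omega> * ?D \<omega>" by (simp add: martingale_transform_def)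
    then show "(?I (Suc n) \<omega>)\<^sup>2 = (?I n \<omega>)\<^sup>2 + 2 * ((?I n \<omega> * g n \<omega>) * ?D \<omega>) + (g n \<omega>)\<^sup>2 * (?D \<omega>)\<^sup>2"
      by (simp add: power2_sum power_mult_distrib)
  qed
  show ?case
    unfolding eq using int2 1 2 Suc.IH[OF n(2)] by (simp add: mult.commute)
qed

text \<open>Lenglart's inequality in discrete time. Both the stopping at level \<open>l\<close> and the truncation of
  the quadratic variation are built into the integrand, so that only the isometry and Chebyshev's
  inequality are needed.\<close>

lemma martingale_transform_Lenglart:
  assumes t: "time_grid t N"
    and g: "\<And>k. k < N \<Longrightarrow> g k \<in> borel_measurable (F (t k))"
    and pos: "0 < C" "0 < l"
  shows "{\<omega>\<in>space M. (\<exists>n\<le>N. l < \<bar>martingale_transform t g n \<omega>\<bar>) \<and> (\<Sum>k<N. (g k \<omega>)\<^sup>2 * (t (Suc k) - t k)) \<le> C} \<in> sets M"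
      (is "?E \<in> _")
    and "prob {\<omega>\<in>space M. (\<exists>n\<le>N. l < \<bar>martingale_transform t g n \<omega>\<bar>) \<and> (\<Sum>k<N. (g k \<omega>)\<^sup>2 * (t (Suc k) - t k)) \<le> C} \<le> C / l\<^sup>2"
proof -
  let ?I = "martingale_transform t g"
  have nn: "0 \<le> t k" if "k \<le> N" for k using time_grid_nonneg[OF t that] .
  have \<Delta>: "0 < t (Suc k) - t k" if "k < N" for k using that time_grid_less[OF t, of k "Suc k"] by simp
  have \<Delta>0: "0 \<le> t (Suc k) - t k" if "k < N" for k using \<Delta>[OF that] by simp
  \<comment> \<open>The sum includes the term j, which is still known at time \<open>t j\<close>.
    Hence the truncated integrand never lets the quadratic variation pass C, not even in its last
    step.\<close>
  define A where "A = (\<lambda>j \<omega>. \<Sum>i\<le>j. (g i \<omega>)\<^sup>2 * (t (Suc i) - t i))"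
  define h where "h = (\<lambda>j \<omega>. if A j \<omega> \<le> C \<and> (\<forall>i\<in>{..j}. \<bar>?I i \<omega>\<bar> \<le> l) then g j \<omega> else 0)"
  have IM: "?I n \<in> borel_measurable M" if "n \<le> N" for n
    using measurable_F_M[OF nn[OF that] martingale_transform_measurable[OF t g order_refl that]] .
  have gM: "g k \<in> borel_measurable M" if "k < N" for k
    using measurable_F_M[OF nn g[OF that]] that by simp
  have "?E = {\<omega>\<in>space M. (\<exists>n\<in>{..N}. l < \<bar>?I n \<omega>\<bar>)} \<inter> {\<omega>\<in>space M. (\<Sum>k<N. (g k \<omega>)\<^sup>2 * (t (Suc k) - t k)) \<le> C}"
    by auto
  also have "\<dots> \<in> sets M"
  proof (rule sets.Int)
    have "{\<omega>\<in>space M. (\<exists>n\<in>{..N}. l < \<bar>?I n \<omega>\<bar>)} = (\<Union>n\<in>{..N}. {\<omega>\<in>space M. l < \<bar>?I n \<omega>\<bar>})" by auto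
    also have "\<dots> \<in> sets M" using IM by (intro sets.finite_UN) auto
    finally show "{\<omega>\<in>space M. (\<exists>n\<in>{..N}. l < \<bar>?I n \<omega>\<bar>)} \<in> sets M" .
    have "(\<lambda>\<omega>. \<Sum>k<N. (g k \<omega>)\<^sup>2 * (t (Suc k) - t k)) \<in> borel_measurable M"
      using gM by (intro borel_measurable_sum borel_measurable_times borel_measurable_power borel_measurable_const) auto
    then show "{\<omega>\<in>space M. (\<Sum>k<N. (g k \<omega>)\<^sup>2 * (t (Suc k) - t k)) \<le> C} \<in> sets M" by measurable
  qed
  finally show E: "?E \<in> sets M" .
  have h_meas: "h j \<in> borel_measurable (F (t j))" if "j < N" for j
  proof -
    have Aj: "A j \<in> borel_measurable (F (t j))"
      unfolding A_def[abs_def]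
    proof (rule borel_measurable_sum)
      fix i assume "i \<in> {..j}"
      then have i: "i < N" "t i \<le> t j" "0 \<le> t i"
        using that by (auto intro!: time_grid_le[OF t] nn)
      show "(\<lambda>\<omega>. (g i \<omega>)\<^sup>2 * (t (Suc i) - t i)) \<in> borel_measurable (F (t j))"
        by (intro borel_measurable_times borel_measurable_power borel_measurable_const measurable_F_mono[OF i(3,2) g[OF i(1)]])
    qed
    have Ii: "?I i \<in> borel_measurable (F (t j))" if "i \<in> {..j}" for i
      using that \<open>j < N\<close> by (intro martingale_transform_measurable[OF t g]) auto
    have "{\<omega>\<in>space (F (t j)). A j \<omega> \<le> C \<and> (\<forall>i\<in>{..j}. \<bar>?I i \<omega>\<bar> \<le> l)} \<in> sets (F (t j))"
      using Aj Ii by (intro sets.sets_Collect_conj sets.sets_Collect_finite_All borel_measurable_le borel_measurable_abs) auto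
    then show ?thesis
      unfolding h_def by (intro measurable_If g[OF that] measurable_const) auto
  qed
  \<comment> \<open>The truncation alone bounds h: no single summand can exceed C while the whole
    sum is at most C.\<close>
  have h_bound: "\<bar>h j \<omega>\<bar> \<le> sqrt (C / (t (Suc j) - t j))" if "j < N" for j \<omega>
  proof (cases "h j \<omega> = 0")
    case False
    then have "A j \<omega> \<le> C" "h j \<omega> = g j \<omega>" by (auto simp: h_def split: if_splits)
    moreover have "(g j \<omega>)\<^sup>2 * (t (Suc j) - t j) \<le> A j \<omega>"
      unfolding A_def using \<Delta>0 that by (intro member_le_sum) (auto intro!: mult_nonneg_nonneg)
    ultimately have "(h j \<omega>)\<^sup>2 \<le> C / (t (Suc j) - t j)"
      using \<Delta>[OF that] by (simp add: pos_le_divide_eq)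
    from real_sqrt_le_mono[OF this] show ?thesis by simp
  qed (use pos \<Delta>[OF that] in auto)
  have h_sum: "(\<Sum>k<n. (h k \<omega>)\<^sup>2 * (t (Suc k) - t k)) \<le> C" if "n \<le> N" for n \<omega>
    using that
  proof (induction n)
    case 0
    show ?case using pos by simp
  next
    case (Suc n)
    show ?case
    proof (cases "h n \<omega> = 0")
      case True
      then show ?thesis using Suc by simp
    next
      case False
      then have "A n \<omega> \<le> C" by (auto simp: h_def split: if_splits)
      moreover have "(\<Sum>k<Suc n. (h k \<omega>)\<^sup>2 * (t (Suc k) - t k)) \<le> A n \<omega>"
        unfolding A_def lessThan_Suc_atMost using \<Delta>0 Suc.prems
        by (intro sum_mono mult_right_mono) (auto simp: h_def)
      ultimately show ?thesis by simp
    qed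
  qed
  let ?J = "martingale_transform t h"
  have J: "integrable M (\<lambda>\<omega>. (?J N \<omega>)\<^sup>2)"
    "expectation (\<lambda>\<omega>. (?J N \<omega>)\<^sup>2) = (\<Sum>k<N. (t (Suc k) - t k) * expectation (\<lambda>\<omega>. (h k \<omega>)\<^sup>2))"
    using martingale_transform_isometry[OF t h_meas, of "\<lambda>k. sqrt (C / (t (Suc k) - t k))" N] h_bound by auto
  have h2: "integrable M (\<lambda>\<omega>. (h k \<omega>)\<^sup>2)" if "k < N" for k
  proof (rule integrable_bounded_random_variable[of _ "C / (t (Suc k) - t k)"])
    have "h k \<in> borel_measurable M" using measurable_F_M[OF nn h_meas[OF that]] that by simp
    then show "(\<lambda>\<omega>. (h k \<omega>)\<^sup>2) \<in> borel_measurable M" by simp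
    show "\<bar>(h k \<omega>)\<^sup>2\<bar> \<le> C / (t (Suc k) - t k)" for \<omega>
      using power_mono[OF h_bound[OF that, of \<omega>], of 2] pos \<Delta>[OF that] by simp
  qed
  have "expectation (\<lambda>\<omega>. (?J N \<omega>)\<^sup>2) = expectation (\<lambda>\<omega>. \<Sum>k<N. (h k \<omega>)\<^sup>2 * (t (Suc k) - t k))"
    unfolding J(2) using h2 by (simp add: Bochner_Integration.integral_sum mult.commute)
  also have "\<dots> \<le> expectation (\<lambda>\<omega>. C)"
    using h2 h_sum by (intro integral_mono) auto
  finally have EJ: "expectation (\<lambda>\<omega>. (?J N \<omega>)\<^sup>2) \<le> C" by (simp add: prob_space)
  have JM: "?J N \<in> borel_measurable M"
    using measurable_F_M[OF nn martingale_transform_measurable[OF t h_meas, of N N]] by simp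
  have "prob ?E \<le> prob {\<omega>\<in>space M. l\<^sup>2 \<le> (?J N \<omega>)\<^sup>2}"
  proof (rule finite_measure_mono)
    show "{\<omega>\<in>space M. l\<^sup>2 \<le> (?J N \<omega>)\<^sup>2} \<in> sets M" using JM by measurable
    show "?E \<subseteq> {\<omega>\<in>space M. l\<^sup>2 \<le> (?J N \<omega>)\<^sup>2}"
    proof
      fix \<omega> assume \<omega>: "\<omega> \<in> ?E"
      \<comment> \<open>First passage above l. Before it h agrees with g, from it on h vanishes, so
        the complete transform of h keeps the value that the transform of g has at the
        passage.\<close>
      define n where "n = (LEAST n. n \<le> N \<and> l < \<bar>?I n \<omega>\<bar>)"
      have n: "n \<le> N" "l < \<bar>?I n \<omega>\<bar>"
        using \<omega> LeastI_ex[of "\<lambda>n. n \<le> N \<and> l < \<bar>?I n \<omega>\<bar>"] unfolding n_def by auto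
      have least: "\<bar>?I i \<omega>\<bar> \<le> l" if "i < n" for i
        using not_less_Least[OF that[unfolded n_def]] that n(1) by auto
      have AC: "A j \<omega> \<le> C" if "j < N" for j
      proof -
        have "A j \<omega> \<le> (\<Sum>k<N. (g k \<omega>)\<^sup>2 * (t (Suc k) - t k))"
          unfolding A_def using that \<Delta>0 by (intro sum_mono2) (auto intro!: mult_nonneg_nonneg)
        then show ?thesis using \<omega> by auto
      qed
      have "?J N \<omega> = (\<Sum>k<n. h k \<omega> * (B (t (Suc k)) \<omega> - B (t k) \<omega>))"
        unfolding martingale_transform_def
      proof (rule sum.mono_neutral_right)
        show "\<forall>k\<in>{..<N} - {..<n}. h k \<omega> * (B (t (Suc k)) \<omega> - B (t k) \<omega>) = 0"
        proof
          fix k assume "k \<in> {..<N} - {..<n}"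
          then have "\<not> (\<forall>i\<in>{..k}. \<bar>?I i \<omega>\<bar> \<le> l)" using n(2) by (auto simp: not_le intro!: bexI[of _ n])
          then have "h k \<omega> = 0" unfolding h_def by (simp only: simp_thms if_False)
          then show "h k \<omega> * (B (t (Suc k)) \<omega> - B (t k) \<omega>) = 0" by simp
        qed
      qed (use n in auto)
      also have "\<dots> = ?I n \<omega>"
        unfolding martingale_transform_def
      proof (rule sum.cong[OF refl])
        fix k assume "k \<in> {..<n}"
        then have "h k \<omega> = g k \<omega>" using AC[of k] least n(1) by (auto simp: h_def)
        then show "h k \<omega> * (B (t (Suc k)) \<omega> - B (t k) \<omega>) = g k \<omega> * (B (t (Suc k)) \<omega> - B (t k) \<omega>)" by simp
      qed
      finally have "l \<le> \<bar>?J N \<omega>\<bar>" using n(2) by simp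
      then have "l\<^sup>2 \<le> (?J N \<omega>)\<^sup>2" using pos power_mono[of l "\<bar>?J N \<omega>\<bar>" 2] by simp
      then show "\<omega> \<in> {\<omega>\<in>space M. l\<^sup>2 \<le> (?J N \<omega>)\<^sup>2}" using \<omega> by simp
    qed
  qed
  also have "\<dots> \<le> expectation (\<lambda>\<omega>. (?J N \<omega>)\<^sup>2) / l\<^sup>2"
    using pos by (intro integral_Markov_inequality_measure[where A = "{}"] J(1)) auto
  also have "\<dots> \<le> C / l\<^sup>2" using EJ by (intro divide_right_mono) auto
  finally show "prob ?E \<le> C / l\<^sup>2" .
qed

end

section \<open>Maximal inequality for simple integrals\<close>

context filtered_brownian_motion
begin

lemma simple_integrand_times:
  assumes "simple_integrand F n \<tau> \<xi>" "i \<le> n"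
  shows "0 \<le> \<tau> i"
  using assms(2)
proof (induction i)
  case 0
  show ?case using assms(1) by (simp add: simple_integrand_def)
next
  case (Suc i)
  have "\<tau> i < \<tau> (Suc i)" using assms(1) Suc.prems by (simp add: simple_integrand_def)
  then show ?case using Suc.IH Suc.prems by linarith
qed

text \<open>The pieces of a simple process are open on the left, so without jump times strictly
  between s and u the process is constant on (s, u], its value at s being excluded.\<close>

lemma simple_process_const:
  assumes "\<And>i. i \<le> n \<Longrightarrow> \<tau> i \<le> s \<or> u \<le> \<tau> i" "s < r" "r \<le> u"
  shows "simple_process n \<tau> \<xi> r \<omega> = simple_process n \<tau> \<xi> u \<omega>"
  unfolding simple_process_def
proof (rule sum.cong[OF refl])
  fix i assume "i \<in> {..<n}"
  then have "i \<le> n" "Suc i \<le> n" by auto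
  then show "\<xi> i \<omega> * indicator {\<tau> i<..\<tau> (Suc i)} r = \<xi> i \<omega> * indicator {\<tau> i<..\<tau> (Suc i)} u"
    using assms(1)[of i] assms(1)[of "Suc i"] assms(2,3) by (auto simp: indicator_def)
qed

lemma simple_integral_increment:
  assumes simp: "simple_integrand F n \<tau> \<xi>"
    and jump: "\<And>i. i \<le> n \<Longrightarrow> \<tau> i \<le> s \<or> u \<le> \<tau> i" and "s < u"
  shows "simple_integral B n \<tau> \<xi> u \<omega> - simple_integral B n \<tau> \<xi> s \<omega>
    = simple_process n \<tau> \<xi> u \<omega> * (B u \<omega> - B s \<omega>)"
  unfolding simple_integral_def simple_process_def sum_subtractf[symmetric] sum_distrib_right
proof (rule sum.cong[OF refl])
  fix i assume "i \<in> {..<n}"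
  then have i: "i \<le> n" "Suc i \<le> n" "\<tau> i < \<tau> (Suc i)" using simp by (auto simp: simple_integrand_def)
  consider "u \<le> \<tau> i" | "\<tau> i \<le> s" "u \<le> \<tau> (Suc i)" | "\<tau> (Suc i) \<le> s"
    using jump[OF i(1)] jump[OF i(2)] by blast
  then show "\<xi> i \<omega> * (B (min u (\<tau> (Suc i))) \<omega> - B (min u (\<tau> i)) \<omega>)
      - \<xi> i \<omega> * (B (min s (\<tau> (Suc i))) \<omega> - B (min s (\<tau> i)) \<omega>)
    = \<xi> i \<omega> * indicator {\<tau> i<..\<tau> (Suc i)} u * (B u \<omega> - B s \<omega>)"
    using i(3) \<open>s < u\<close> by cases (auto simp: min_def indicator_def right_diff_distrib)
qed

text \<open>Predictability: the value on (s, u] is a coefficient that was fixed at time s or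
  earlier.\<close>

lemma simple_process_measurable:
  assumes simp: "simple_integrand F n \<tau> \<xi>"
    and jump: "\<And>i. i \<le> n \<Longrightarrow> \<tau> i \<le> s \<or> u \<le> \<tau> i"
  shows "simple_process n \<tau> \<xi> u \<in> borel_measurable (F s)"
  unfolding simple_process_def[abs_def]
proof (rule borel_measurable_sum)
  fix i assume "i \<in> {..<n}"
  then have i: "i \<le> n" "\<xi> i \<in> borel_measurable (F (\<tau> i))" using simp by (auto simp: simple_integrand_def)
  show "(\<lambda>\<omega>. \<xi> i \<omega> * indicator {\<tau> i<..\<tau> (Suc i)} u) \<in> borel_measurable (F s)"
  proof (cases "u \<in> {\<tau> i<..\<tau> (Suc i)}")
    case True
    then have "\<tau> i \<le> s" using jump[OF i(1)] by auto
    then have "\<xi> i \<in> borel_measurable (F s)"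
      using simple_integrand_times[OF simp i(1)] measurable_F_mono i(2) by blast
    then show ?thesis using True by simp
  qed simp
qed

lemma simple_integral_maximal:
  fixes D :: "real set"
  assumes simp: "simple_integrand F n \<tau> \<xi>"
    and ab: "0 \<le> a" "a < b" and D: "finite D" "D \<subseteq> {a..b}" "a \<in> D" "b \<in> D"
    and \<eta>: "\<eta> \<in> borel_measurable (F a)" and pos: "0 < C" "0 < l"
  defines "I \<equiv> \<lambda>s \<omega>. simple_integral B n \<tau> \<xi> s \<omega> - simple_integral B n \<tau> \<xi> a \<omega> - \<eta> \<omega> * (B s \<omega> - B a \<omega>)"
  shows "prob {\<omega>\<in>space M. (\<exists>s\<in>D. l < \<bar>I s \<omega>\<bar>) \<and>
    (\<integral>\<^sup>+r\<in>{a..b}. ennreal ((simple_process n \<tau> \<xi> r \<omega> - \<eta> \<omega>)\<^sup>2) \<partial>lborel) \<le> ennreal C} \<le> C / l\<^sup>2"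
proof -
  have "finite (D \<union> (\<tau> ` {..n} \<inter> {a..b}))" "D \<union> (\<tau> ` {..n} \<inter> {a..b}) \<noteq> {}" using D by auto
  then obtain N t where Dt: "D \<union> (\<tau> ` {..n} \<inter> {a..b}) = t ` {..N :: nat}"
    and less: "\<And>i j. i < j \<Longrightarrow> j \<le> N \<Longrightarrow> t i < t j"
    using finite_set_enumerate_increasing by metis
  have tab: "t k \<in> {a..b}" if "k \<le> N" for k
  proof -
    have "t k \<in> D \<union> (\<tau> ` {..n} \<inter> {a..b})" unfolding Dt using that by simp
    then show ?thesis using D(2) by blast
  qed
  have grid: "time_grid t N"
    using tab[of 0] ab less by (auto simp: time_grid_def)
  obtain i where i: "i \<le> N" "t i = a" using D(3) Dt by (metis UnI1 atMost_iff imageE)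
  have t0: "t 0 = a" using time_grid_le[OF grid, of 0 i] i tab[of 0] by auto
  have jump: "\<tau> i \<le> t k \<or> t (Suc k) \<le> \<tau> i" if "k < N" "i \<le> n" for i k
  proof (rule ccontr)
    assume "\<not> ?thesis"
    then have *: "t k < \<tau> i" "\<tau> i < t (Suc k)" by auto
    then have "\<tau> i \<in> {a..b}" using tab[of k] tab[of "Suc k"] that by auto
    then have "\<tau> i \<in> t ` {..N}" unfolding Dt[symmetric] using that by blast
    then obtain j where j: "j \<le> N" "\<tau> i = t j" by blast
    show False
    proof (cases "j \<le> k")
      case True
      then show False using time_grid_le[OF grid, of j k] * j that by auto
    next
      case False
      then show False using time_grid_le[OF grid, of "Suc k" j] * j that by auto
    qed
  qed
  define g where "g = (\<lambda>k \<omega>. simple_process n \<tau> \<xi> (t (Suc k)) \<omega> - \<eta> \<omega>)"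
  have g: "g k \<in> borel_measurable (F (t k))" if "k < N" for k
  proof -
    have "\<eta> \<in> borel_measurable (F (t k))" using \<eta> tab[of k] that ab by (intro measurable_F_mono[of a "t k"]) auto
    moreover have "simple_process n \<tau> \<xi> (t (Suc k)) \<in> borel_measurable (F (t k))"
      by (rule simple_process_measurable[OF simp jump[OF that]])
    ultimately show ?thesis unfolding g_def by (intro borel_measurable_diff)
  qed
  have I_eq: "martingale_transform t g k \<omega> = I (t k) \<omega>" if "k \<le> N" for k \<omega>
    using that
  proof (induction k)
    case 0
    show ?case by (simp add: martingale_transform_def I_def t0)
  next
    case (Suc k)
    then have k: "k < N" "t k < t (Suc k)" using less by auto
    have "martingale_transform t g (Suc k) \<omega> = I (t k) \<omega> + g k \<omega> * (B (t (Suc k)) \<omega> - B (t k) \<omega>)"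
      using Suc by (simp add: martingale_transform_def)
    also have "\<dots> = I (t (Suc k)) \<omega>"
      using simple_integral_increment[OF simp jump[OF k(1)] k(2), of \<omega>]
      by (simp add: I_def g_def left_diff_distrib right_diff_distrib)
    finally show ?case .
  qed
  \<comment> \<open>The grid sum is an integral over disjoint half-open cells; an inequality
    suffices, so it is enough that the cells lie in [a,b].\<close>
  have sum_le: "ennreal (\<Sum>k<N. (g k \<omega>)\<^sup>2 * (t (Suc k) - t k))
    \<le> (\<integral>\<^sup>+r\<in>{a..b}. ennreal ((simple_process n \<tau> \<xi> r \<omega> - \<eta> \<omega>)\<^sup>2) \<partial>lborel)" for \<omega>
  proof -
    have "ennreal (\<Sum>k<N. (g k \<omega>)\<^sup>2 * (t (Suc k) - t k)) = (\<Sum>k<N. ennreal ((g k \<omega>)\<^sup>2) * emeasure lborel {t k<..t (Suc k)})"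
      using time_grid_le[OF grid] by (subst sum_ennreal[symmetric]) (auto simp: ennreal_mult intro!: sum.cong)
    also have "\<dots> = (\<Sum>k<N. \<integral>\<^sup>+r. ennreal ((g k \<omega>)\<^sup>2) * indicator {t k<..t (Suc k)} r \<partial>lborel)"
      by (simp add: nn_integral_cmult_indicator)
    also have "\<dots> = (\<integral>\<^sup>+r. (\<Sum>k<N. ennreal ((g k \<omega>)\<^sup>2) * indicator {t k<..t (Suc k)} r) \<partial>lborel)"
      by (rule nn_integral_sum[symmetric]) auto
    also have "\<dots> \<le> (\<integral>\<^sup>+r\<in>{a..b}. ennreal ((simple_process n \<tau> \<xi> r \<omega> - \<eta> \<omega>)\<^sup>2) \<partial>lborel)"
    proof (rule nn_integral_mono)
      fix r :: real
      show "(\<Sum>k<N. ennreal ((g k \<omega>)\<^sup>2) * indicator {t k<..t (Suc k)} r)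
        \<le> ennreal ((simple_process n \<tau> \<xi> r \<omega> - \<eta> \<omega>)\<^sup>2) * indicator {a..b} r"
      proof (cases "\<exists>k<N. r \<in> {t k<..t (Suc k)}")
        case True
        then obtain k where k: "k < N" "r \<in> {t k<..t (Suc k)}" by blast
        have "(\<Sum>j<N. ennreal ((g j \<omega>)\<^sup>2) * indicator {t j<..t (Suc j)} r)
          = (\<Sum>j\<in>{k}. ennreal ((g j \<omega>)\<^sup>2) * indicator {t j<..t (Suc j)} r)"
        proof (rule sum.mono_neutral_right)
          show "\<forall>j\<in>{..<N} - {k}. ennreal ((g j \<omega>)\<^sup>2) * indicator {t j<..t (Suc j)} r = 0"
          proof
            fix j assume j: "j \<in> {..<N} - {k}"
            then consider "Suc j \<le> k" | "Suc k \<le> j" by fastforce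
            then have "r \<notin> {t j<..t (Suc j)}"
            proof cases
              case 1
              then show ?thesis using time_grid_le[OF grid 1] k by auto
            next
              case 2
              then show ?thesis using time_grid_le[OF grid 2] k j by auto
            qed
            then show "ennreal ((g j \<omega>)\<^sup>2) * indicator {t j<..t (Suc j)} r = 0" by simp
          qed
        qed (use k in auto)
        also have "\<dots> = ennreal ((simple_process n \<tau> \<xi> r \<omega> - \<eta> \<omega>)\<^sup>2)"
          using k simple_process_const[OF jump[OF k(1)], where r = r and \<xi> = \<xi> and \<omega> = \<omega>] by (simp add: g_def)
        finally show ?thesis using k tab[of k] tab[of "Suc k"] by auto
      next
        case False
        then have "(\<Sum>k<N. ennreal ((g k \<omega>)\<^sup>2) * indicator {t k<..t (Suc k)} r) = 0"
          by (intro sum.neutral) (auto simp: indicator_def)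
        then show ?thesis by simp
      qed
    qed
    finally show ?thesis .
  qed
  let ?E = "{\<omega>\<in>space M. (\<exists>k\<le>N. l < \<bar>martingale_transform t g k \<omega>\<bar>) \<and> (\<Sum>k<N. (g k \<omega>)\<^sup>2 * (t (Suc k) - t k)) \<le> C}"
  have "prob {\<omega>\<in>space M. (\<exists>s\<in>D. l < \<bar>I s \<omega>\<bar>) \<and>
    (\<integral>\<^sup>+r\<in>{a..b}. ennreal ((simple_process n \<tau> \<xi> r \<omega> - \<eta> \<omega>)\<^sup>2) \<partial>lborel) \<le> ennreal C} \<le> prob ?E"
  proof (rule finite_measure_mono)
    show "?E \<in> sets M" by (rule martingale_transform_Lenglart(1)[OF grid g pos])
    show "{\<omega>\<in>space M. (\<exists>s\<in>D. l < \<bar>I s \<omega>\<bar>) \<and>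
      (\<integral>\<^sup>+r\<in>{a..b}. ennreal ((simple_process n \<tau> \<xi> r \<omega> - \<eta> \<omega>)\<^sup>2) \<partial>lborel) \<le> ennreal C} \<subseteq> ?E"
    proof
      fix \<omega> assume "\<omega> \<in> {\<omega>\<in>space M. (\<exists>s\<in>D. l < \<bar>I s \<omega>\<bar>) \<and>
        (\<integral>\<^sup>+r\<in>{a..b}. ennreal ((simple_process n \<tau> \<xi> r \<omega> - \<eta> \<omega>)\<^sup>2) \<partial>lborel) \<le> ennreal C}"
      then obtain s where \<omega>: "\<omega> \<in> space M" and s: "s \<in> D" "l < \<bar>I s \<omega>\<bar>"
        and C: "(\<integral>\<^sup>+r\<in>{a..b}. ennreal ((simple_process n \<tau> \<xi> r \<omega> - \<eta> \<omega>)\<^sup>2) \<partial>lborel) \<le> ennreal C"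
        by blast
      have "s \<in> t ` {..N}" unfolding Dt[symmetric] using s by blast
      then obtain k where "k \<le> N" "s = t k" by blast
      then have "k \<le> N" "l < \<bar>martingale_transform t g k \<omega>\<bar>" using s I_eq by auto
      moreover have "ennreal (\<Sum>k<N. (g k \<omega>)\<^sup>2 * (t (Suc k) - t k)) \<le> ennreal C"
        using sum_le[of \<omega>] C by (rule order_trans)
      then have "(\<Sum>k<N. (g k \<omega>)\<^sup>2 * (t (Suc k) - t k)) \<le> C" using pos by (simp add: ennreal_le_iff)
      ultimately show "\<omega> \<in> ?E"
        using \<omega> by blast
    qed
  qed
  also have "\<dots> \<le> C / l\<^sup>2" by (rule martingale_transform_Lenglart(2)[OF grid g pos])
  finally show ?thesis .
qed

lemma B_maximal:
  assumes "0 \<le> a" "a < b" "0 < l"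
  shows "prob {\<omega>\<in>space M. \<exists>s\<in>{a..b}. l < \<bar>B s \<omega> - B a \<omega>\<bar>} \<le> (b - a) / l\<^sup>2"
proof (rule measure_ex_Icc_le)
  show "(\<lambda>\<omega>. \<bar>B t \<omega> - B a \<omega>\<bar>) \<in> borel_measurable M" if "t \<in> {a..b}" for t using that assms by simp
  show "continuous_on {a..b} (\<lambda>t. \<bar>B t \<omega> - B a \<omega>\<bar>)" if "\<omega> \<in> space M" for \<omega>
    using continuous_on_subset[OF B_continuous[OF that], of "{a..b}"] assms
    by (intro continuous_on_rabs continuous_on_diff continuous_on_const) auto
  fix D assume D: "finite D" "D \<subseteq> {a..b}" "a \<in> D" "b \<in> D"
  \<comment> \<open>The empty simple process with \<eta> = -1 gives the process B s - B a with
    quadratic variation b - a = C; the result is Kolmogorov's inequality.\<close>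
  have "simple_integrand F 0 (\<lambda>_. 0) (\<lambda>_ _. 0)" by (simp add: simple_integrand_def)
  from simple_integral_maximal[OF this assms(1,2) D, of "\<lambda>_. - 1" "b - a" l] assms
  show "prob {\<omega>\<in>space M. \<exists>t\<in>D. l < \<bar>B t \<omega> - B a \<omega>\<bar>} \<le> (b - a) / l\<^sup>2"
    by (simp add: simple_integral_def simple_process_def)
qed (use assms in auto)

section \<open>Passage from simple integrals to the Ito integral\<close>

lemma progressively_measurable_adapted:
  assumes "progressively_measurable F H" "0 \<le> t"
  shows "H t \<in> borel_measurable (F t)"
proof -
  have "(\<lambda>(s, \<omega>). H s \<omega>) \<in> borel_measurable (restrict_space borel {0..t} \<Otimes>\<^sub>M F t)"
    using assms by (simp add: progressively_measurable_def)
  from measurable_compose[OF measurable_Pair1'[of t] this] show ?thesis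
    using assms(2) by (simp add: space_restrict_space)
qed

lemma progressively_measurable_section:
  assumes "progressively_measurable F H" "\<omega> \<in> space M" "0 \<le> T"
  shows "(\<lambda>s. H s \<omega>) \<in> borel_measurable (restrict_space borel {0..T})"
proof -
  have "(\<lambda>(s, \<omega>). H s \<omega>) \<in> borel_measurable (restrict_space borel {0..T} \<Otimes>\<^sub>M F T)"
    using assms by (simp add: progressively_measurable_def)
  from measurable_compose[OF measurable_Pair2'[of \<omega>] this] show ?thesis
    using assms by (simp add: space_F)
qed

text \<open>Tonelli's theorem on [0,T] times the sample space; Lebesgue measure is restricted to
  [0,T] because joint measurability is given there.\<close>

lemma square_nn_integral_measurable:
  fixes g :: "real \<Rightarrow> 'a \<Rightarrow> real"
  assumes g: "(\<lambda>p. g (fst p) (snd p)) \<in> borel_measurable (restrict_space borel {0..T} \<Otimes>\<^sub>M M)"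
    and A: "A \<in> sets borel" "A \<subseteq> {0..T}"
  shows "(\<lambda>\<omega>. \<integral>\<^sup>+s\<in>A. ennreal ((g s \<omega>)\<^sup>2) \<partial>lborel) \<in> borel_measurable M"
proof -
  let ?L = "restrict_space lborel {0..T}"
  interpret L: sigma_finite_measure ?L
    by (rule sigma_finite_measure_restrict_space[OF sigma_finite_lborel]) (simp add: borel_closed)
  have sets_L [measurable_cong]: "sets ?L = sets (restrict_space borel {0..T})"
    by (rule sets_restrict_space_cong) simp
  have "(\<lambda>p. g (fst p) (snd p)) \<in> borel_measurable (?L \<Otimes>\<^sub>M M)"
    using g measurable_cong_sets[OF sets_pair_measure_cong[OF sets_L refl] refl] by blast
  from measurable_compose[OF measurable_pair_swap' this]
  have [measurable]: "(\<lambda>p. g (snd p) (fst p)) \<in> borel_measurable (M \<Otimes>\<^sub>M ?L)"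
    by (simp add: case_prod_beta)
  have "(\<lambda>s. indicator A s :: ennreal) \<in> borel_measurable ?L"
    using A(1) by (intro measurable_restrict_space1) simp
  from measurable_compose[OF measurable_snd this]
  have [measurable]: "(\<lambda>p. indicator A (snd p) :: ennreal) \<in> borel_measurable (M \<Otimes>\<^sub>M ?L)" .
  have "(\<lambda>p. ennreal ((g (snd p) (fst p))\<^sup>2) * indicator A (snd p)) \<in> borel_measurable (M \<Otimes>\<^sub>M ?L)"
    by measurable
  then have "(\<lambda>\<omega>. \<integral>\<^sup>+s. ennreal ((g s \<omega>)\<^sup>2) * indicator A s \<partial>?L) \<in> borel_measurable M"
    by (intro L.borel_measurable_nn_integral) (simp add: case_prod_beta)
  also have "(\<lambda>\<omega>. \<integral>\<^sup>+s. ennreal ((g s \<omega>)\<^sup>2) * indicator A s \<partial>?L) = (\<lambda>\<omega>. \<integral>\<^sup>+s\<in>A. ennreal ((g s \<omega>)\<^sup>2) \<partial>lborel)"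
    using A(2) by (subst nn_integral_restrict_space) (auto intro!: ext nn_integral_cong split: split_indicator)
  finally show ?thesis .
qed

lemma progressively_measurable_joint:
  assumes H: "progressively_measurable F H" and T: "0 \<le> T"
  shows "(\<lambda>p. H (fst p) (snd p)) \<in> borel_measurable (restrict_space borel {0..T} \<Otimes>\<^sub>M M)"
proof -
  have Hm: "(\<lambda>p. H (fst p) (snd p)) \<in> borel_measurable (restrict_space borel {0..T} \<Otimes>\<^sub>M F T)"
    using H T by (simp add: progressively_measurable_def case_prod_beta')
  have "(\<lambda>\<omega>. \<omega>) \<in> M \<rightarrow>\<^sub>M F T"
    using measurable_F_M[OF T measurable_ident] by (simp add: id_def)
  then have "(\<lambda>p. (fst p, snd p)) \<in> restrict_space borel {0..T} \<Otimes>\<^sub>M M \<rightarrow>\<^sub>M restrict_space borel {0..T} \<Otimes>\<^sub>M F T"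
    by (intro measurable_Pair measurable_fst measurable_compose[OF measurable_snd])
  from measurable_compose[OF this Hm] show ?thesis by simp
qed

lemma simple_process_joint:
  assumes S: "simple_integrand F n \<tau> \<xi>"
  shows "(\<lambda>p. simple_process n \<tau> \<xi> (fst p) (snd p)) \<in> borel_measurable (restrict_space borel {0..T} \<Otimes>\<^sub>M M)"
  unfolding simple_process_def
proof (rule borel_measurable_sum)
  fix i assume i: "i \<in> {..<n}"
  then have [measurable]: "\<xi> i \<in> borel_measurable M"
    using S simple_integrand_times[OF S, of i] measurable_F_M[of "\<tau> i" "\<xi> i" borel] by (auto simp: simple_integrand_def)
  have "(\<lambda>s. indicator {\<tau> i<..\<tau> (Suc i)} s :: real) \<in> borel_measurable (restrict_space borel {0..T})"
    by (rule measurable_restrict_space1) simp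
  from measurable_compose[OF measurable_fst this]
  have [measurable]: "(\<lambda>p. indicator {\<tau> i<..\<tau> (Suc i)} (fst p) :: real) \<in> borel_measurable (restrict_space borel {0..T} \<Otimes>\<^sub>M M)" .
  show "(\<lambda>p. \<xi> i (snd p) * indicator {\<tau> i<..\<tau> (Suc i)} (fst p)) \<in> borel_measurable (restrict_space borel {0..T} \<Otimes>\<^sub>M M)"
    by measurable
qed

lemma oscillation_measurable:
  assumes "progressively_measurable F H" "0 \<le> a" "a \<le> b"
  shows "(\<lambda>\<omega>. \<integral>\<^sup>+s\<in>{a..b}. ennreal ((H s \<omega> - H a \<omega>)\<^sup>2) \<partial>lborel) \<in> borel_measurable M"
proof (rule square_nn_integral_measurable[where T = b])
  have [measurable]: "H a \<in> borel_measurable M"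
    using progressively_measurable_adapted[OF assms(1,2)] measurable_F_M assms by blast
  have [measurable]: "(\<lambda>p. H (fst p) (snd p)) \<in> borel_measurable (restrict_space borel {0..b} \<Otimes>\<^sub>M M)"
    using progressively_measurable_joint[OF assms(1)] assms by simp
  show "(\<lambda>p. H (fst p) (snd p) - H a (snd p)) \<in> borel_measurable (restrict_space borel {0..b} \<Otimes>\<^sub>M M)"
    by measurable
qed (use assms in auto)

text \<open>The maximal inequality for the approximating simple processes with \<eta> =
  \<open>H a\<close>, in the limit. Of the level 2 l, one l is spent on replacing J by the simple
  integral, l/2 at s and l/2 at a. The quarter of C comes from (x - z)^2 \<le> 2 (x - y)^2 + 2 (y -
  z)^2, with approximation error and oscillation of H both at most C/4.\<close>

lemma ito_integral_window_finite:
  fixes D :: "real set"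
  assumes ito: "ito_integral M F B H J"
    and ab: "0 \<le> a" "a < b" and D: "finite D" "D \<subseteq> {a..b}" "a \<in> D" "b \<in> D"
    and pos: "0 < C" "0 < l"
  shows "prob {\<omega>\<in>space M. \<exists>s\<in>D. 2 * l < \<bar>J s \<omega> - J a \<omega> - H a \<omega> * (B s \<omega> - B a \<omega>)\<bar>}
    \<le> C / l\<^sup>2 + prob {\<omega>\<in>space M. ennreal (C / 4) < (\<integral>\<^sup>+s\<in>{a..b}. ennreal ((H s \<omega> - H a \<omega>)\<^sup>2) \<partial>lborel)}"
proof -
  have b: "0 \<le> b" using ab by simp
  have prog: "progressively_measurable F H" and J: "adapted F J" "continuous_paths M J"
    using ito by (auto simp: ito_integral_def)
  obtain n \<tau> \<xi> where simp: "\<And>k :: nat. simple_integrand F (n k) (\<tau> k) (\<xi> k)"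
    and lim1: "\<And>T \<delta>. 0 \<le> T \<Longrightarrow> 0 < \<delta> \<Longrightarrow> (\<lambda>k. prob {\<omega> \<in> space M.
              (\<integral>\<^sup>+s\<in>{0..T}. ennreal ((simple_process (n k) (\<tau> k) (\<xi> k) s \<omega> - H s \<omega>)\<^sup>2) \<partial>lborel)
                > ennreal \<delta>}) \<longlonglongrightarrow> 0"
    and lim2: "\<And>T \<delta>. 0 \<le> T \<Longrightarrow> 0 < \<delta> \<Longrightarrow> (\<lambda>k. prob {\<omega> \<in> space M.
              \<exists>t\<in>{0..T}. \<bar>simple_integral B (n k) (\<tau> k) (\<xi> k) t \<omega> - J t \<omega>\<bar> > \<delta>}) \<longlonglongrightarrow> 0"
    using ito unfolding ito_integral_def by blast
  let ?sp = "\<lambda>k. simple_process (n k) (\<tau> k) (\<xi> k)"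
  let ?si = "\<lambda>k. simple_integral B (n k) (\<tau> k) (\<xi> k)"
  let ?Q1 = "\<lambda>k \<omega>. \<integral>\<^sup>+s\<in>{0..b}. ennreal ((?sp k s \<omega> - H s \<omega>)\<^sup>2) \<partial>lborel"
  let ?Q2 = "\<lambda>k \<omega>. \<integral>\<^sup>+s\<in>{a..b}. ennreal ((?sp k s \<omega> - H a \<omega>)\<^sup>2) \<partial>lborel"
  let ?Q3 = "\<lambda>\<omega>. \<integral>\<^sup>+s\<in>{a..b}. ennreal ((H s \<omega> - H a \<omega>)\<^sup>2) \<partial>lborel"
  let ?A = "{\<omega>\<in>space M. \<exists>s\<in>D. 2 * l < \<bar>J s \<omega> - J a \<omega> - H a \<omega> * (B s \<omega> - B a \<omega>)\<bar>}"
  let ?E = "{\<omega>\<in>space M. ennreal (C / 4) < ?Q3 \<omega>}"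
  let ?E1 = "\<lambda>k. {\<omega> \<in> space M. \<exists>t\<in>{0..b}. l / 2 < \<bar>?si k t \<omega> - J t \<omega>\<bar>}"
  let ?E2 = "\<lambda>k. {\<omega> \<in> space M. ennreal (C / 4) < ?Q1 k \<omega>}"
  let ?E3 = "\<lambda>k. {\<omega>\<in>space M. (\<exists>s\<in>D. l < \<bar>?si k s \<omega> - ?si k a \<omega> - H a \<omega> * (B s \<omega> - B a \<omega>)\<bar>) \<and> ?Q2 k \<omega> \<le> ennreal C}"
  have \<tau>: "0 \<le> \<tau> k i" if "i \<le> n k" for k i using simple_integrand_times[OF simp that] .
  have HaF: "H a \<in> borel_measurable (F a)" by (rule progressively_measurable_adapted[OF prog ab(1)])
  have Ha [measurable]: "H a \<in> borel_measurable M" by (rule measurable_F_M[OF ab(1) HaF])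
  note [measurable] = progressively_measurable_joint[OF prog b] simple_process_joint[OF simp, of _ b]
  have JM: "J t \<in> borel_measurable M" if "0 \<le> t" for t
    using J(1) measurable_F_M[OF that] that by (auto simp: adapted_def)
  have \<xi>M: "\<xi> k i \<in> borel_measurable M" if "i < n k" for k i
    using simp[of k] that \<tau>[of i k] measurable_F_M[of "\<tau> k i" "\<xi> k i" borel] by (auto simp: simple_integrand_def)
  have siM: "?si k t \<in> borel_measurable M" if "0 \<le> t" for k t
    unfolding simple_integral_def[abs_def]
  proof (rule borel_measurable_sum)
    fix i assume "i \<in> {..<n k}"
    then have "0 \<le> min t (\<tau> k (Suc i))" "0 \<le> min t (\<tau> k i)" "\<xi> k i \<in> borel_measurable M"
      using that \<tau>[of i k] \<tau>[of "Suc i" k] \<xi>M by auto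
    then show "(\<lambda>\<omega>. \<xi> k i \<omega> * (B (min t (\<tau> k (Suc i))) \<omega> - B (min t (\<tau> k i)) \<omega>)) \<in> borel_measurable M"
      by (intro borel_measurable_times borel_measurable_diff B_measurable)
  qed
  have si_cont: "continuous_on {0..} (\<lambda>t. ?si k t \<omega>)" if "\<omega> \<in> space M" for k \<omega>
    unfolding simple_integral_def
  proof (rule continuous_on_sum)
    fix i assume "i \<in> {..<n k}"
    then have "0 \<le> \<tau> k (Suc i)" "0 \<le> \<tau> k i" using \<tau>[of i k] \<tau>[of "Suc i" k] by auto
    then show "continuous_on {0..} (\<lambda>t. \<xi> k i \<omega> * (B (min t (\<tau> k (Suc i))) \<omega> - B (min t (\<tau> k i)) \<omega>))"
      by (intro continuous_on_mult continuous_on_diff continuous_on_const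
          B_continuous_comp[OF that] continuous_on_min continuous_on_id) auto
  qed
  have E1: "?E1 k \<in> sets M" for k
  proof (rule measurable_ex_Icc)
    show "(\<lambda>\<omega>. \<bar>?si k t \<omega> - J t \<omega>\<bar>) \<in> borel_measurable M" if "t \<in> {0..b}" for t
      using siM[of t k] JM[of t] that by simp
    show "continuous_on {0..b} (\<lambda>t. \<bar>?si k t \<omega> - J t \<omega>\<bar>)" if "\<omega> \<in> space M" for \<omega>
    proof (rule continuous_on_subset[of "{0..}"])
      show "continuous_on {0..} (\<lambda>t. \<bar>?si k t \<omega> - J t \<omega>\<bar>)"
        using si_cont[OF that, of k] J(2) that
        unfolding continuous_paths_def by (intro continuous_on_rabs continuous_on_diff) auto
    qed auto
  qed
  have Q1: "?Q1 k \<in> borel_measurable M" for k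
    by (rule square_nn_integral_measurable[where T = b])
      (auto intro!: borel_measurable_diff progressively_measurable_joint[OF prog b] simple_process_joint[OF simp])
  have Q2: "?Q2 k \<in> borel_measurable M" for k
    by (rule square_nn_integral_measurable[where T = b]) (measurable, use ab in auto)
  have Q3: "?Q3 \<in> borel_measurable M"
    using oscillation_measurable[OF prog ab(1)] ab(2) by simp
  have E2: "?E2 k \<in> sets M" for k using Q1[of k] by measurable
  have E: "?E \<in> sets M" using Q3 by measurable
  have E3: "?E3 k \<in> sets M" for k
  proof -
    have "{\<omega>\<in>space M. \<exists>s\<in>D. l < \<bar>?si k s \<omega> - ?si k a \<omega> - H a \<omega> * (B s \<omega> - B a \<omega>)\<bar>} \<in> sets M"
    proof (rule sets.sets_Collect_finite_Ex[OF _ D(1)])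
      fix s assume "s \<in> D"
      then have s: "0 \<le> s" using D ab by auto
      note [measurable] = siM[OF s, of k] siM[OF ab(1), of k] B_measurable[OF s] B_measurable[OF ab(1)]
      show "{\<omega>\<in>space M. l < \<bar>?si k s \<omega> - ?si k a \<omega> - H a \<omega> * (B s \<omega> - B a \<omega>)\<bar>} \<in> sets M" by measurable
    qed
    moreover have "{\<omega>\<in>space M. ?Q2 k \<omega> \<le> ennreal C} \<in> sets M"
      using Q2[of k] by measurable
    ultimately have "{\<omega>\<in>space M. \<exists>s\<in>D. l < \<bar>?si k s \<omega> - ?si k a \<omega> - H a \<omega> * (B s \<omega> - B a \<omega>)\<bar>}
      \<inter> {\<omega>\<in>space M. ?Q2 k \<omega> \<le> ennreal C} \<in> sets M"
      by (rule sets.Int)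
    also have "{\<omega>\<in>space M. \<exists>s\<in>D. l < \<bar>?si k s \<omega> - ?si k a \<omega> - H a \<omega> * (B s \<omega> - B a \<omega>)\<bar>}
      \<inter> {\<omega>\<in>space M. ?Q2 k \<omega> \<le> ennreal C} = ?E3 k" by blast
    finally show ?thesis .
  qed
  have Q_le: "?Q2 k \<omega> \<le> 2 * ?Q1 k \<omega> + 2 * ?Q3 \<omega>" if \<omega>: "\<omega> \<in> space M" for k \<omega>
  proof -
    have Hs: "(\<lambda>s. H s \<omega>) \<in> borel_measurable (restrict_space borel {0..b})"
      by (rule progressively_measurable_section[OF prog \<omega> b])
    have sps: "(\<lambda>s. ?sp k s \<omega>) \<in> borel_measurable (restrict_space borel {0..b})"
      unfolding simple_process_def by (intro measurable_restrict_space1 borel_measurable_sum) measurable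
    note [measurable] = Hs sps
    have "(\<lambda>s. ennreal ((?sp k s \<omega> - H s \<omega>)\<^sup>2)) \<in> borel_measurable (restrict_space borel {0..b})"
      by measurable
    then have m1: "(\<lambda>s. ennreal ((?sp k s \<omega> - H s \<omega>)\<^sup>2) * indicator {0..b} s) \<in> borel_measurable lborel"
      by (subst (asm) borel_measurable_restrict_space_iff_ennreal) (simp_all add: borel_closed)
    have "(\<lambda>s. ennreal ((H s \<omega> - H a \<omega>)\<^sup>2)) \<in> borel_measurable (restrict_space borel {0..b})"
      by measurable
    then have "(\<lambda>s. ennreal ((H s \<omega> - H a \<omega>)\<^sup>2) * indicator {0..b} s) \<in> borel_measurable lborel"
      by (subst (asm) borel_measurable_restrict_space_iff_ennreal) (simp_all add: borel_closed)
    then have "(\<lambda>s. ennreal ((H s \<omega> - H a \<omega>)\<^sup>2) * indicator {0..b} s * indicator {a..b} s) \<in> borel_measurable lborel"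
      by (rule borel_measurable_times_ennreal) simp
    also have "(\<lambda>s. ennreal ((H s \<omega> - H a \<omega>)\<^sup>2) * indicator {0..b} s * indicator {a..b} s)
      = (\<lambda>s. ennreal ((H s \<omega> - H a \<omega>)\<^sup>2) * indicator {a..b} s)"
      using ab by (auto split: split_indicator)
    finally have m2: "(\<lambda>s. ennreal ((H s \<omega> - H a \<omega>)\<^sup>2) * indicator {a..b} s) \<in> borel_measurable lborel" .
    have real_ineq: "(x - z)\<^sup>2 \<le> 2 * (x - y)\<^sup>2 + 2 * (y - z)\<^sup>2" for x y z :: real
      using zero_le_power2[of "(x - y) - (y - z)"] by (simp add: power2_eq_square algebra_simps)
    have "?Q2 k \<omega> \<le> (\<integral>\<^sup>+s. 2 * (ennreal ((?sp k s \<omega> - H s \<omega>)\<^sup>2) * indicator {0..b} s)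
        + 2 * (ennreal ((H s \<omega> - H a \<omega>)\<^sup>2) * indicator {a..b} s) \<partial>lborel)"
    proof (rule nn_integral_mono)
      fix s :: real
      show "ennreal ((?sp k s \<omega> - H a \<omega>)\<^sup>2) * indicator {a..b} s
        \<le> 2 * (ennreal ((?sp k s \<omega> - H s \<omega>)\<^sup>2) * indicator {0..b} s) + 2 * (ennreal ((H s \<omega> - H a \<omega>)\<^sup>2) * indicator {a..b} s)"
      proof (cases "s \<in> {a..b}")
        case True
        have "ennreal ((?sp k s \<omega> - H a \<omega>)\<^sup>2) \<le> ennreal (2 * (?sp k s \<omega> - H s \<omega>)\<^sup>2 + 2 * (H s \<omega> - H a \<omega>)\<^sup>2)"
          by (intro ennreal_leI real_ineq)
        also have "\<dots> = 2 * ennreal ((?sp k s \<omega> - H s \<omega>)\<^sup>2) + 2 * ennreal ((H s \<omega> - H a \<omega>)\<^sup>2)"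
          by (simp add: ennreal_plus ennreal_mult)
        finally show ?thesis using True ab by simp
      qed simp
    qed
    also have "\<dots> = 2 * ?Q1 k \<omega> + 2 * ?Q3 \<omega>"
      using m1 m2 by (simp add: nn_integral_add nn_integral_cmult)
    finally show ?thesis .
  qed
  \<comment> \<open>Off the two approximation events and the oscillation event, a deviation of J
    forces one of the simple integral, while its quadratic variation is at most C.\<close>
  have sub: "?A \<subseteq> ?E3 k \<union> ?E1 k \<union> ?E2 k \<union> ?E" for k
  proof
    fix \<omega> assume \<omega>: "\<omega> \<in> ?A"
    show "\<omega> \<in> ?E3 k \<union> ?E1 k \<union> ?E2 k \<union> ?E"
    proof (rule ccontr)
      assume n: "\<omega> \<notin> ?E3 k \<union> ?E1 k \<union> ?E2 k \<union> ?E"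
      obtain s where s: "s \<in> D" "2 * l < \<bar>J s \<omega> - J a \<omega> - H a \<omega> * (B s \<omega> - B a \<omega>)\<bar>" using \<omega> by blast
      have "\<bar>?si k t \<omega> - J t \<omega>\<bar> \<le> l / 2" if "t \<in> {0..b}" for t
      proof (rule ccontr)
        assume "\<not> ?thesis"
        then have "l / 2 < \<bar>?si k t \<omega> - J t \<omega>\<bar>" by simp
        then show False using n \<omega> that by blast
      qed
      moreover have "s \<in> {0..b}" "a \<in> {0..b}" using s(1) D ab by auto
      ultimately have "\<bar>?si k s \<omega> - J s \<omega>\<bar> \<le> l / 2" "\<bar>?si k a \<omega> - J a \<omega>\<bar> \<le> l / 2" by blast+
      with s(2) have big: "l < \<bar>?si k s \<omega> - ?si k a \<omega> - H a \<omega> * (B s \<omega> - B a \<omega>)\<bar>"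
        by linarith
      have "?Q1 k \<omega> \<le> ennreal (C / 4)" "?Q3 \<omega> \<le> ennreal (C / 4)" using n \<omega> by (auto simp: not_less)
      then have "2 * ?Q1 k \<omega> + 2 * ?Q3 \<omega> \<le> 2 * ennreal (C / 4) + 2 * ennreal (C / 4)"
        by (intro add_mono mult_left_mono) auto
      then have "?Q2 k \<omega> \<le> 2 * ennreal (C / 4) + 2 * ennreal (C / 4)"
        using Q_le[of \<omega> k] \<omega> by (auto intro: order_trans)
      moreover have "2 * ennreal (C / 4) = ennreal (C / 2)"
        using pos ennreal_mult[of 2 "C / 4"] by simp
      moreover have "ennreal (C / 2) + ennreal (C / 2) = ennreal C"
        using pos by (simp add: ennreal_plus[symmetric] del: ennreal_plus)
      ultimately have "?Q2 k \<omega> \<le> ennreal C" by simp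
      then show False using n \<omega> s(1) big by blast
    qed
  qed
  have "prob ?A \<le> C / l\<^sup>2 + prob (?E1 k) + prob (?E2 k) + prob ?E" for k
  proof -
    have "prob ?A \<le> prob (?E3 k \<union> ?E1 k \<union> ?E2 k \<union> ?E)"
      by (rule finite_measure_mono[OF sub]) (intro sets.Un E1 E2 E3 E)
    also have "\<dots> \<le> prob (?E3 k \<union> ?E1 k \<union> ?E2 k) + prob ?E"
      by (intro measure_Un_le sets.Un E1 E2 E3 E)
    also have "prob (?E3 k \<union> ?E1 k \<union> ?E2 k) \<le> prob (?E3 k \<union> ?E1 k) + prob (?E2 k)"
      by (intro measure_Un_le sets.Un E1 E2 E3 E)
    also have "prob (?E3 k \<union> ?E1 k) \<le> prob (?E3 k) + prob (?E1 k)"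
      by (intro measure_Un_le sets.Un E1 E2 E3 E)
    also have "prob (?E3 k) \<le> C / l\<^sup>2"
      by (rule simple_integral_maximal[OF simp ab D HaF pos])
    finally show ?thesis by simp
  qed
  moreover have "(\<lambda>k. C / l\<^sup>2 + prob (?E1 k) + prob (?E2 k) + prob ?E) \<longlonglongrightarrow> C / l\<^sup>2 + 0 + 0 + prob ?E"
    using pos by (intro tendsto_add tendsto_const lim1 lim2 b) auto
  ultimately show ?thesis
    by (intro LIMSEQ_le_const[where X = "\<lambda>k. C / l\<^sup>2 + prob (?E1 k) + prob (?E2 k) + prob ?E"]) auto
qed

text \<open>The bound for finite sets does not depend on the set of times.\<close>

lemma ito_integral_window:
  assumes ito: "ito_integral M F B H J"
    and ab: "0 \<le> a" "a < b" and pos: "0 < C" "0 < l"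
  shows "prob {\<omega>\<in>space M. \<exists>s\<in>{a..b}. 2 * l < \<bar>J s \<omega> - J a \<omega> - H a \<omega> * (B s \<omega> - B a \<omega>)\<bar>}
    \<le> C / l\<^sup>2 + prob {\<omega>\<in>space M. ennreal (C / 4) < (\<integral>\<^sup>+s\<in>{a..b}. ennreal ((H s \<omega> - H a \<omega>)\<^sup>2) \<partial>lborel)}"
proof (rule measure_ex_Icc_le)
  have prog: "progressively_measurable F H" and J: "adapted F J" "continuous_paths M J"
    using ito by (auto simp: ito_integral_def)
  have JM: "J t \<in> borel_measurable M" if "0 \<le> t" for t
    using J(1) measurable_F_M[OF that] that by (auto simp: adapted_def)
  have Ha: "H a \<in> borel_measurable M"
    using progressively_measurable_adapted[OF prog ab(1)] measurable_F_M ab by blast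
  show "(\<lambda>\<omega>. \<bar>J t \<omega> - J a \<omega> - H a \<omega> * (B t \<omega> - B a \<omega>)\<bar>) \<in> borel_measurable M" if "t \<in> {a..b}" for t
    using JM[of t] JM[of a] Ha B_measurable[of t] B_measurable[of a] that ab by simp
  show "continuous_on {a..b} (\<lambda>t. \<bar>J t \<omega> - J a \<omega> - H a \<omega> * (B t \<omega> - B a \<omega>)\<bar>)" if "\<omega> \<in> space M" for \<omega>
  proof (rule continuous_on_subset[of "{0..}"])
    show "continuous_on {0..} (\<lambda>t. \<bar>J t \<omega> - J a \<omega> - H a \<omega> * (B t \<omega> - B a \<omega>)\<bar>)"
      using B_continuous[OF that] J(2) that unfolding continuous_paths_def
      by (intro continuous_on_rabs continuous_on_diff continuous_on_mult continuous_on_const) auto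
  qed (use ab in auto)
  fix D assume "finite D" "D \<subseteq> {a..b}" "a \<in> D" "b \<in> D"
  then show "prob {\<omega>\<in>space M. \<exists>s\<in>D. 2 * l < \<bar>J s \<omega> - J a \<omega> - H a \<omega> * (B s \<omega> - B a \<omega>)\<bar>}
    \<le> C / l\<^sup>2 + prob {\<omega>\<in>space M. ennreal (C / 4) < (\<integral>\<^sup>+s\<in>{a..b}. ennreal ((H s \<omega> - H a \<omega>)\<^sup>2) \<partial>lborel)}"
    by (intro ito_integral_window_finite assms)
qed (use ab in auto)

end

section \<open>The diffusion near time 1\<close>

text \<open>By compactness of [0,n], the level x is hit before time n when the distance to x falls
  below every 1/(m+1) there. The minus signs bring the condition into the form of
  \<open>measurable_ex_Icc\<close>.\<close>

lemma measurable_hits: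
  fixes X :: "real \<Rightarrow> 'a \<Rightarrow> real"
  assumes X: "\<And>t. 0 \<le> t \<Longrightarrow> X t \<in> borel_measurable M"
    and cont: "\<And>\<omega>. \<omega> \<in> space M \<Longrightarrow> continuous_on {0..} (\<lambda>t. X t \<omega>)"
  shows "{\<omega>\<in>space M. \<exists>t\<ge>0. X t \<omega> = x} \<in> sets M"
proof -
  have c: "continuous_on {0..real n} (\<lambda>t. X t \<omega>)" if "\<omega> \<in> space M" for \<omega> n
    by (rule continuous_on_subset[OF cont[OF that]]) auto
  have iff: "(\<exists>t\<ge>0. X t \<omega> = x) \<longleftrightarrow> (\<exists>n. \<forall>m. \<exists>t\<in>{0..real n}. - 1 / real (Suc m) < - \<bar>X t \<omega> - x\<bar>)"
    if \<omega>: "\<omega> \<in> space M" for \<omega>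
  proof
    assume "\<exists>t\<ge>0. X t \<omega> = x"
    then obtain t where t: "0 \<le> t" "X t \<omega> = x" by blast
    obtain n :: nat where "t \<le> real n" using real_arch_simple by blast
    then show "\<exists>n. \<forall>m. \<exists>t\<in>{0..real n}. - 1 / real (Suc m) < - \<bar>X t \<omega> - x\<bar>"
      using t by (intro exI[of _ n] allI bexI[of _ t]) auto
  next
    assume "\<exists>n. \<forall>m. \<exists>t\<in>{0..real n}. - 1 / real (Suc m) < - \<bar>X t \<omega> - x\<bar>"
    then obtain n where n: "\<And>m. \<exists>t\<in>{0..real n}. - 1 / real (Suc m) < - \<bar>X t \<omega> - x\<bar>" by blast
    have "\<exists>t0\<in>{0..real n}. \<forall>t\<in>{0..real n}. \<bar>X t0 \<omega> - x\<bar> \<le> \<bar>X t \<omega> - x\<bar>"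
      by (intro continuous_attains_inf continuous_on_rabs continuous_on_diff c[OF \<omega>] continuous_on_const) auto
    then obtain t0 where t0: "t0 \<in> {0..real n}" "\<And>t. t \<in> {0..real n} \<Longrightarrow> \<bar>X t0 \<omega> - x\<bar> \<le> \<bar>X t \<omega> - x\<bar>" by blast
    have lt: "\<bar>X t0 \<omega> - x\<bar> < 1 / real (Suc m)" for m
    proof -
      obtain t where "t \<in> {0..real n}" "- 1 / real (Suc m) < - \<bar>X t \<omega> - x\<bar>" using n by blast
      then show ?thesis using t0(2)[of t] by simp
    qed
    have "\<bar>X t0 \<omega> - x\<bar> = 0"
    proof (rule ccontr)
      assume "\<bar>X t0 \<omega> - x\<bar> \<noteq> 0"
      then obtain m where "1 / real (Suc m) < \<bar>X t0 \<omega> - x\<bar>" using nat_approx_posE[of "\<bar>X t0 \<omega> - x\<bar>"] by auto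
      then show False using lt[of m] by simp
    qed
    then show "\<exists>t\<ge>0. X t \<omega> = x" using t0(1) by (intro exI[of _ t0]) auto
  qed
  have "{\<omega>\<in>space M. \<exists>t\<ge>0. X t \<omega> = x}
    = {\<omega>\<in>space M. \<exists>n. \<forall>m. \<exists>t\<in>{0..real n}. - 1 / real (Suc m) < - \<bar>X t \<omega> - x\<bar>}"
    by (rule Collect_cong, rule conj_cong[OF refl iff])
  also have "\<dots> = (\<Union>n. \<Inter>m. {\<omega>\<in>space M. \<exists>t\<in>{0..real n}. - 1 / real (Suc m) < - \<bar>X t \<omega> - x\<bar>})"
    by blast
  also have "\<dots> \<in> sets M"
  proof (intro sets.countable_UN sets.countable_INT image_subsetI measurable_ex_Icc)
    fix n t assume "t \<in> {0..real n}"
    then have [measurable]: "X t \<in> borel_measurable M" using X by simp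
    show "(\<lambda>\<omega>. - \<bar>X t \<omega> - x\<bar>) \<in> borel_measurable M" by measurable
  next
    fix n \<omega> assume "\<omega> \<in> space M"
    then show "continuous_on {0..real n} (\<lambda>t. - \<bar>X t \<omega> - x\<bar>)"
      by (intro continuous_on_minus continuous_on_rabs continuous_on_diff c continuous_on_const)
  qed auto
  finally show ?thesis .
qed

text \<open>Reduces uncountably many exceptional levels to countably many: a path that exceeds a
  level of A also exceeds one of the chosen levels.\<close>

lemma countable_coinitial:
  fixes A :: "real set"
  assumes "bdd_below A"
  obtains C where "countable C" "C \<subseteq> A" "\<And>x. x \<in> A \<Longrightarrow> \<exists>c\<in>C. c \<le> x"
proof (cases "A = {} \<or> Inf A \<in> A")
  case True
  have le: "Inf A \<le> x" if "x \<in> A" for x using cInf_lower[OF that assms] .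
  show ?thesis
  proof (rule that[of "if A = {} then {} else {Inf A}"])
    show "\<exists>c\<in>(if A = {} then {} else {Inf A}). c \<le> x" if "x \<in> A" for x
      using le[OF that] that by auto
  qed (use True in auto)
next
  case False
  have "\<exists>c\<in>A. c < Inf A + 1 / real (Suc n)" for n
    using cInf_lessD[of A "Inf A + 1 / real (Suc n)"] False by auto
  then obtain c where c: "\<And>n. c n \<in> A" "\<And>n. c n < Inf A + 1 / real (Suc n)" by metis
  show ?thesis
  proof (rule that[of "range c"])
    fix x assume x: "x \<in> A"
    then have "Inf A < x" using cInf_lower[OF x assms] False by (cases "Inf A = x") auto
    then obtain n where "1 / real (Suc n) < x - Inf A" using nat_approx_posE[of "x - Inf A"] by auto
    then show "\<exists>c\<in>range c. c \<le> x" using c(2)[of n] by (intro bexI[of _ "c n"]) auto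
  qed (use c in auto)
qed

text \<open>By the intermediate value theorem, exceeding a point outside the range means hitting one of
  countably many points, each of which is hit with probability \<open>0\<close>.\<close>

lemma (in prob_space) AE_above_in_process_range:
  fixes X :: "real \<Rightarrow> 'a \<Rightarrow> real"
  assumes X: "\<And>t. 0 \<le> t \<Longrightarrow> X t \<in> borel_measurable M"
    and cont: "\<And>\<omega>. \<omega> \<in> space M \<Longrightarrow> continuous_on {0..} (\<lambda>t. X t \<omega>)"
    and start: "AE \<omega> in M. X 0 \<omega> = x0"
  shows "AE \<omega> in M. \<forall>t\<ge>0. x0 \<le> X t \<omega> \<longrightarrow> X t \<omega> \<in> process_range M X"
proof -
  define A where "A = {x. x0 \<le> x \<and> x \<notin> process_range M X}"
  have "bdd_below A" by (auto simp: A_def intro!: bdd_belowI[of _ x0])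
  then obtain C where C: "countable C" "C \<subseteq> A" "\<And>x. x \<in> A \<Longrightarrow> \<exists>c\<in>C. c \<le> x"
    using countable_coinitial by blast
  have "AE \<omega> in M. \<forall>c\<in>C. \<omega> \<notin> {\<omega>\<in>space M. \<exists>t\<ge>0. X t \<omega> = c}"
    unfolding AE_ball_countable[OF C(1)]
  proof
    fix c assume "c \<in> C"
    then have "\<not> 0 < prob {\<omega>\<in>space M. \<exists>t\<ge>0. X t \<omega> = c}" using C(2) by (auto simp: A_def process_range_def)
    then have "prob {\<omega>\<in>space M. \<exists>t\<ge>0. X t \<omega> = c} = 0" by (simp add: zero_less_measure_iff)
    then have "{\<omega>\<in>space M. \<exists>t\<ge>0. X t \<omega> = c} \<in> null_sets M"
      using measurable_hits[OF X cont] by (simp add: null_sets_def emeasure_eq_measure)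
    then show "AE \<omega> in M. \<omega> \<notin> {\<omega>\<in>space M. \<exists>t\<ge>0. X t \<omega> = c}" by (rule AE_not_in)
  qed
  then show ?thesis
    using start AE_space
  proof eventually_elim
    case (elim \<omega>)
    show ?case
    proof (intro allI impI, rule ccontr)
      fix t assume t: "0 \<le> t" "x0 \<le> X t \<omega>" "X t \<omega> \<notin> process_range M X"
      then obtain c where c: "c \<in> C" "c \<le> X t \<omega>" using C(3)[of "X t \<omega>"] by (auto simp: A_def)
      then have "X 0 \<omega> \<le> c" using C(2) elim by (auto simp: A_def)
      then have "\<exists>s\<ge>0. s \<le> t \<and> X s \<omega> = c"
        using c t continuous_on_subset[OF cont[of \<omega>], of "{0..t}"] elim by (intro IVT') auto
      then show False using elim c by blast
    qed
  qed
qed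

text \<open>The part below \<open>x0\<close> follows by reflecting the process. One null set has to
  serve all times, since \<sigma> is continuous on the range only and the path is composed with it
  as a whole.\<close>

lemma (in prob_space) AE_in_process_range:
  fixes X :: "real \<Rightarrow> 'a \<Rightarrow> real"
  assumes X: "\<And>t. 0 \<le> t \<Longrightarrow> X t \<in> borel_measurable M"
    and cont: "\<And>\<omega>. \<omega> \<in> space M \<Longrightarrow> continuous_on {0..} (\<lambda>t. X t \<omega>)"
    and start: "AE \<omega> in M. X 0 \<omega> = x0"
  shows "AE \<omega> in M. \<forall>t\<ge>0. X t \<omega> \<in> process_range M X"
proof -
  have neg: "x \<in> process_range M (\<lambda>t \<omega>. - X t \<omega>) \<longleftrightarrow> - x \<in> process_range M X" for x
    unfolding process_range_def by (simp add: minus_equation_iff[of _ x] eq_commute[of "- x"])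
  have "AE \<omega> in M. \<forall>t\<ge>0. - x0 \<le> - X t \<omega> \<longrightarrow> - X t \<omega> \<in> process_range M (\<lambda>t \<omega>. - X t \<omega>)"
    by (rule AE_above_in_process_range) (use X start in \<open>auto intro!: continuous_on_minus cont\<close>)
  moreover have "AE \<omega> in M. \<forall>t\<ge>0. x0 \<le> X t \<omega> \<longrightarrow> X t \<omega> \<in> process_range M X"
    by (rule AE_above_in_process_range[OF X cont start])
  ultimately show ?thesis
  proof eventually_elim
    case (elim \<omega>)
    then show ?case unfolding neg by (metis linear minus_minus neg_le_iff_le)
  qed
qed

lemma locally_bounded_compact:
  assumes "locally_bounded g" "compact C"
  shows "bounded (g ` C)"
proof -
  obtain r where r: "\<And>x. 0 < r x" "\<And>x. bounded (g ` ball x (r x))"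
    using assms(1) unfolding locally_bounded_def by metis
  have "C \<subseteq> (\<Union>x\<in>C. ball x (r x))" using r(1) by auto
  then obtain D where D: "D \<subseteq> C" "finite D" "C \<subseteq> (\<Union>x\<in>D. ball x (r x))"
    using compactE_image[OF assms(2), of C "\<lambda>x. ball x (r x)"] by auto
  have "bounded (\<Union>x\<in>D. g ` ball x (r x))" using D(2) r(2) by (intro bounded_UN) auto
  then show ?thesis by (rule bounded_subset) (use D(3) in blast)
qed

text \<open>Turns pathwise statements with thresholds depending on \<omega> into convergence of
  probabilities, by dominated convergence along sequences.\<close>

lemma (in prob_space) prob_tendsto_0_at_right:
  fixes E :: "real \<Rightarrow> 'a set"
  assumes "0 < b" and E: "\<And>\<epsilon>. 0 < \<epsilon> \<Longrightarrow> \<epsilon> < b \<Longrightarrow> E \<epsilon> \<in> sets M"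
    and ev: "AE \<omega> in M. eventually (\<lambda>\<epsilon>. \<omega> \<notin> E \<epsilon>) (at_right 0)"
  shows "((\<lambda>\<epsilon>. prob (E \<epsilon>)) \<longlongrightarrow> 0) (at_right 0)"
proof (rule tendsto_at_right_sequentially[OF assms(1)])
  fix S :: "nat \<Rightarrow> real"
  assume S: "\<And>n. 0 < S n" "\<And>n. S n < b" "S \<longlonglongrightarrow> 0"
  have "filterlim S (at_right 0) sequentially"
    using S by (intro tendsto_imp_filterlim_at_right) auto
  then have sub: "eventually (\<lambda>n. P (S n)) sequentially" if "eventually P (at_right 0)" for P
    using that by (auto simp: filterlim_iff)
  have "(\<lambda>n. \<integral>\<omega>. indicator (E (S n)) \<omega> \<partial>M) \<longlonglongrightarrow> (\<integral>\<omega>. (0 :: real) \<partial>M)"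
  proof (rule integral_dominated_convergence[where w = "\<lambda>_. 1"])
    show "(indicator (E (S n)) :: 'a \<Rightarrow> real) \<in> borel_measurable M" for n
      using E[OF S(1,2)] by simp
    show "AE \<omega> in M. (\<lambda>n. indicator (E (S n)) \<omega> :: real) \<longlonglongrightarrow> 0"
      using ev
    proof eventually_elim
      case (elim \<omega>)
      have "eventually (\<lambda>n. indicator (E (S n)) \<omega> = (0 :: real)) sequentially"
        using sub[OF elim] by eventually_elim simp
      then show ?case by (rule tendsto_eventually)
    qed
    show "AE \<omega> in M. norm (indicator (E (S n)) \<omega> :: real) \<le> 1" for n by (auto split: split_indicator)
  qed auto
  moreover have "(\<integral>\<omega>. indicator (E (S n)) \<omega> \<partial>M) = prob (E (S n))" for n
    using E[OF S(1,2), of n] by simp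
  ultimately show "(\<lambda>n. prob (E (S n))) \<longlonglongrightarrow> 0" by simp
qed

section \<open>Rounding the coefficient and comparing paths in a window\<close>

definition scale :: "real \<Rightarrow> cpath \<Rightarrow> cpath" where
  "scale c x = path_of (\<lambda>t. c * at_time x t)"

lemma at_time_scale: "at_time (scale c x) t = c * at_time x t"
  unfolding scale_def using at_time_neg[of t x]
  by (subst at_time_path_of) (auto intro!: continuous_intros simp: max_def)

text \<open>The mesh is 1/m^2 because the rounding error gets multiplied by rescaled Brownian
  increments of size up to 2 m. Larger values than m are sent to 0 so that finitely many values
  remain; the price is the probability that \<open>\<sigma> (X 1)\<close> exceeds m.\<close>

definition quantize :: "nat \<Rightarrow> real \<Rightarrow> real" where
  "quantize m s = (if s \<le> real m then real_of_int \<lfloor>s * (real m)\<^sup>2\<rfloor> / (real m)\<^sup>2 else 0)"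

lemma quantize_measurable [measurable]: "quantize m \<in> borel_measurable borel"
  unfolding quantize_def[abs_def] by measurable

lemma quantize_close:
  assumes "s \<le> real m" "0 < m"
  shows "\<bar>s - quantize m s\<bar> \<le> 1 / (real m)\<^sup>2"
proof -
  define k where "k = (real m)\<^sup>2"
  have k: "0 < k" using assms by (simp add: k_def)
  have "s - of_int \<lfloor>s * k\<rfloor> / k = (s * k - of_int \<lfloor>s * k\<rfloor>) / k" using k by (simp add: field_simps)
  moreover have "0 \<le> s * k - of_int \<lfloor>s * k\<rfloor>" "s * k - of_int \<lfloor>s * k\<rfloor> \<le> 1" by linarith+
  ultimately have "\<bar>s - of_int \<lfloor>s * k\<rfloor> / k\<bar> \<le> 1 / k" using k by (simp add: divide_right_mono)
  then show ?thesis using assms(1) by (simp add: quantize_def k_def)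
qed

text \<open>Both times u and v are referred to the left end a, because the estimates of drift and
  Ito integral start there. This costs four errors \<eta> \<epsilon>^(1/2) and doubles the bound on
  the Brownian increment.\<close>

lemma window_estimate:
  fixes x j w :: "real \<Rightarrow> real"
  assumes \<epsilon>: "0 < \<epsilon>" and in_window: "u \<in> I" "v \<in> I"
    and xj: "\<And>s. s \<in> I \<Longrightarrow> \<bar>x s - x a - (j s - j a)\<bar> \<le> \<eta> * sqrt \<epsilon>"
    and jw: "\<And>s. s \<in> I \<Longrightarrow> \<bar>j s - j a - h * (w s - w a)\<bar> \<le> \<eta> * sqrt \<epsilon>"
    and w: "\<And>s. s \<in> I \<Longrightarrow> \<bar>w s - w a\<bar> \<le> K * sqrt \<epsilon>"
  shows "\<bar>(x u - x v) / sqrt \<epsilon> - c * ((w u - w v) / sqrt \<epsilon>)\<bar> \<le> 4 * \<eta> + \<bar>h - c\<bar> * (2 * K)"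
proof -
  have p: "0 < sqrt \<epsilon>" using \<epsilon> by simp
  have "\<bar>w u - w v\<bar> \<le> 2 * K * sqrt \<epsilon>" using w[OF in_window(1)] w[OF in_window(2)] by linarith
  then have 1: "\<bar>(h - c) * (w u - w v)\<bar> \<le> \<bar>h - c\<bar> * (2 * K * sqrt \<epsilon>)"
    unfolding abs_mult by (intro mult_left_mono) auto
  have split: "x u - x v - c * (w u - w v)
    = (x u - x a - (j u - j a)) - (x v - x a - (j v - j a))
      + (j u - j a - h * (w u - w a)) - (j v - j a - h * (w v - w a)) + (h - c) * (w u - w v)"
    by (simp add: algebra_simps)
  have tri: "\<bar>p - q + r - s + y\<bar> \<le> \<bar>p\<bar> + \<bar>q\<bar> + \<bar>r\<bar> + \<bar>s\<bar> + \<bar>y\<bar>" for p q r s y :: real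
    by linarith
  have "\<bar>x u - x v - c * (w u - w v)\<bar>
    \<le> \<bar>x u - x a - (j u - j a)\<bar> + \<bar>x v - x a - (j v - j a)\<bar> + \<bar>j u - j a - h * (w u - w a)\<bar>
      + \<bar>j v - j a - h * (w v - w a)\<bar> + \<bar>(h - c) * (w u - w v)\<bar>"
    unfolding split by (rule tri)
  also have "\<dots> \<le> \<eta> * sqrt \<epsilon> + \<eta> * sqrt \<epsilon> + \<eta> * sqrt \<epsilon> + \<eta> * sqrt \<epsilon> + \<bar>h - c\<bar> * (2 * K * sqrt \<epsilon>)"
    by (intro add_mono xj jw in_window 1)
  also have "\<dots> = (4 * \<eta> + \<bar>h - c\<bar> * (2 * K)) * sqrt \<epsilon>" by (simp add: algebra_simps)
  finally have "\<bar>x u - x v - c * (w u - w v)\<bar> / sqrt \<epsilon> \<le> 4 * \<eta> + \<bar>h - c\<bar> * (2 * K)"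
    using p by (simp add: pos_divide_le_eq)
  moreover have "(x u - x v) / sqrt \<epsilon> - c * ((w u - w v) / sqrt \<epsilon>) = (x u - x v - c * (w u - w v)) / sqrt \<epsilon>"
    by (simp add: diff_divide_distrib right_diff_distrib)
  ultimately show ?thesis using p by simp
qed

section \<open>Drift and coefficient over shrinking windows\<close>

text \<open>Continuity of \<sigma> on the range is recorded in the form in which the estimates use
  it, as continuity in time along almost every path.\<close>

locale diffusion = filtered_brownian_motion M F W
  for M :: "'a measure" and F :: "real \<Rightarrow> 'a measure" and W :: "real \<Rightarrow> 'a \<Rightarrow> real" +
  fixes X J :: "real \<Rightarrow> 'a \<Rightarrow> real" and \<mu> \<sigma> :: "real \<Rightarrow> real" and x0 :: real
  assumes X_adapted: "adapted F X" and X_paths: "continuous_paths M X"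
    and ito: "ito_integral M F W (\<lambda>t \<omega>. \<sigma> (X t \<omega>)) J"
    and sde: "AE \<omega> in M. \<forall>t\<ge>0. (\<lambda>s. \<mu> (X s \<omega>)) absolutely_integrable_on {0..t} \<and>
      X t \<omega> = x0 + integral {0..t} (\<lambda>s. \<mu> (X s \<omega>)) + J t \<omega>"
    and \<mu>_bounded: "locally_bounded \<mu>"
    and \<sigma>_continuous: "AE \<omega> in M. continuous_on {0..} (\<lambda>t. \<sigma> (X t \<omega>))"
    and \<sigma>_nonneg: "0 \<le> \<sigma> x"
begin

lemma X_measurable: "0 \<le> t \<Longrightarrow> X t \<in> borel_measurable M"
  using X_adapted measurable_F_M[of t "X t" borel] by (auto simp: adapted_def)

lemma X_cont: "\<omega> \<in> space M \<Longrightarrow> continuous_on {0..} (\<lambda>t. X t \<omega>)"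
  using X_paths by (auto simp: continuous_paths_def)

lemma J_measurable: "0 \<le> t \<Longrightarrow> J t \<in> borel_measurable M"
  using ito measurable_F_M[of t "J t" borel] by (auto simp: adapted_def ito_integral_def)

lemma J_cont: "\<omega> \<in> space M \<Longrightarrow> continuous_on {0..} (\<lambda>t. J t \<omega>)"
  using ito by (auto simp: continuous_paths_def ito_integral_def)

lemma \<sigma>X_progressive: "progressively_measurable F (\<lambda>t \<omega>. \<sigma> (X t \<omega>))"
  using ito by (simp add: ito_integral_def)

lemma \<sigma>X_measurable: "0 \<le> t \<Longrightarrow> (\<lambda>\<omega>. \<sigma> (X t \<omega>)) \<in> borel_measurable M"
  using progressively_measurable_adapted[OF \<sigma>X_progressive] measurable_F_M by blast

text \<open>Along a fixed path the drift coefficient is bounded on [0,2], so its integral over the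
  window is of order \<epsilon> and eventually below \<eta> \<epsilon>^(1/2). The bound is random,
  hence the conclusion is about probabilities.\<close>

lemma drift_vanishes:
  assumes m: "0 < m" and \<eta>: "0 < \<eta>"
  shows "((\<lambda>\<epsilon>. prob {\<omega>\<in>space M. \<exists>s\<in>{1 - \<epsilon> * m..1 + \<epsilon> * m}.
      \<eta> * sqrt \<epsilon> < \<bar>X s \<omega> - X (1 - \<epsilon> * m) \<omega> - (J s \<omega> - J (1 - \<epsilon> * m) \<omega>)\<bar>}) \<longlongrightarrow> 0) (at_right 0)"
proof (rule prob_tendsto_0_at_right[of "1 / m"])
  show "0 < 1 / m" using m by simp
  fix \<epsilon> assume \<epsilon>: "0 < \<epsilon>" "\<epsilon> < 1 / m"
  then have a: "0 \<le> 1 - \<epsilon> * m" using m by (simp add: field_simps)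
  show "{\<omega>\<in>space M. \<exists>s\<in>{1 - \<epsilon> * m..1 + \<epsilon> * m}.
      \<eta> * sqrt \<epsilon> < \<bar>X s \<omega> - X (1 - \<epsilon> * m) \<omega> - (J s \<omega> - J (1 - \<epsilon> * m) \<omega>)\<bar>} \<in> sets M"
  proof (rule measurable_ex_Icc)
    show "(\<lambda>\<omega>. \<bar>X t \<omega> - X (1 - \<epsilon> * m) \<omega> - (J t \<omega> - J (1 - \<epsilon> * m) \<omega>)\<bar>) \<in> borel_measurable M"
      if "t \<in> {1 - \<epsilon> * m..1 + \<epsilon> * m}" for t
      using that a X_measurable[of t] X_measurable[of "1 - \<epsilon> * m"] J_measurable[of t] J_measurable[of "1 - \<epsilon> * m"] by simp
    show "continuous_on {1 - \<epsilon> * m..1 + \<epsilon> * m} (\<lambda>t. \<bar>X t \<omega> - X (1 - \<epsilon> * m) \<omega> - (J t \<omega> - J (1 - \<epsilon> * m) \<omega>)\<bar>)"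
      if "\<omega> \<in> space M" for \<omega>
      using X_cont[OF that] J_cont[OF that] a
      by (intro continuous_on_rabs continuous_on_diff continuous_on_const; elim continuous_on_subset; auto)
  qed
next
  show "AE \<omega> in M. eventually (\<lambda>\<epsilon>. \<omega> \<notin> {\<omega>\<in>space M. \<exists>s\<in>{1 - \<epsilon> * m..1 + \<epsilon> * m}.
      \<eta> * sqrt \<epsilon> < \<bar>X s \<omega> - X (1 - \<epsilon> * m) \<omega> - (J s \<omega> - J (1 - \<epsilon> * m) \<omega>)\<bar>}) (at_right 0)"
    using sde AE_space
  proof eventually_elim
    case (elim \<omega>)
    have "compact ((\<lambda>t. X t \<omega>) ` {0..2})"
      by (intro compact_continuous_image continuous_on_subset[OF X_cont[OF elim(2)]]) auto
    from locally_bounded_compact[OF \<mu>_bounded this] obtain K where "\<forall>r\<in>{0..2}. \<bar>\<mu> (X r \<omega>)\<bar> \<le> K"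
      unfolding bounded_iff by auto
    then have K: "\<bar>\<mu> (X r \<omega>)\<bar> \<le> K" if "r \<in> {0..2}" for r using that by blast
    have K0: "0 \<le> K" using K[of 0] by auto
    have "((\<lambda>\<epsilon>. sqrt \<epsilon> * (2 * K * m)) \<longlongrightarrow> sqrt 0 * (2 * K * m)) (at_right 0)"
      by (intro tendsto_intros)
    from order_tendstoD(2)[OF this, of \<eta>]
    have "eventually (\<lambda>\<epsilon>. sqrt \<epsilon> * (2 * K * m) < \<eta>) (at_right 0)" using \<eta> by simp
    moreover have "eventually (\<lambda>\<epsilon>. 0 < \<epsilon> \<and> \<epsilon> < 1 / m) (at_right 0)"
      using m by (intro eventually_at_rightI[of 0 "1 / m"]) auto
    ultimately show ?case
    proof eventually_elim
      case small: (elim \<epsilon>)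
      define a where "a = 1 - \<epsilon> * m"
      have am: "0 \<le> a" "\<epsilon> * m \<le> 1" using small m by (simp_all add: a_def field_simps)
      have "\<bar>X s \<omega> - X a \<omega> - (J s \<omega> - J a \<omega>)\<bar> \<le> \<eta> * sqrt \<epsilon>" if s: "s \<in> {a..1 + \<epsilon> * m}" for s
      proof -
        let ?f = "\<lambda>r. \<mu> (X r \<omega>)"
        have s0: "0 \<le> s" "a \<le> s" "s \<le> 2" using s am by auto
        have int: "?f integrable_on {0..s}"
          using elim(1) s0 by (auto intro: set_lebesgue_integral_eq_integral(1))
        have "integral {0..a} ?f + integral {a..s} ?f = integral {0..s} ?f"
          by (rule Henstock_Kurzweil_Integration.integral_combine[OF am(1) s0(2) int])
        moreover have "X s \<omega> = x0 + integral {0..s} ?f + J s \<omega>" "X a \<omega> = x0 + integral {0..a} ?f + J a \<omega>"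
          using elim(1) s0 am by blast+
        ultimately have "X s \<omega> - X a \<omega> - (J s \<omega> - J a \<omega>) = integral {a..s} ?f" by simp
        also have "\<bar>integral {a..s} ?f\<bar> \<le> integral {a..s} (\<lambda>_. K)"
          unfolding real_norm_def[symmetric]
        proof (rule Henstock_Kurzweil_Integration.integral_norm_bound_integral)
          show "?f integrable_on {a..s}" by (rule integrable_subinterval_real[OF int]) (use am s0 in auto)
          show "norm (?f r) \<le> K" if "r \<in> {a..s}" for r unfolding real_norm_def using that am s0 by (intro K) auto
        qed auto
        also have "\<dots> = K * (s - a)" using s0 by simp
        also have "\<dots> \<le> K * (2 * (\<epsilon> * m))" using s K0 by (intro mult_left_mono) (auto simp: a_def)
        also have "\<dots> = (sqrt \<epsilon> * (2 * K * m)) * sqrt \<epsilon>"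
          using small real_sqrt_mult_self[of \<epsilon>] by (simp add: algebra_simps)
        also have "\<dots> \<le> \<eta> * sqrt \<epsilon>" using small by (intro mult_right_mono) auto
        finally show ?thesis .
      qed
      then show ?case unfolding a_def by (auto simp: not_less)
    qed
  qed
qed

lemma \<sigma>X_close:
  assumes "continuous_on {0..} (\<lambda>t. \<sigma> (X t \<omega>))" "0 < \<kappa>" "0 < m"
  shows "eventually (\<lambda>\<epsilon>. 0 < \<epsilon> \<and> \<epsilon> * m < 1 \<and> (\<forall>s\<in>{1 - \<epsilon> * m..1 + \<epsilon> * m}. \<bar>\<sigma> (X s \<omega>) - \<sigma> (X 1 \<omega>)\<bar> < \<kappa>)) (at_right 0)"
proof -
  obtain d where d: "0 < d" "\<And>s. 0 \<le> s \<Longrightarrow> \<bar>s - 1\<bar> < d \<Longrightarrow> \<bar>\<sigma> (X s \<omega>) - \<sigma> (X 1 \<omega>)\<bar> < \<kappa>"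
    using assms(1,2) unfolding continuous_on_iff dist_real_def by (metis atLeast_iff zero_le_one)
  have "0 < min (1 / m) (d / m)" using d assms(3) by simp
  then show ?thesis
  proof (rule eventually_at_rightI[rotated])
    fix \<epsilon> assume "\<epsilon> \<in> {0<..<min (1 / m) (d / m)}"
    then have \<epsilon>: "0 < \<epsilon>" "\<epsilon> * m < 1" "\<epsilon> * m < d" using assms(3) by (auto simp: field_simps)
    show "0 < \<epsilon> \<and> \<epsilon> * m < 1 \<and> (\<forall>s\<in>{1 - \<epsilon> * m..1 + \<epsilon> * m}. \<bar>\<sigma> (X s \<omega>) - \<sigma> (X 1 \<omega>)\<bar> < \<kappa>)"
      using \<epsilon> by (auto intro!: d(2))
  qed
qed

text \<open>Serves to replace the coefficient frozen at the left end by the one at time 1, which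
  appears in the limit.\<close>

lemma coefficient_start_vanishes:
  assumes m: "0 < m" and r: "0 < r"
  shows "((\<lambda>\<epsilon>. prob {\<omega>\<in>space M. r < \<bar>\<sigma> (X (1 - \<epsilon> * m) \<omega>) - \<sigma> (X 1 \<omega>)\<bar>}) \<longlongrightarrow> 0) (at_right 0)"
proof (rule prob_tendsto_0_at_right[of "1 / m"])
  show "0 < 1 / m" using m by simp
  fix \<epsilon> assume "0 < \<epsilon>" "\<epsilon> < 1 / m"
  then have "0 \<le> 1 - \<epsilon> * m" using m by (simp add: field_simps)
  note [measurable] = \<sigma>X_measurable[OF this] \<sigma>X_measurable[of 1, simplified]
  show "{\<omega>\<in>space M. r < \<bar>\<sigma> (X (1 - \<epsilon> * m) \<omega>) - \<sigma> (X 1 \<omega>)\<bar>} \<in> sets M" by measurable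
next
  show "AE \<omega> in M. eventually (\<lambda>\<epsilon>. \<omega> \<notin> {\<omega>\<in>space M. r < \<bar>\<sigma> (X (1 - \<epsilon> * m) \<omega>) - \<sigma> (X 1 \<omega>)\<bar>}) (at_right 0)"
    using \<sigma>_continuous
  proof eventually_elim
    case (elim \<omega>)
    from \<sigma>X_close[OF elim r m] show ?case
    proof eventually_elim
      case (elim \<epsilon>)
      then have "1 - \<epsilon> * m \<in> {1 - \<epsilon> * m..1 + \<epsilon> * m}" using m by simp
      then show ?case using elim by force
    qed
  qed
qed

text \<open>The threshold is that of \<open>ito_integral_window\<close> with C = \<gamma>
  \<epsilon>.\<close>

lemma coefficient_oscillation_vanishes:
  assumes m: "0 < m" and \<gamma>: "0 < \<gamma>"
  shows "((\<lambda>\<epsilon>. prob {\<omega>\<in>space M. ennreal (\<gamma> * \<epsilon> / 4)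
    < (\<integral>\<^sup>+s\<in>{1 - \<epsilon> * m..1 + \<epsilon> * m}. ennreal ((\<sigma> (X s \<omega>) - \<sigma> (X (1 - \<epsilon> * m) \<omega>))\<^sup>2) \<partial>lborel)}) \<longlongrightarrow> 0) (at_right 0)"
proof (rule prob_tendsto_0_at_right[of "1 / m"])
  show "0 < 1 / m" using m by simp
  fix \<epsilon> assume "0 < \<epsilon>" "\<epsilon> < 1 / m"
  then have "0 \<le> 1 - \<epsilon> * m" "1 - \<epsilon> * m \<le> 1 + \<epsilon> * m" using m by (simp_all add: field_simps)
  note [measurable] = oscillation_measurable[OF \<sigma>X_progressive this]
  show "{\<omega>\<in>space M. ennreal (\<gamma> * \<epsilon> / 4)
    < (\<integral>\<^sup>+s\<in>{1 - \<epsilon> * m..1 + \<epsilon> * m}. ennreal ((\<sigma> (X s \<omega>) - \<sigma> (X (1 - \<epsilon> * m) \<omega>))\<^sup>2) \<partial>lborel)} \<in> sets M"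
    by measurable
next
  \<comment> \<open>Chosen so that (2 \<kappa>)^2 times the length 2 \<epsilon> m of the window
    equals \<gamma> \<epsilon>/4.\<close>
  define \<kappa> where "\<kappa> = sqrt (\<gamma> / (32 * m))"
  have \<kappa>: "0 < \<kappa>" "\<kappa>\<^sup>2 = \<gamma> / (32 * m)" using m \<gamma> by (simp_all add: \<kappa>_def)
  show "AE \<omega> in M. eventually (\<lambda>\<epsilon>. \<omega> \<notin> {\<omega>\<in>space M. ennreal (\<gamma> * \<epsilon> / 4)
    < (\<integral>\<^sup>+s\<in>{1 - \<epsilon> * m..1 + \<epsilon> * m}. ennreal ((\<sigma> (X s \<omega>) - \<sigma> (X (1 - \<epsilon> * m) \<omega>))\<^sup>2) \<partial>lborel)}) (at_right 0)"
    using \<sigma>_continuous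
  proof eventually_elim
    case (elim \<omega>)
    from \<sigma>X_close[OF elim \<kappa>(1) m] show ?case
    proof eventually_elim
      case (elim \<epsilon>)
      let ?a = "1 - \<epsilon> * m" and ?b = "1 + \<epsilon> * m"
      have ab: "?a \<le> ?b" using elim m by simp
      have "(\<integral>\<^sup>+s\<in>{?a..?b}. ennreal ((\<sigma> (X s \<omega>) - \<sigma> (X ?a \<omega>))\<^sup>2) \<partial>lborel)
        \<le> (\<integral>\<^sup>+s. ennreal (4 * \<kappa>\<^sup>2) * indicator {?a..?b} s \<partial>lborel)"
      proof (rule nn_integral_mono)
        fix s
        show "ennreal ((\<sigma> (X s \<omega>) - \<sigma> (X ?a \<omega>))\<^sup>2) * indicator {?a..?b} s \<le> ennreal (4 * \<kappa>\<^sup>2) * indicator {?a..?b} s"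
        proof (cases "s \<in> {?a..?b}")
          case True
          then have "\<bar>\<sigma> (X s \<omega>) - \<sigma> (X 1 \<omega>)\<bar> < \<kappa>" "\<bar>\<sigma> (X ?a \<omega>) - \<sigma> (X 1 \<omega>)\<bar> < \<kappa>" using elim ab by auto
          then have "\<bar>\<sigma> (X s \<omega>) - \<sigma> (X ?a \<omega>)\<bar> \<le> 2 * \<kappa>" by linarith
          from power_mono[OF this, of 2] have "(\<sigma> (X s \<omega>) - \<sigma> (X ?a \<omega>))\<^sup>2 \<le> 4 * \<kappa>\<^sup>2"
            by (simp add: power_mult_distrib)
          then show ?thesis using True by (simp add: ennreal_leI)
        qed simp
      qed
      also have "\<dots> = ennreal (4 * \<kappa>\<^sup>2) * ennreal (2 * (\<epsilon> * m))"
        using ab by (simp add: nn_integral_cmult_indicator)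
      also have "\<dots> = ennreal (4 * \<kappa>\<^sup>2 * (2 * (\<epsilon> * m)))"
        using elim m by (intro ennreal_mult[symmetric]) auto
      also have "4 * \<kappa>\<^sup>2 * (2 * (\<epsilon> * m)) = \<gamma> * \<epsilon> / 4" using m by (simp add: \<kappa>(2))
      finally show ?case by (simp add: not_less)
    qed
  qed
qed

section \<open>Comparison of the zoomed diffusion with scaled Brownian windows\<close>

definition zoom_before :: "real \<Rightarrow> 'a \<Rightarrow> cpath" where
  "zoom_before \<epsilon> \<omega> = path_of (\<lambda>t. zoomed X \<epsilon> (- t) \<omega>)"

definition zoom_after :: "real \<Rightarrow> 'a \<Rightarrow> cpath" where
  "zoom_after \<epsilon> \<omega> = path_of (\<lambda>t. zoomed X \<epsilon> t \<omega>)"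

lemma zoomed_continuous:
  assumes "\<omega> \<in> space M"
  shows "continuous_on S (\<lambda>t. zoomed X \<epsilon> t \<omega>)"
proof -
  have "continuous_on S (\<lambda>t. X (max 0 (1 + \<epsilon> * t)) \<omega>)"
    by (rule continuous_on_compose2[OF X_cont[OF assms]]) (auto intro!: continuous_intros)
  then show ?thesis
    unfolding zoomed_def by (intro continuous_on_mult continuous_on_diff continuous_on_const)
qed

lemma zoomed_continuous_neg:
  assumes "\<omega> \<in> space M"
  shows "continuous_on S (\<lambda>t. zoomed X \<epsilon> (- t) \<omega>)"
  by (rule continuous_on_compose2[OF zoomed_continuous[OF assms, of UNIV]]) (auto intro!: continuous_intros)

lemma zoomed_measurable: "zoomed X \<epsilon> t \<in> borel_measurable M"
  unfolding zoomed_def[abs_def] using X_measurable[of "max 0 (1 + \<epsilon> * t)"] X_measurable[of 1] by simp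

lemma zoom_before_measurable: "zoom_before \<epsilon> \<in> borel_measurable M"
  unfolding zoom_before_def[abs_def] by (intro measurable_path_of zoomed_measurable zoomed_continuous_neg)

lemma zoom_after_measurable: "zoom_after \<epsilon> \<in> borel_measurable M"
  unfolding zoom_after_def[abs_def] by (intro measurable_path_of zoomed_measurable zoomed_continuous)

lemma at_time_zoom:
  assumes "\<omega> \<in> space M" "0 \<le> t"
  shows "at_time (zoom_before \<epsilon> \<omega>) t = zoomed X \<epsilon> (- t) \<omega>" "at_time (zoom_after \<epsilon> \<omega>) t = zoomed X \<epsilon> t \<omega>"
  using assms by (auto simp: zoom_before_def zoom_after_def at_time_path_of zoomed_continuous zoomed_continuous_neg)

lemma zoomed_eq:
  assumes "0 < \<epsilon>" "0 \<le> 1 + \<epsilon> * t"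
  shows "zoomed X \<epsilon> t \<omega> = (X (1 + \<epsilon> * t) \<omega> - X 1 \<omega>) / sqrt \<epsilon>"
proof -
  have "\<epsilon> powr (- 1 / 2) = 1 / sqrt \<epsilon>"
    using assms(1) by (simp add: powr_minus_divide powr_half_sqrt)
  then show ?thesis using assms by (simp add: zoomed_def max_absorb2)
qed

text \<open>Intermediate between the zoomed diffusion and the limit: rounding leaves finitely many
  coefficients, and stopping at m leaves windows to which mixing applies.\<close>

definition small_noise :: "nat \<Rightarrow> real \<Rightarrow> 'a \<Rightarrow> cpath \<times> cpath" where
  "small_noise m \<epsilon> \<omega> = (scale (quantize m (\<sigma> (X 1 \<omega>))) (path_before 1 \<epsilon> (real m) \<omega>),
     scale (quantize m (\<sigma> (X 1 \<omega>))) (path_after 1 \<epsilon> (real m) \<omega>))"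

lemma scale_measurable:
  assumes "c \<in> borel_measurable N" "Y \<in> borel_measurable N"
  shows "(\<lambda>\<omega>. scale (c \<omega>) (Y \<omega>)) \<in> borel_measurable N"
  using assms by (intro measurable_cpathI) (simp add: at_time_scale)

lemma small_noise_measurable:
  assumes "0 < \<epsilon>" "\<epsilon> * real m \<le> 1"
  shows "small_noise m \<epsilon> \<in> borel_measurable M"
  unfolding small_noise_def[abs_def]
  using \<sigma>X_measurable[of 1] assms
  by (intro borel_measurable_Pair scale_measurable path_before_measurable_M path_after_measurable_M
      measurable_compose[OF _ quantize_measurable]) auto

lemma small_noise_approx_pointwise:
  assumes m: "0 < m" and \<epsilon>: "0 < \<epsilon>" "\<epsilon> * real m < 1" and \<omega>: "\<omega> \<in> space M"
  defines "a \<equiv> 1 - \<epsilon> * real m" and "b \<equiv> 1 + \<epsilon> * real m"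
  assumes good: "\<And>s. s \<in> {a..b} \<Longrightarrow> \<bar>X s \<omega> - X a \<omega> - (J s \<omega> - J a \<omega>)\<bar> \<le> 1 / real m * sqrt \<epsilon>"
    "\<And>s. s \<in> {a..b} \<Longrightarrow> \<bar>J s \<omega> - J a \<omega> - \<sigma> (X a \<omega>) * (W s \<omega> - W a \<omega>)\<bar> \<le> 1 / real m * sqrt \<epsilon>"
    "\<And>s. s \<in> {a..b} \<Longrightarrow> \<bar>W s \<omega> - W a \<omega>\<bar> \<le> real m * sqrt \<epsilon>"
    "\<bar>\<sigma> (X a \<omega>) - \<sigma> (X 1 \<omega>)\<bar> \<le> 1 / (real m)\<^sup>2" "\<sigma> (X 1 \<omega>) \<le> real m"
  shows "dist (zoom_before \<epsilon> \<omega>, zoom_after \<epsilon> \<omega>) (small_noise m \<epsilon> \<omega>) \<le> 16 / real m"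
proof -
  let ?c = "quantize m (\<sigma> (X 1 \<omega>))"
  have ab: "1 \<in> {a..b}" using \<epsilon> m by (auto simp: a_def b_def)
  \<comment> \<open>One 1/m^2 comes from moving from a to time 1, the other from rounding.
    Multiplied by 2 m they give 4/m, and the four errors 1/m of the window estimate bring this to
    8/m.\<close>
  have "\<bar>\<sigma> (X a \<omega>) - ?c\<bar> \<le> 2 / (real m)\<^sup>2"
    using good(4) quantize_close[OF good(5) m] by simp
  then have "\<bar>\<sigma> (X a \<omega>) - ?c\<bar> * (2 * real m) \<le> 2 / (real m)\<^sup>2 * (2 * real m)" by (intro mult_right_mono) auto
  also have "\<dots> = 4 / real m" using m by (simp add: power2_eq_square)
  finally have hc: "4 * (1 / real m) + \<bar>\<sigma> (X a \<omega>) - ?c\<bar> * (2 * real m) \<le> 8 / real m" by simp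
  have est: "\<bar>(X u \<omega> - X 1 \<omega>) / sqrt \<epsilon> - ?c * ((W u \<omega> - W 1 \<omega>) / sqrt \<epsilon>)\<bar> \<le> 8 / real m" if "u \<in> {a..b}" for u
    by (rule order_trans[OF window_estimate[where I = "{a..b}" and x = "\<lambda>s. X s \<omega>" and j = "\<lambda>s. J s \<omega>"
          and w = "\<lambda>s. W s \<omega>" and a = a and h = "\<sigma> (X a \<omega>)" and \<eta> = "1 / real m" and K = "real m"] hc])
      (use \<epsilon>(1) that ab good(1-3) in auto)
  \<comment> \<open>The part of the metric after time m costs no more than the error on
    [0,m].\<close>
  have m1: "1 / (1 + real m) \<le> 8 / real m" using m by (simp add: field_simps)
  have t: "1 - \<epsilon> * t \<in> {a..b}" "1 + \<epsilon> * t \<in> {a..b}" "0 \<le> 1 + \<epsilon> * (- t)" "0 \<le> 1 + \<epsilon> * t" if "t \<in> {0..real m}" for t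
  proof -
    have "0 \<le> \<epsilon> * t" "\<epsilon> * t \<le> \<epsilon> * real m" using that \<epsilon> by (auto intro: mult_left_mono)
    then show "1 - \<epsilon> * t \<in> {a..b}" "1 + \<epsilon> * t \<in> {a..b}" "0 \<le> 1 + \<epsilon> * (- t)" "0 \<le> 1 + \<epsilon> * t"
      using \<epsilon> unfolding a_def b_def atLeastAtMost_iff by ((intro conjI)?; simp; linarith)+
  qed
  have "dist (zoom_before \<epsilon> \<omega>) (scale ?c (path_before 1 \<epsilon> (real m) \<omega>)) \<le> max (8 / real m) (1 / (1 + real m))"
  proof (rule dist_cpath_max)
    fix t assume "t \<in> {0..real m}"
    then show "\<bar>at_time (zoom_before \<epsilon> \<omega>) t - at_time (scale ?c (path_before 1 \<epsilon> (real m) \<omega>)) t\<bar> \<le> 8 / real m"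
      using est[OF t(1)] t(3) \<epsilon> \<omega> by (simp add: at_time_zoom at_time_scale at_time_path_before zoomed_eq)
  qed simp
  moreover have "dist (zoom_after \<epsilon> \<omega>) (scale ?c (path_after 1 \<epsilon> (real m) \<omega>)) \<le> max (8 / real m) (1 / (1 + real m))"
  proof (rule dist_cpath_max)
    fix t assume "t \<in> {0..real m}"
    then show "\<bar>at_time (zoom_after \<epsilon> \<omega>) t - at_time (scale ?c (path_after 1 \<epsilon> (real m) \<omega>)) t\<bar> \<le> 8 / real m"
      using est[OF t(2)] t(4) \<epsilon> \<omega> by (simp add: at_time_zoom at_time_scale at_time_path_after zoomed_eq)
  qed simp
  ultimately have "dist (zoom_before \<epsilon> \<omega>) (scale ?c (path_before 1 \<epsilon> (real m) \<omega>))
    + dist (zoom_after \<epsilon> \<omega>) (scale ?c (path_after 1 \<epsilon> (real m) \<omega>)) \<le> 16 / real m"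
    using m1 by simp
  then show ?thesis
    unfolding small_noise_def dist_Pair_Pair
    by (rule order_trans[OF sqrt_sum_squares_le_sum[OF zero_le_dist zero_le_dist]])
qed

text \<open>Of 34/m, 16/m is the error on the good event. The bad event has probability at most 9/m
  plus that of \<open>\<sigma> (X 1)\<close> exceeding m: 1/m for the drift, 4/m + 1/m for the Ito
  integral, 2/m for the Brownian bound, 1/m for the coefficient at the left end. It counts twice
  because pairs of paths have distance at most 2.\<close>

lemma small_noise_approx:
  assumes m: "0 < m"
  shows "eventually (\<lambda>\<epsilon>. expectation (\<lambda>\<omega>. dist (zoom_before \<epsilon> \<omega>, zoom_after \<epsilon> \<omega>) (small_noise m \<epsilon> \<omega>))
    \<le> 34 / real m + 2 * prob {\<omega>\<in>space M. real m < \<sigma> (X 1 \<omega>)}) (at_right 0)"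
proof -
  let ?a = "\<lambda>\<epsilon>. 1 - \<epsilon> * real m" and ?b = "\<lambda>\<epsilon>. 1 + \<epsilon> * real m"
  define A where "A = (\<lambda>\<epsilon>. {\<omega>\<in>space M. \<exists>s\<in>{?a \<epsilon>..?b \<epsilon>}. 1 / real m * sqrt \<epsilon> < \<bar>X s \<omega> - X (?a \<epsilon>) \<omega> - (J s \<omega> - J (?a \<epsilon>) \<omega>)\<bar>})"
  define A' where "A' = (\<lambda>\<epsilon>. {\<omega>\<in>space M. \<exists>s\<in>{?a \<epsilon>..?b \<epsilon>}. 2 * (1 / real m * sqrt \<epsilon> / 2)
    < \<bar>J s \<omega> - J (?a \<epsilon>) \<omega> - \<sigma> (X (?a \<epsilon>) \<omega>) * (W s \<omega> - W (?a \<epsilon>) \<omega>)\<bar>})"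
  define B' where "B' = (\<lambda>\<epsilon>. {\<omega>\<in>space M. \<exists>s\<in>{?a \<epsilon>..?b \<epsilon>}. real m * sqrt \<epsilon> < \<bar>W s \<omega> - W (?a \<epsilon>) \<omega>\<bar>})"
  define C' where "C' = (\<lambda>\<epsilon>. {\<omega>\<in>space M. 1 / (real m)\<^sup>2 < \<bar>\<sigma> (X (?a \<epsilon>) \<omega>) - \<sigma> (X 1 \<omega>)\<bar>})"
  define D' where "D' = {\<omega>\<in>space M. real m < \<sigma> (X 1 \<omega>)}"
  \<comment> \<open>Here C = \<epsilon>/m^3 and l = \<epsilon>^(1/2)/(2 m), so that C/l^2 =
    4/m.\<close>
  define Q where "Q = (\<lambda>\<epsilon>. {\<omega>\<in>space M. ennreal ((1 / real m ^ 3) * \<epsilon> / 4)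
    < (\<integral>\<^sup>+s\<in>{?a \<epsilon>..?b \<epsilon>}. ennreal ((\<sigma> (X s \<omega>) - \<sigma> (X (?a \<epsilon>) \<omega>))\<^sup>2) \<partial>lborel)})"
  have m': "0 < real m" using m by simp
  have "eventually (\<lambda>\<epsilon>. prob (A \<epsilon>) < 1 / real m) (at_right 0)"
    unfolding A_def by (rule order_tendstoD(2)[OF drift_vanishes]) (use m in auto)
  moreover have "eventually (\<lambda>\<epsilon>. prob (C' \<epsilon>) < 1 / real m) (at_right 0)"
    unfolding C'_def by (rule order_tendstoD(2)[OF coefficient_start_vanishes]) (use m in auto)
  moreover have "eventually (\<lambda>\<epsilon>. prob (Q \<epsilon>) < 1 / real m) (at_right 0)"
    unfolding Q_def by (rule order_tendstoD(2)[OF coefficient_oscillation_vanishes]) (use m in auto)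
  moreover have "eventually (\<lambda>\<epsilon>. 0 < \<epsilon> \<and> \<epsilon> < 1 / real m) (at_right 0)"
    using m by (intro eventually_at_rightI[of 0 "1 / real m"]) auto
  ultimately show ?thesis
  proof eventually_elim
    case (elim \<epsilon>)
    then have \<epsilon>: "0 < \<epsilon>" "\<epsilon> * real m < 1" using m by (auto simp: field_simps)
    have ab: "0 \<le> ?a \<epsilon>" "?a \<epsilon> < ?b \<epsilon>" using \<epsilon> m by auto
    have PA': "prob (A' \<epsilon>) \<le> 4 / real m + prob (Q \<epsilon>)"
    proof -
      have "prob (A' \<epsilon>) \<le> (1 / real m ^ 3 * \<epsilon>) / (1 / real m * sqrt \<epsilon> / 2)\<^sup>2 + prob (Q \<epsilon>)"
        unfolding A'_def Q_def by (rule ito_integral_window[OF ito ab]) (use \<epsilon> m in auto)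
      also have "(1 / real m ^ 3 * \<epsilon>) / (1 / real m * sqrt \<epsilon> / 2)\<^sup>2 = 4 / real m"
        using \<epsilon> m by (simp add: power_divide power2_eq_square power3_eq_cube field_simps)
      finally show ?thesis .
    qed
    have PB: "prob (B' \<epsilon>) \<le> 2 / real m"
    proof -
      have "prob (B' \<epsilon>) \<le> (?b \<epsilon> - ?a \<epsilon>) / (real m * sqrt \<epsilon>)\<^sup>2"
        unfolding B'_def by (rule B_maximal[OF ab]) (use \<epsilon> m in auto)
      also have "\<dots> = 2 / real m"
        using \<epsilon> m by (simp add: power_mult_distrib power2_eq_square field_simps)
      finally show ?thesis .
    qed
    have cont: "continuous_on {?a \<epsilon>..?b \<epsilon>} (\<lambda>t. X t \<omega>)" "continuous_on {?a \<epsilon>..?b \<epsilon>} (\<lambda>t. J t \<omega>)"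
      "continuous_on {?a \<epsilon>..?b \<epsilon>} (\<lambda>t. W t \<omega>)" if "\<omega> \<in> space M" for \<omega>
      using ab by (auto intro: continuous_on_subset[OF X_cont[OF that]] continuous_on_subset[OF J_cont[OF that]]
          continuous_on_subset[OF B_continuous[OF that]])
    note meas = X_measurable J_measurable B_measurable \<sigma>X_measurable
    have sets: "A \<epsilon> \<in> sets M" "A' \<epsilon> \<in> sets M" "B' \<epsilon> \<in> sets M" "C' \<epsilon> \<in> sets M" "D' \<in> sets M"
    proof -
      show "A \<epsilon> \<in> sets M" unfolding A_def
        using ab by (intro measurable_ex_Icc borel_measurable_abs borel_measurable_diff meas
            continuous_on_rabs continuous_on_diff continuous_on_const cont) auto
      show "A' \<epsilon> \<in> sets M" unfolding A'_def
        using ab by (intro measurable_ex_Icc borel_measurable_abs borel_measurable_diff borel_measurable_times meas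
            continuous_on_rabs continuous_on_diff continuous_on_mult continuous_on_const cont) auto
      show "B' \<epsilon> \<in> sets M" unfolding B'_def
        using ab by (intro measurable_ex_Icc borel_measurable_abs borel_measurable_diff meas
            continuous_on_rabs continuous_on_diff continuous_on_const cont) auto
      show "C' \<epsilon> \<in> sets M" unfolding C'_def
        using meas(4)[OF ab(1)] meas(4)[of 1] by simp
      show "D' \<in> sets M" unfolding D'_def using meas(4)[of 1] by simp
    qed
    let ?U = "A \<epsilon> \<union> A' \<epsilon> \<union> B' \<epsilon> \<union> C' \<epsilon> \<union> D'"
    have U: "?U \<in> sets M" by (intro sets.Un sets)
    have "prob ?U \<le> prob (A \<epsilon>) + prob (A' \<epsilon>) + prob (B' \<epsilon>) + prob (C' \<epsilon>) + prob D'"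
      by (intro order_trans[OF measure_Un_le] add_mono order_refl sets.Un sets)
    then have PU: "prob ?U \<le> 9 / real m + prob D'"
      using elim PA' PB by (simp add: field_simps)
    let ?d = "\<lambda>\<omega>. dist (zoom_before \<epsilon> \<omega>, zoom_after \<epsilon> \<omega>) (small_noise m \<epsilon> \<omega>)"
    have d2: "?d \<omega> \<le> 2" for \<omega>
    proof -
      have "dist (x1, y1) (x2, y2) \<le> 2" for x1 y1 x2 y2 :: cpath
        unfolding dist_Pair_Pair
        using sqrt_sum_squares_le_sum[of "dist x1 x2" "dist y1 y2"] dist_cpath_le_1[of x1 x2] dist_cpath_le_1[of y1 y2]
        by simp
      then show ?thesis by (cases "small_noise m \<epsilon> \<omega>") auto
    qed
    have [measurable]: "zoom_before \<epsilon> \<in> borel_measurable M" "zoom_after \<epsilon> \<in> borel_measurable M" "small_noise m \<epsilon> \<in> borel_measurable M"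
      using zoom_before_measurable zoom_after_measurable small_noise_measurable \<epsilon> by auto
    have dm: "?d \<in> borel_measurable M" by measurable
    have "expectation ?d \<le> expectation (\<lambda>\<omega>. 16 / real m + 2 * indicator ?U \<omega>)"
    proof (rule integral_mono)
      show "integrable M ?d" by (rule integrable_bounded_random_variable[OF dm, of 2]) (use d2 in auto)
      show "integrable M (\<lambda>\<omega>. 16 / real m + 2 * indicator ?U \<omega> :: real)"
        by (intro Bochner_Integration.integrable_add integrable_const integrable_mult_right integrable_real_indicator U)
          (simp add: emeasure_eq_measure)
      fix \<omega> assume \<omega>: "\<omega> \<in> space M"
      show "?d \<omega> \<le> 16 / real m + 2 * indicator ?U \<omega>"
      proof (cases "\<omega> \<in> ?U")
        case True
        then show ?thesis using d2[of \<omega>] m' by (simp add: add_increasing)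
      next
        case False
        have "?d \<omega> \<le> 16 / real m"
        proof (rule small_noise_approx_pointwise[OF m \<epsilon> \<omega>])
          show "\<sigma> (X 1 \<omega>) \<le> real m" using False \<omega> by (auto simp: D'_def not_less)
          show "\<bar>\<sigma> (X (?a \<epsilon>) \<omega>) - \<sigma> (X 1 \<omega>)\<bar> \<le> 1 / (real m)\<^sup>2" using False \<omega> by (auto simp: C'_def not_less)
          fix s assume s: "s \<in> {?a \<epsilon>..?b \<epsilon>}"
          show "\<bar>X s \<omega> - X (?a \<epsilon>) \<omega> - (J s \<omega> - J (?a \<epsilon>) \<omega>)\<bar> \<le> 1 / real m * sqrt \<epsilon>"
            using False \<omega> s unfolding A_def by (metis (mono_tags, lifting) UnI1 mem_Collect_eq not_less)
          show "\<bar>J s \<omega> - J (?a \<epsilon>) \<omega> - \<sigma> (X (?a \<epsilon>) \<omega>) * (W s \<omega> - W (?a \<epsilon>) \<omega>)\<bar> \<le> 1 / real m * sqrt \<epsilon>"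
          proof (rule ccontr)
            assume "\<not> ?thesis"
            then have "\<omega> \<in> A' \<epsilon>" using \<omega> s unfolding A'_def by (auto simp: not_le)
            then show False using False by blast
          qed
          show "\<bar>W s \<omega> - W (?a \<epsilon>) \<omega>\<bar> \<le> real m * sqrt \<epsilon>"
          proof (rule ccontr)
            assume "\<not> ?thesis"
            then have "\<omega> \<in> B' \<epsilon>" using \<omega> s unfolding B'_def by (auto simp: not_le)
            then show False using False by blast
          qed
        qed
        then show ?thesis using False by simp
      qed
    qed
    also have "\<dots> = 16 / real m + 2 * prob ?U"
      using U integrable_real_indicator[OF U] by (simp add: prob_space emeasure_eq_measure)
    also have "\<dots> \<le> 34 / real m + 2 * prob D'" using PU by simp
    finally show ?case by (simp add: D'_def)
  qed
qed

end

section \<open>Stable convergence\<close>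

text \<open>The Lipschitz constant is the maximum of 1 and the modulus of c, because the cutoff
  1/(1+t) in the metric does not shrink with c.\<close>

lemma continuous_on_scale: "continuous_on UNIV (scale c)"
proof -
  let ?C = "max 1 \<bar>c\<bar>"
  have le: "dist (scale c x) (scale c y) \<le> ?C * dist x y" for x y
  proof (rule dist_cpath_leI)
    fix t :: real assume t: "0 \<le> t"
    have "\<bar>c * at_time x t - c * at_time y t\<bar> = \<bar>c\<bar> * \<bar>at_time x t - at_time y t\<bar>"
      by (simp add: abs_mult[symmetric] right_diff_distrib)
    also have "\<dots> \<le> ?C * \<bar>at_time x t - at_time y t\<bar>" by (intro mult_right_mono) auto
    finally have *: "\<bar>c * at_time x t - c * at_time y t\<bar> \<le> ?C * \<bar>at_time x t - at_time y t\<bar>" .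
    consider "\<bar>at_time x t - at_time y t\<bar> \<le> dist x y" | "1 / (1 + t) \<le> dist x y"
      using dist_cpath_ge[OF t, of x y] by (auto simp: min_le_iff_disj)
    then show "min \<bar>at_time (scale c x) t - at_time (scale c y) t\<bar> (1 / (1 + t)) \<le> ?C * dist x y"
    proof cases
      case 1
      then have "?C * \<bar>at_time x t - at_time y t\<bar> \<le> ?C * dist x y" by (intro mult_left_mono) auto
      then show ?thesis using * unfolding at_time_scale by (intro min.coboundedI1) linarith
    next
      case 2
      have "1 * dist x y \<le> ?C * dist x y" by (intro mult_right_mono) auto
      then show ?thesis using 2 by (intro min.coboundedI2) linarith
    qed
  qed
  have "lipschitz_on ?C UNIV (scale c)" by (rule lipschitz_onI) (use le in auto)
  then show ?thesis by (rule lipschitz_on_continuous_on)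
qed

text \<open>For 0 \<le> s \<le> m the integer part of s m^2 lies between 0 and m^3.\<close>

lemma quantize_mem:
  assumes "0 < m" "0 \<le> s"
  shows "quantize m s \<in> (\<lambda>k. real k / (real m)\<^sup>2) ` {..m ^ 3}"
proof (cases "s \<le> real m")
  case True
  define k where "k = nat \<lfloor>s * (real m)\<^sup>2\<rfloor>"
  have "s * (real m)\<^sup>2 \<le> real m * (real m)\<^sup>2" using True by (intro mult_right_mono) auto
  then have "real_of_int \<lfloor>s * (real m)\<^sup>2\<rfloor> \<le> real m * (real m)\<^sup>2" using of_int_floor_le order_trans by blast
  moreover have k: "real k = real_of_int \<lfloor>s * (real m)\<^sup>2\<rfloor>" using assms by (simp add: k_def)
  ultimately have "real k \<le> real (m ^ 3)" by (simp add: power3_eq_cube power2_eq_square)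
  then have "k \<le> m ^ 3" by (simp only: of_nat_le_iff)
  moreover have "quantize m s = real k / (real m)\<^sup>2" using True k by (simp add: quantize_def)
  ultimately show ?thesis by blast
next
  case False
  then show ?thesis by (intro image_eqI[of _ _ 0]) (auto simp: quantize_def)
qed

lemma quantize_tendsto: "(\<lambda>m. quantize m s) \<longlonglongrightarrow> s"
proof -
  have "(\<lambda>m. s - quantize m s) \<longlonglongrightarrow> 0"
  proof (rule Lim_null_comparison)
    obtain n :: nat where n: "s \<le> real n" using real_arch_simple by blast
    show "eventually (\<lambda>m. norm (s - quantize m s) \<le> 1 / real m) sequentially"
      using eventually_ge_at_top[of "max n 1"]
    proof eventually_elim
      case (elim m)
      then have "\<bar>s - quantize m s\<bar> \<le> 1 / (real m)\<^sup>2" using n by (intro quantize_close) auto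
      also have "\<dots> \<le> 1 / real m" using elim by (intro divide_left_mono) (auto simp: power2_eq_square)
      finally show ?case by simp
    qed
    show "(\<lambda>m. 1 / real m) \<longlonglongrightarrow> 0" by (rule lim_1_over_n)
  qed
  from tendsto_diff[OF tendsto_const[of s] this] show ?thesis by simp
qed

section \<open>Reduction to Lipschitz test functions\<close>

text \<open>Infimal convolution of f with k times the metric (Pasch-Hausdorff envelope): for bounded
  f the largest k-Lipschitz function below f.\<close>

definition lipschitz_minorant :: "('b :: metric_space \<Rightarrow> real) \<Rightarrow> nat \<Rightarrow> 'b \<Rightarrow> real" where
  "lipschitz_minorant f k x = (INF y. f y + real k * dist x y)"

lemma lipschitz_minorant:
  fixes f :: "'b :: metric_space \<Rightarrow> real"
  assumes K: "\<And>x. \<bar>f x\<bar> \<le> K"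
  shows lipschitz_minorant_le: "lipschitz_minorant f k x \<le> f x"
    and lipschitz_minorant_abs_le: "\<bar>lipschitz_minorant f k x\<bar> \<le> K"
    and lipschitz_minorant_lipschitz: "\<bar>lipschitz_minorant f k x - lipschitz_minorant f k y\<bar> \<le> real k * dist x y"
    and lipschitz_minorant_tendsto: "continuous_on UNIV f \<Longrightarrow> (\<lambda>k. lipschitz_minorant f k x) \<longlonglongrightarrow> f x"
proof -
  have f_ge: "- K \<le> f y + real k * dist x y" for k x y
  proof -
    have "- K \<le> f y" using K[of y] by linarith
    moreover have "0 \<le> real k * dist x y" by simp
    ultimately show ?thesis by linarith
  qed
  have bdd: "bdd_below (range (\<lambda>y. f y + real k * dist x y))" for k x
    by (rule bdd_belowI2[OF f_ge])
  have lower: "lipschitz_minorant f k x \<le> f y + real k * dist x y" for k x y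
    unfolding lipschitz_minorant_def by (rule cINF_lower[OF bdd]) simp
  have greatest: "c \<le> lipschitz_minorant f k x" if "\<And>y. c \<le> f y + real k * dist x y" for c k x
    unfolding lipschitz_minorant_def by (rule cINF_greatest) (use that in auto)
  show le: "lipschitz_minorant f k x \<le> f x" for k x using lower[of k x x] by simp
  have "- K \<le> lipschitz_minorant f k x" by (rule greatest[OF f_ge])
  then show "\<bar>lipschitz_minorant f k x\<bar> \<le> K" using le[of k x] K[of x] by simp
  have lip: "lipschitz_minorant f k x - real k * dist x y \<le> lipschitz_minorant f k y" for k x y
  proof (rule greatest)
    fix z
    have "real k * dist x z \<le> real k * (dist x y + dist y z)" by (intro mult_left_mono dist_triangle) auto
    then show "lipschitz_minorant f k x - real k * dist x y \<le> f z + real k * dist y z"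
      using lower[of k x z] by (simp add: distrib_left)
  qed
  show "\<bar>lipschitz_minorant f k x - lipschitz_minorant f k y\<bar> \<le> real k * dist x y"
    using lip[of k x y] lip[of k y x] by (simp add: dist_commute abs_le_iff)
  assume cont: "continuous_on UNIV f"
  show "(\<lambda>k. lipschitz_minorant f k x) \<longlonglongrightarrow> f x"
  proof (rule LIMSEQ_I)
    fix r :: real assume r: "0 < r"
    obtain d where d: "0 < d" "\<And>y. dist y x < d \<Longrightarrow> dist (f y) (f x) < r / 2"
      using cont[unfolded continuous_on_iff, rule_format, of x "r / 2"] r by auto
    obtain n :: nat where n: "2 * K / d \<le> real n" using real_arch_simple by blast
    have "norm (lipschitz_minorant f k x - f x) < r" if "n \<le> k" for k
    proof -
      have "f x - r / 2 \<le> lipschitz_minorant f k x"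
      proof (rule greatest)
        fix y
        show "f x - r / 2 \<le> f y + real k * dist x y"
        proof (cases "dist y x < d")
          case True
          have "0 \<le> real k * dist x y" by simp
          moreover have "\<bar>f y - f x\<bar> < r / 2" using d(2)[OF True] by (simp only: dist_real_def)
          ultimately show ?thesis by linarith
        next
          case False
          \<comment> \<open>Away from x the penalty is at least 2 K, the largest possible drop of
            f.\<close>
          have "2 * K \<le> real n * d" using n d(1) by (simp add: pos_divide_le_eq)
          also have "\<dots> \<le> real k * dist x y"
            using False that d(1) by (intro mult_mono) (auto simp: dist_commute)
          finally show ?thesis using K[of x] K[of y] r by linarith
        qed
      qed
      then show ?thesis using le[of k x] r by (simp add: abs_less_iff)
    qed
    then show "\<exists>n. \<forall>k\<ge>n. norm (lipschitz_minorant f k x - f x) < r" by blast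
  qed
qed

text \<open>Lipschitz minorants converge to f from below, so for nonnegative V the Lipschitz case
  bounds the limit inferior from below; the same for -f gives the upper bound. Monotonicity requires
  V \<ge> 0, hence a signed V is written as V + K' minus the constant K'.\<close>

lemma stable_portmanteau:
  fixes Z :: "real \<Rightarrow> 'a \<Rightarrow> 'c :: metric_space" and Z0 :: "'a \<times> 'b \<Rightarrow> 'c"
  assumes prob: "prob_space M" "prob_space P" and fst_meas: "fst \<in> measurable P M"
    and Z: "\<And>\<epsilon>. Z \<epsilon> \<in> borel_measurable M" and Z0: "Z0 \<in> borel_measurable P"
    and lip: "\<And>g V L K K'. (\<And>x y. \<bar>g x - g y\<bar> \<le> L * dist x y) \<Longrightarrow> (\<And>x. \<bar>g x\<bar> \<le> K) \<Longrightarrow>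
      V \<in> borel_measurable M \<Longrightarrow> (\<And>\<omega>. \<omega> \<in> space M \<Longrightarrow> \<bar>V \<omega>\<bar> \<le> K') \<Longrightarrow>
      ((\<lambda>\<epsilon>. \<integral>\<omega>. g (Z \<epsilon> \<omega>) * V \<omega> \<partial>M) \<longlongrightarrow> (\<integral>p. g (Z0 p) * V (fst p) \<partial>P)) (at_right 0)"
    and f: "continuous_on UNIV f" "\<And>x. \<bar>f x\<bar> \<le> (K :: real)"
    and V: "V \<in> borel_measurable M" "\<And>\<omega>. \<omega> \<in> space M \<Longrightarrow> \<bar>V \<omega>\<bar> \<le> (K' :: real)"
  shows "((\<lambda>\<epsilon>. \<integral>\<omega>. f (Z \<epsilon> \<omega>) * V \<omega> \<partial>M) \<longlongrightarrow> (\<integral>p. f (Z0 p) * V (fst p) \<partial>P)) (at_right 0)"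
proof -
  interpret M: prob_space M by fact
  interpret P: prob_space P by fact
  have K0: "0 \<le> K" using f(2)[of undefined] by linarith
  have fstM: "fst p \<in> space M" if "p \<in> space P" for p using measurable_space[OF fst_meas that] .
  have meas: "(\<lambda>\<omega>. g (Z \<epsilon> \<omega>) * U \<omega>) \<in> borel_measurable M" "(\<lambda>p. g (Z0 p) * U (fst p)) \<in> borel_measurable P"
    if "continuous_on UNIV g" "U \<in> borel_measurable M" for g :: "'c \<Rightarrow> real" and U :: "'a \<Rightarrow> real" and \<epsilon>
    using measurable_compose[OF Z borel_measurable_continuous_onI[OF that(1)]]
      measurable_compose[OF Z0 borel_measurable_continuous_onI[OF that(1)]]
      measurable_compose[OF fst_meas that(2)] that(2) by auto
  have bound: "\<bar>g x * u\<bar> \<le> K * C" if "\<bar>g x\<bar> \<le> K" "\<bar>u\<bar> \<le> C" for g :: "'c \<Rightarrow> real" and x u C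
    unfolding abs_mult using that K0 by (intro mult_mono) auto
  have int: "integrable M (\<lambda>\<omega>. g (Z \<epsilon> \<omega>) * U \<omega>)" "integrable P (\<lambda>p. g (Z0 p) * U (fst p))"
    if "continuous_on UNIV g" "\<And>x. \<bar>g x\<bar> \<le> K" "U \<in> borel_measurable M" "\<And>\<omega>. \<omega> \<in> space M \<Longrightarrow> \<bar>U \<omega>\<bar> \<le> C"
    for g :: "'c \<Rightarrow> real" and U :: "'a \<Rightarrow> real" and \<epsilon> C
    using meas[OF that(1,3)] that(2,4) fstM bound
    by (auto intro!: M.integrable_bounded_random_variable[of _ "K * C"] P.integrable_bounded_random_variable[of _ "K * C"])
  have lower: "eventually (\<lambda>\<epsilon>. (\<integral>p. g (Z0 p) * U (fst p) \<partial>P) - r < (\<integral>\<omega>. g (Z \<epsilon> \<omega>) * U \<omega> \<partial>M)) (at_right 0)"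
    if g: "continuous_on UNIV g" "\<And>x. \<bar>g x\<bar> \<le> K" and U: "U \<in> borel_measurable M" "\<And>\<omega>. \<omega> \<in> space M \<Longrightarrow> \<bar>U \<omega>\<bar> \<le> C"
      "\<And>\<omega>. \<omega> \<in> space M \<Longrightarrow> 0 \<le> U \<omega>" and r: "0 < r" for g :: "'c \<Rightarrow> real" and U :: "'a \<Rightarrow> real" and C r
  proof -
    let ?g = "lipschitz_minorant g"
    note minor = lipschitz_minorant[of g K, OF g(2)]
    have gc: "continuous_on UNIV (?g k)" for k
    proof -
      have "lipschitz_on (real k) UNIV (?g k)"
        by (rule lipschitz_onI) (use minor(3) in \<open>auto simp: dist_real_def\<close>)
      then show ?thesis by (rule lipschitz_on_continuous_on)
    qed
    have "(\<lambda>k. \<integral>p. ?g k (Z0 p) * U (fst p) \<partial>P) \<longlonglongrightarrow> (\<integral>p. g (Z0 p) * U (fst p) \<partial>P)"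
    proof (rule integral_dominated_convergence[where w = "\<lambda>_. K * C"])
      show "AE p in P. (\<lambda>k. ?g k (Z0 p) * U (fst p)) \<longlonglongrightarrow> g (Z0 p) * U (fst p)"
        by (intro AE_I2 tendsto_mult minor(4) g(1) tendsto_const)
      show "AE p in P. norm (?g k (Z0 p) * U (fst p)) \<le> K * C" for k
        unfolding real_norm_def by (intro AE_I2 bound minor(2) U(2) fstM)
    qed (use meas gc g U in auto)
    from order_tendstoD(1)[OF this, of "(\<integral>p. g (Z0 p) * U (fst p) \<partial>P) - r / 2"] r
    obtain k where k: "(\<integral>p. g (Z0 p) * U (fst p) \<partial>P) - r / 2 < (\<integral>p. ?g k (Z0 p) * U (fst p) \<partial>P)"
      by (auto simp: eventually_sequentially)
    have "((\<lambda>\<epsilon>. \<integral>\<omega>. ?g k (Z \<epsilon> \<omega>) * U \<omega> \<partial>M) \<longlongrightarrow> (\<integral>p. ?g k (Z0 p) * U (fst p) \<partial>P)) (at_right 0)"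
      by (rule lip[OF minor(3) minor(2) U(1,2)])
    from order_tendstoD(1)[OF this, of "(\<integral>p. ?g k (Z0 p) * U (fst p) \<partial>P) - r / 2"] r
    have "eventually (\<lambda>\<epsilon>. (\<integral>p. ?g k (Z0 p) * U (fst p) \<partial>P) - r / 2 < (\<integral>\<omega>. ?g k (Z \<epsilon> \<omega>) * U \<omega> \<partial>M)) (at_right 0)"
      by simp
    then show ?thesis
    proof eventually_elim
      case (elim \<epsilon>)
      have "(\<integral>\<omega>. ?g k (Z \<epsilon> \<omega>) * U \<omega> \<partial>M) \<le> (\<integral>\<omega>. g (Z \<epsilon> \<omega>) * U \<omega> \<partial>M)"
        by (intro integral_mono int[OF gc minor(2) U(1,2)] int[OF g U(1,2)] mult_right_mono minor(1) U(3))
      then show ?case using elim k by linarith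
    qed
  qed
  have pos: "((\<lambda>\<epsilon>. \<integral>\<omega>. f (Z \<epsilon> \<omega>) * U \<omega> \<partial>M) \<longlongrightarrow> (\<integral>p. f (Z0 p) * U (fst p) \<partial>P)) (at_right 0)"
    if U: "U \<in> borel_measurable M" "\<And>\<omega>. \<omega> \<in> space M \<Longrightarrow> \<bar>U \<omega>\<bar> \<le> C" "\<And>\<omega>. \<omega> \<in> space M \<Longrightarrow> 0 \<le> U \<omega>"
    for U :: "'a \<Rightarrow> real" and C
  proof (rule tendstoI)
    fix r :: real assume r: "0 < r"
    have nf: "continuous_on UNIV (\<lambda>x. - f x)" "\<And>x. \<bar>- f x\<bar> \<le> K" using f by (auto intro: continuous_on_minus)
    have "eventually (\<lambda>\<epsilon>. (\<integral>p. f (Z0 p) * U (fst p) \<partial>P) - r < (\<integral>\<omega>. f (Z \<epsilon> \<omega>) * U \<omega> \<partial>M)) (at_right 0)"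
      by (rule lower[OF f U r])
    moreover have "eventually (\<lambda>\<epsilon>. (\<integral>p. - f (Z0 p) * U (fst p) \<partial>P) - r < (\<integral>\<omega>. - f (Z \<epsilon> \<omega>) * U \<omega> \<partial>M)) (at_right 0)"
      by (rule lower[OF nf U r])
    ultimately show "eventually (\<lambda>\<epsilon>. dist (\<integral>\<omega>. f (Z \<epsilon> \<omega>) * U \<omega> \<partial>M) (\<integral>p. f (Z0 p) * U (fst p) \<partial>P) < r) (at_right 0)"
    proof eventually_elim
      case (elim \<epsilon>)
      then show ?case by (simp add: dist_real_def abs_less_iff)
    qed
  qed
  have U1: "\<bar>V \<omega> + K'\<bar> \<le> 2 * K'" "0 \<le> V \<omega> + K'" "0 \<le> K'" "\<bar>K'\<bar> \<le> K'" if "\<omega> \<in> space M" for \<omega>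
    using V(2)[OF that] by auto
  have "((\<lambda>\<epsilon>. (\<integral>\<omega>. f (Z \<epsilon> \<omega>) * (V \<omega> + K') \<partial>M) - (\<integral>\<omega>. f (Z \<epsilon> \<omega>) * K' \<partial>M))
    \<longlongrightarrow> (\<integral>p. f (Z0 p) * (V (fst p) + K') \<partial>P) - (\<integral>p. f (Z0 p) * K' \<partial>P)) (at_right 0)"
    using pos[of "\<lambda>\<omega>. V \<omega> + K'" "2 * K'"] pos[of "\<lambda>_. K'" K'] U1 V(1) by (intro tendsto_diff) auto
  moreover have "(\<integral>\<omega>. f (Z \<epsilon> \<omega>) * (V \<omega> + K') \<partial>M) - (\<integral>\<omega>. f (Z \<epsilon> \<omega>) * K' \<partial>M) = (\<integral>\<omega>. f (Z \<epsilon> \<omega>) * V \<omega> \<partial>M)" for \<epsilon>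
    using int(1)[OF f V] int(1)[OF f, of "\<lambda>_. K'" K'] U1(4) by (simp add: distrib_left)
  moreover have "(\<integral>p. f (Z0 p) * (V (fst p) + K') \<partial>P) - (\<integral>p. f (Z0 p) * K' \<partial>P) = (\<integral>p. f (Z0 p) * V (fst p) \<partial>P)"
    using int(2)[OF f V] int(2)[OF f, of "\<lambda>_. K'" K'] U1(4) by (simp add: distrib_left)
  ultimately show ?thesis by simp
qed

subsection \<open>Continuous paths in the Skorokhod space\<close>

text \<open>A deterministic path regarded as a process over a one-point sample space, so that the
  facts on \<open>sample_path\<close> apply.\<close>

definition to_cadlag :: "cpath \<Rightarrow> cadlag" where
  "to_cadlag x = sample_path (\<lambda>t _. at_time x t) ()"

lemma Rep_to_cadlag: "0 \<le> t \<Longrightarrow> Rep_cadlag (to_cadlag x) t = at_time x t"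
  unfolding to_cadlag_def by (rule Rep_sample_path[OF continuous_on_at_time])

lemma sample_path_eq_to_cadlag:
  assumes "continuous_on {0..} (\<lambda>t. Y t \<omega>)"
  shows "sample_path Y \<omega> = to_cadlag (path_of (\<lambda>t. Y t \<omega>))"
  unfolding to_cadlag_def sample_path_def by (simp add: at_time_path_of[OF assms] max_def cong: if_cong)

text \<open>Uniform closeness on [0,T] puts a path into a Skorokhod neighbourhood with the identity
  as time change. Continuous test functions on the Skorokhod space therefore pull back to continuous
  functions of paths.\<close>

lemma continuous_on_to_cadlag: "continuous_on UNIV to_cadlag"
  unfolding continuous_on_open_vimage[OF open_UNIV]
proof (intro allI impI)
  fix S :: "cadlag set" assume S: "open S"
  have "open (to_cadlag -` S)"
    unfolding open_dist
  proof
    fix x assume "x \<in> to_cadlag -` S"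
    then obtain T e where T: "0 < T" "0 < e" "skorokhod_nhd (to_cadlag x) T e \<subseteq> S"
      using S unfolding open_cadlag_def by auto
    show "\<exists>d>0. \<forall>y. dist y x < d \<longrightarrow> y \<in> to_cadlag -` S"
    proof (intro exI[of _ "min e (1 / (1 + T))"] conjI allI impI)
      show "0 < min e (1 / (1 + T))" using T by simp
      fix y assume y: "dist y x < min e (1 / (1 + T))"
      have "\<bar>at_time y s - at_time x s\<bar> < e" if "s \<in> {0..T}" for s
        using abs_at_time_diff_le_dist[of s T y x] that y by auto
      then have "to_cadlag y \<in> skorokhod_nhd (to_cadlag x) T e"
        unfolding skorokhod_nhd_def time_change_def using T
        by (auto simp: Rep_to_cadlag strict_mono_on_def intro!: exI[of _ "\<lambda>s. s"])
      then show "y \<in> to_cadlag -` S" using T by auto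
    qed
  qed
  then show "open (to_cadlag -` S \<inter> UNIV)" by simp
qed

lemma continuous_on_to_cadlag_pair: "continuous_on UNIV (\<lambda>(x, y). (to_cadlag x, to_cadlag y))"
  unfolding case_prod_beta
  by (intro continuous_on_Pair continuous_on_compose2[OF continuous_on_to_cadlag] continuous_on_fst continuous_on_snd continuous_on_id) auto

subsection \<open>The limit on the extension\<close>

lemma sets_generated_by:
  "sets (generated_by \<Omega> Y I) = sigma_sets \<Omega> (\<Union>t\<in>I. {Y t -` A \<inter> \<Omega> |A. A \<in> sets borel})"
  and space_generated_by [simp]: "space (generated_by \<Omega> Y I) = \<Omega>"
  unfolding generated_by_def by (auto intro!: sets_measure_of space_measure_of)

lemma generated_by_mono: "I \<subseteq> I' \<Longrightarrow> sets (generated_by \<Omega> Y I) \<subseteq> sets (generated_by \<Omega> Y I')"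
  unfolding sets_generated_by by (intro sigma_sets_mono' UN_mono) auto

lemma standard_brownian_motion_filtered:
  assumes "prob_space P" "standard_brownian_motion P U" "sets (generated_by (space P) U {0..}) \<subseteq> sets P"
  shows "filtered_brownian_motion P (\<lambda>t. generated_by (space P) U {0..t}) U"
proof -
  interpret prob_space P by fact
  show ?thesis
  proof
    show "subalgebra P (generated_by (space P) U {0..t})" for t
      using generated_by_mono[of "{0..t}" "{0..}" "space P" U] assms(3) by (auto simp: subalgebra_def)
    show "sets (generated_by (space P) U {0..s}) \<subseteq> sets (generated_by (space P) U {0..t})" if "s \<le> t" for s t
      by (rule generated_by_mono) (use that in auto)
    show "brownian_motion_wrt P (\<lambda>t. generated_by (space P) U {0..t}) U"
      using assms(2) by (simp add: standard_brownian_motion_def)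
  qed
qed

locale diffusion_extension = diffusion M F W X J \<mu> \<sigma> x0
  for M :: "'a measure" and F :: "real \<Rightarrow> 'a measure" and W X J :: "real \<Rightarrow> 'a \<Rightarrow> real"
    and \<mu> \<sigma> :: "real \<Rightarrow> real" and x0 :: real +
  fixes N :: "'b measure" and P :: "('a \<times> 'b) measure" and U1 U2 :: "real \<Rightarrow> 'a \<times> 'b \<Rightarrow> real"
  assumes extension: "is_extension M N P"
    and bm1: "standard_brownian_motion P U1" and bm2: "standard_brownian_motion P U2"
    and indep: "prob_space.indep_sets P
           ((!) [sets (generated_by (space P) U1 {0..}),
                 sets (generated_by (space P) U2 {0..}),
                 {A \<times> space N | A. A \<in> sets M}]) {0, 1, 2}"
begin

lemma prob_space_P: "prob_space P"
  using extension by (simp add: is_extension_def)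

sublocale P: prob_space P by (rule prob_space_P)

lemma space_P: "space P = space M \<times> space N"
  using extension sets_eq_imp_space_eq[of P "M \<Otimes>\<^sub>M N"] by (simp add: is_extension_def space_pair_measure)

lemma fst_measurable: "fst \<in> measurable P M"
  using extension measurable_cong_sets[of P "M \<Otimes>\<^sub>M N" M M] by (auto simp: is_extension_def)

lemma fst_vimage: "A \<in> sets M \<Longrightarrow> fst -` A \<inter> space P = A \<times> space N"
  using sets.sets_into_space[of A M] by (auto simp: space_P)

text \<open>The extension condition says precisely that the first marginal is M.\<close>

lemma distr_fst: "distr P M fst = M"
proof (rule measure_eqI)
  fix A assume "A \<in> sets (distr P M fst)"
  then show "emeasure (distr P M fst) A = emeasure M A"
    using extension by (simp add: emeasure_distr[OF fst_measurable] fst_vimage is_extension_def)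
qed simp

lemma expectation_fst:
  assumes "V \<in> borel_measurable M"
  shows "P.expectation (\<lambda>p. V (fst p)) = (expectation V :: real)"
  using integral_distr[OF fst_measurable assms] by (simp add: distr_fst)

lemma generated_subset:
  "sets (generated_by (space P) U1 {0..}) \<subseteq> sets P" "sets (generated_by (space P) U2 {0..}) \<subseteq> sets P"
  using indep unfolding P.indep_sets_def by auto

sublocale U1: filtered_brownian_motion P "\<lambda>t. generated_by (space P) U1 {0..t}" U1
  by (rule standard_brownian_motion_filtered[OF prob_space_P bm1 generated_subset(1)])

sublocale U2: filtered_brownian_motion P "\<lambda>t. generated_by (space P) U2 {0..t}" U2
  by (rule standard_brownian_motion_filtered[OF prob_space_P bm2 generated_subset(2)])

lemma indep_prob:
  assumes "A \<in> sets (generated_by (space P) U1 {0..})" "B \<in> sets (generated_by (space P) U2 {0..})" "C \<in> sets M"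
  shows "P.prob (A \<inter> B) = P.prob A * P.prob B"
    and "P.prob (A \<inter> B \<inter> (C \<times> space N)) = P.prob A * P.prob B * P.prob (C \<times> space N)"
proof -
  let ?A = "(!) [A, B, C \<times> space N]"
  have "P.prob (\<Inter>j\<in>{0, 1}. ?A j) = (\<Prod>j\<in>{0, 1 :: nat}. P.prob (?A j))"
    by (rule P.indep_setsD[OF indep]) (use assms in auto)
  then show "P.prob (A \<inter> B) = P.prob A * P.prob B" by simp
  have "P.prob (\<Inter>j\<in>{0, 1, 2}. ?A j) = (\<Prod>j\<in>{0, 1, 2 :: nat}. P.prob (?A j))"
    by (rule P.indep_setsD[OF indep]) (use assms in auto)
  then show "P.prob (A \<inter> B \<inter> (C \<times> space N)) = P.prob A * P.prob B * P.prob (C \<times> space N)"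
    by (simp add: Int_assoc mult.assoc)
qed

definition noise :: "nat \<Rightarrow> 'a \<times> 'b \<Rightarrow> cpath \<times> cpath" where
  "noise m p = (U1.path_after 0 1 (real m) p, U2.path_after 0 1 (real m) p)"

lemma path_after_generated:
  "U1.path_after 0 1 (real m) \<in> borel_measurable (generated_by (space P) U1 {0..})"
  "U2.path_after 0 1 (real m) \<in> borel_measurable (generated_by (space P) U2 {0..})"
proof -
  have "subalgebra (generated_by (space P) U {0..}) (generated_by (space P) U {0..real m})" for U
    using generated_by_mono[of "{0..real m}" "{0..}" "space P" U] by (auto simp: subalgebra_def)
  from measurable_from_subalg[OF this U1.path_after_measurable[of 0 1 "real m" "real m"]]
    measurable_from_subalg[OF this U2.path_after_measurable[of 0 1 "real m" "real m"]]
  show "U1.path_after 0 1 (real m) \<in> borel_measurable (generated_by (space P) U1 {0..})"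
    "U2.path_after 0 1 (real m) \<in> borel_measurable (generated_by (space P) U2 {0..})" by auto
qed

lemma noise_measurable [measurable]: "noise m \<in> borel_measurable P"
  unfolding noise_def[abs_def]
  by (intro borel_measurable_Pair U1.path_after_measurable_M U2.path_after_measurable_M) auto

text \<open>The backward window has the law of a forward one by time reversal, and the two windows
  are independent like past and future of time 1, as U1 and U2 are.\<close>

lemma noise_distr:
  assumes "0 < \<epsilon>" "\<epsilon> * real m \<le> 1"
  shows "distr P borel (noise m) = distr M borel (\<lambda>\<omega>. (path_before 1 \<epsilon> (real m) \<omega>, path_after 1 \<epsilon> (real m) \<omega>))"
proof -
  have "P.indep_var borel (U1.path_after 0 1 (real m)) borel (U2.path_after 0 1 (real m))"
    by (rule P.indep_var_subalgebra[OF _ _ _ path_after_generated])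
      (use generated_subset indep_prob(1)[OF _ _ sets.empty_sets] in \<open>auto simp: subalgebra_def\<close>)
  then have "distr P borel (noise m) = distr P borel (U1.path_after 0 1 (real m)) \<Otimes>\<^sub>M distr P borel (U2.path_after 0 1 (real m))"
    by (simp add: P.indep_var_distribution_eq borel_prod noise_def[abs_def])
  also have "distr P borel (U1.path_after 0 1 (real m)) = distr M borel (path_before 1 \<epsilon> (real m))"
    by (rule path_before_distr_eq[symmetric, OF filtered_brownian_motion_axioms U1.filtered_brownian_motion_axioms])
      (use assms in auto)
  also have "distr P borel (U2.path_after 0 1 (real m)) = distr M borel (path_after 1 \<epsilon> (real m))"
    by (rule path_after_distr_eq[OF U2.filtered_brownian_motion_axioms filtered_brownian_motion_axioms])
      (use assms in auto)
  also have "distr M borel (path_before 1 \<epsilon> (real m)) \<Otimes>\<^sub>M distr M borel (path_after 1 \<epsilon> (real m))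
    = distr M borel (\<lambda>\<omega>. (path_before 1 \<epsilon> (real m) \<omega>, path_after 1 \<epsilon> (real m) \<omega>))"
    by (rule two_sided_distr[symmetric]) (use assms in auto)
  finally show ?thesis .
qed

text \<open>Independence is given for three families, while the noise depends on two of them
  jointly. Intersections of an event of U1 with an event of U2 form an intersection-stable family,
  from which the factorisation extends.\<close>

lemma noise_indep_M:
  fixes h :: "cpath \<times> cpath \<Rightarrow> real"
  assumes h: "h \<in> borel_measurable borel" "\<And>z. \<bar>h z\<bar> \<le> K"
    and V: "V \<in> borel_measurable M" "\<And>\<omega>. \<omega> \<in> space M \<Longrightarrow> \<bar>V \<omega>\<bar> \<le> K'"
  shows "P.expectation (\<lambda>p. h (noise m p) * V (fst p)) = P.expectation (\<lambda>p. h (noise m p)) * expectation V"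
proof -
  let ?G1 = "generated_by (space P) U1 {0..}" and ?G2 = "generated_by (space P) U2 {0..}"
  define G where "G = {A \<inter> B | A B. A \<in> sets ?G1 \<and> B \<in> sets ?G2}"
  define \<O> where "\<O> = sigma (space P) G"
  define \<S> where "\<S> = vimage_algebra (space P) fst M"
  have G_sets: "G \<subseteq> sets P" using generated_subset unfolding G_def by blast
  then have G_Pow: "G \<subseteq> Pow (space P)" using sets.space_closed by blast
  have "fst \<in> space P \<rightarrow> space M" by (auto simp: space_P)
  then have \<S>_sets: "sets \<S> = {A \<times> space N |A. A \<in> sets M}"
    unfolding \<S>_def Setcompr_eq_image
    by (subst sets_vimage_algebra2) (auto simp only: Setcompr_eq_image intro!: image_cong fst_vimage)
  have \<S>_P: "sets \<S> \<subseteq> sets P"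
    unfolding \<S>_sets using measurable_sets[OF fst_measurable] fst_vimage by force
  have "P.indep_set G (sets \<S>)"
    unfolding P.indep_sets2_eq
  proof (intro conjI ballI G_sets \<S>_P)
    fix H E assume "H \<in> G" "E \<in> sets \<S>"
    then obtain A B C where "A \<in> sets ?G1" "B \<in> sets ?G2" "H = A \<inter> B" "C \<in> sets M" "E = C \<times> space N"
      by (auto simp: G_def \<S>_sets)
    then show "P.prob (H \<inter> E) = P.prob H * P.prob E" using indep_prob[of A B C] by simp
  qed
  moreover have "Int_stable G"
  proof (rule Int_stableI)
    fix H H' assume "H \<in> G" "H' \<in> G"
    then obtain A C A' C' where "A \<in> sets ?G1" "C \<in> sets ?G2" "H = A \<inter> C"
      "A' \<in> sets ?G1" "C' \<in> sets ?G2" "H' = A' \<inter> C'" by (auto simp: G_def)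
    then show "H \<inter> H' \<in> G"
      unfolding G_def by (intro CollectI exI[of _ "A \<inter> A'"] exI[of _ "C \<inter> C'"]) auto
  qed
  moreover have "Int_stable (sets \<S>)" by (rule sets.Int_stable)
  ultimately have ind: "P.indep_set (sigma_sets (space P) G) (sigma_sets (space P) (sets \<S>))"
    by (rule P.indep_set_sigma_sets)
  have sets_\<O>: "sets \<O> = sigma_sets (space P) G" and space_\<O>: "space \<O> = space P"
    using G_Pow by (simp_all add: \<O>_def)
  have "A \<in> sets \<O>" if "A \<in> sets ?G1" for A
  proof -
    have "A = A \<inter> space P" using that generated_subset sets.sets_into_space[of A P] by blast
    moreover have "space P \<in> sets ?G2" using sets.top[of ?G2] by simp
    ultimately show ?thesis unfolding sets_\<O> G_def using that by blast
  qed
  then have sub1: "subalgebra \<O> ?G1" by (auto simp: subalgebra_def space_\<O>)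
  have "A \<in> sets \<O>" if "A \<in> sets ?G2" for A
  proof -
    have "A = space P \<inter> A" using that generated_subset sets.sets_into_space[of A P] by blast
    moreover have "space P \<in> sets ?G1" using sets.top[of ?G1] by simp
    ultimately show ?thesis unfolding sets_\<O> G_def using that by blast
  qed
  then have sub2: "subalgebra \<O> ?G2" by (auto simp: subalgebra_def space_\<O>)
  have "P.indep_var borel (\<lambda>p. h (noise m p)) borel (\<lambda>p. V (fst p))"
  proof (rule P.indep_var_subalgebra)
    show "subalgebra P \<O>"
      using sets.sigma_sets_subset[OF G_sets] by (simp add: subalgebra_def space_\<O> sets_\<O>)
    show "subalgebra P \<S>" using \<S>_P by (auto simp: subalgebra_def \<S>_def)
    show "P.prob (x \<inter> y) = P.prob x * P.prob y" if "x \<in> sets \<O>" "y \<in> sets \<S>" for x y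
      using P.indep_setD[OF ind, of x y] that by (auto simp: sets_\<O>)
    show "(\<lambda>p. h (noise m p)) \<in> borel_measurable \<O>"
      unfolding noise_def
      by (intro measurable_compose[OF borel_measurable_Pair h(1)] measurable_from_subalg[OF sub1]
          measurable_from_subalg[OF sub2] path_after_generated)
    show "(\<lambda>p. V (fst p)) \<in> borel_measurable \<S>"
      unfolding \<S>_def by (intro measurable_compose[OF measurable_vimage_algebra1 V(1)]) (auto simp: space_P)
  qed
  moreover have "integrable P (\<lambda>p. h (noise m p))"
    by (rule P.integrable_bounded_random_variable[of _ K]) (use h in \<open>auto intro: measurable_compose[OF noise_measurable]\<close>)
  moreover have "integrable P (\<lambda>p. V (fst p))"
    by (rule P.integrable_bounded_random_variable[of _ K'])
      (use V in \<open>auto intro: measurable_compose[OF fst_measurable] simp: space_P\<close>)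
  ultimately have "P.expectation (\<lambda>p. h (noise m p) * V (fst p)) = P.expectation (\<lambda>p. h (noise m p)) * P.expectation (\<lambda>p. V (fst p))"
    by (rule P.indep_var_lebesgue_integral)
  then show ?thesis by (simp add: expectation_fst[OF V(1)])
qed

section \<open>Stable limits of the scaled noise and of the zoomed diffusion\<close>

definition scale2 :: "real \<Rightarrow> cpath \<times> cpath \<Rightarrow> cpath \<times> cpath" where
  "scale2 c z = (scale c (fst z), scale c (snd z))"

lemma continuous_on_scale2: "continuous_on UNIV (scale2 c)"
  unfolding scale2_def[abs_def]
  by (intro continuous_on_Pair continuous_on_compose2[OF continuous_on_scale] continuous_on_fst continuous_on_snd continuous_on_id) auto

definition scaled_noise :: "nat \<Rightarrow> 'a \<times> 'b \<Rightarrow> cpath \<times> cpath" where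
  "scaled_noise m p = scale2 (quantize m (\<sigma> (X 1 (fst p)))) (noise m p)"

text \<open>The coefficient need not be independent of the noise before time 1, so mixing does not
  apply to the product as it stands. Splitting by the finitely many values c of the rounded
  coefficient makes c a constant inside f and moves the indicator of the value into the test
  variable.\<close>

lemma small_noise_stable:
  fixes f :: "cpath \<times> cpath \<Rightarrow> real"
  assumes m: "0 < m" and f: "continuous_on UNIV f" "\<And>x. \<bar>f x\<bar> \<le> K"
    and V: "V \<in> borel_measurable M" "\<And>\<omega>. \<omega> \<in> space M \<Longrightarrow> \<bar>V \<omega>\<bar> \<le> K'"
  shows "((\<lambda>\<epsilon>. expectation (\<lambda>\<omega>. f (small_noise m \<epsilon> \<omega>) * V \<omega>)) \<longlongrightarrow>
    P.expectation (\<lambda>p. f (scaled_noise m p) * V (fst p))) (at_right 0)"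
proof -
  define C where "C = (\<lambda>k. real k / (real m)\<^sup>2) ` {..m ^ 3}"
  have C: "finite C" by (simp add: C_def)
  define q where "q = (\<lambda>\<omega>. quantize m (\<sigma> (X 1 \<omega>)))"
  have q: "q \<omega> \<in> C" for \<omega> unfolding q_def C_def by (rule quantize_mem[OF m \<sigma>_nonneg])
  have [measurable]: "q \<in> borel_measurable M"
    unfolding q_def using \<sigma>X_measurable[of 1] by (intro measurable_compose[OF _ quantize_measurable]) auto
  define Vc where "Vc = (\<lambda>c \<omega>. if q \<omega> = c then V \<omega> else 0)"
  note [measurable] = V(1)
  have Vc_meas [measurable]: "Vc c \<in> borel_measurable M" for c unfolding Vc_def by measurable
  have K': "0 \<le> K'" using V(2) not_empty by (meson abs_ge_zero all_not_in_conv order_trans)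
  have Vc_bound: "\<bar>Vc c \<omega>\<bar> \<le> K'" if "\<omega> \<in> space M" for c \<omega> using V(2)[OF that] K' by (simp add: Vc_def)
  have fc: "continuous_on UNIV (\<lambda>z. f (scale2 c z))" for c
    by (rule continuous_on_compose2[OF f(1) continuous_on_scale2]) auto
  have fc_meas: "(\<lambda>z. f (scale2 c z)) \<in> borel_measurable borel" for c
    by (rule borel_measurable_continuous_onI[OF fc])
  have split: "g (scale2 (q \<omega>) z) * V \<omega> = (\<Sum>c\<in>C. g (scale2 c z) * Vc c \<omega>)" for g :: "cpath \<times> cpath \<Rightarrow> real" and z \<omega>
  proof -
    have "(\<Sum>c\<in>C. g (scale2 c z) * Vc c \<omega>) = (\<Sum>c\<in>C. if c = q \<omega> then g (scale2 c z) * V \<omega> else 0)"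
      by (intro sum.cong) (auto simp: Vc_def)
    then show ?thesis using C q by (simp add: sum.delta)
  qed
  let ?B = "\<lambda>\<epsilon> \<omega>. (path_before 1 \<epsilon> (real m) \<omega>, path_after 1 \<epsilon> (real m) \<omega>)"
  \<comment> \<open>Mixing is used once for each value c; the constant mean is that of the limit
    noise, which has the law of the windows at every admissible scale.\<close>
  have lim: "((\<lambda>\<epsilon>. \<Sum>c\<in>C. expectation (\<lambda>\<omega>. f (scale2 c (?B \<epsilon> \<omega>)) * Vc c \<omega>)) \<longlongrightarrow>
    (\<Sum>c\<in>C. P.expectation (\<lambda>p. f (scale2 c (noise m p))) * expectation (Vc c))) (at_right 0)"
  proof (intro tendsto_sum two_sided_mixing[where K = K and K' = K'])
    fix c \<epsilon> :: real assume \<epsilon>: "0 < \<epsilon>" "\<epsilon> * real m \<le> 1"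
    have "expectation (\<lambda>\<omega>. f (scale2 c (?B \<epsilon> \<omega>))) = integral\<^sup>L (distr M borel (?B \<epsilon>)) (\<lambda>z. f (scale2 c z))"
      by (rule integral_distr[symmetric, OF two_sided_measurable fc_meas]) (use \<epsilon> in auto)
    also have "\<dots> = P.expectation (\<lambda>p. f (scale2 c (noise m p)))"
      unfolding noise_distr[OF \<epsilon>, symmetric] by (rule integral_distr[OF noise_measurable fc_meas])
    finally show "expectation (\<lambda>\<omega>. f (scale2 c (?B \<epsilon> \<omega>))) = P.expectation (\<lambda>p. f (scale2 c (noise m p)))" .
  qed (use m in simp | rule fc f(2) Vc_meas | erule Vc_bound)+
  \<comment> \<open>On the extension the noise is independent of the original sigma-algebra, so
    products of means become means of products, and the split by values is undone.\<close>
  have limit_eq: "(\<Sum>c\<in>C. P.expectation (\<lambda>p. f (scale2 c (noise m p))) * expectation (Vc c))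
    = P.expectation (\<lambda>p. f (scaled_noise m p) * V (fst p))"
  proof -
    have "(\<Sum>c\<in>C. P.expectation (\<lambda>p. f (scale2 c (noise m p))) * expectation (Vc c))
      = (\<Sum>c\<in>C. P.expectation (\<lambda>p. f (scale2 c (noise m p)) * Vc c (fst p)))"
      by (intro sum.cong refl noise_indep_M[symmetric, where K = K and K' = K'] fc_meas f(2) Vc_meas Vc_bound)
    also have "\<dots> = P.expectation (\<lambda>p. \<Sum>c\<in>C. f (scale2 c (noise m p)) * Vc c (fst p))"
    proof (rule Bochner_Integration.integral_sum[symmetric])
      fix c
      show "integrable P (\<lambda>p. f (scale2 c (noise m p)) * Vc c (fst p))"
      proof (rule P.integrable_bounded_random_variable)
        show "(\<lambda>p. f (scale2 c (noise m p)) * Vc c (fst p)) \<in> borel_measurable P"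
          by (intro borel_measurable_times measurable_compose[OF noise_measurable fc_meas] measurable_compose[OF fst_measurable Vc_meas])
        show "\<bar>f (scale2 c (noise m p)) * Vc c (fst p)\<bar> \<le> \<bar>K\<bar> * K'" if "p \<in> space P" for p
          unfolding abs_mult using f(2) Vc_bound[of "fst p" c] that
          by (intro mult_mono) (auto simp: space_P intro: order_trans[OF f(2)])
      qed
    qed
    also have "\<dots> = P.expectation (\<lambda>p. f (scaled_noise m p) * V (fst p))"
      unfolding scaled_noise_def split[symmetric] q_def ..
    finally show ?thesis .
  qed
  have ev: "eventually (\<lambda>\<epsilon>. (\<Sum>c\<in>C. expectation (\<lambda>\<omega>. f (scale2 c (?B \<epsilon> \<omega>)) * Vc c \<omega>))
    = expectation (\<lambda>\<omega>. f (small_noise m \<epsilon> \<omega>) * V \<omega>)) (at_right 0)"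
  proof (rule eventually_at_rightI)
    show "(0 :: real) < 1 / real m" using m by simp
    fix \<epsilon> assume "\<epsilon> \<in> {0<..<1 / real m}"
    then have \<epsilon>: "0 < \<epsilon>" "\<epsilon> * real m \<le> 1" using m by (auto simp: field_simps)
    have "(\<Sum>c\<in>C. expectation (\<lambda>\<omega>. f (scale2 c (?B \<epsilon> \<omega>)) * Vc c \<omega>))
      = expectation (\<lambda>\<omega>. \<Sum>c\<in>C. f (scale2 c (?B \<epsilon> \<omega>)) * Vc c \<omega>)"
    proof (rule Bochner_Integration.integral_sum[symmetric])
      fix c
      show "integrable M (\<lambda>\<omega>. f (scale2 c (?B \<epsilon> \<omega>)) * Vc c \<omega>)"
      proof (rule integrable_bounded_random_variable)
        show "(\<lambda>\<omega>. f (scale2 c (?B \<epsilon> \<omega>)) * Vc c \<omega>) \<in> borel_measurable M"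
          using \<epsilon> by (intro borel_measurable_times measurable_compose[OF two_sided_measurable fc_meas] Vc_meas) auto
        show "\<bar>f (scale2 c (?B \<epsilon> \<omega>)) * Vc c \<omega>\<bar> \<le> \<bar>K\<bar> * K'" if "\<omega> \<in> space M" for \<omega>
          unfolding abs_mult using f(2) Vc_bound[OF that, of c]
          by (intro mult_mono) (auto intro: order_trans[OF f(2)])
      qed
    qed
    also have "\<dots> = expectation (\<lambda>\<omega>. f (small_noise m \<epsilon> \<omega>) * V \<omega>)"
      unfolding split[symmetric] by (simp add: scale2_def small_noise_def q_def)
    finally show "(\<Sum>c\<in>C. expectation (\<lambda>\<omega>. f (scale2 c (?B \<epsilon> \<omega>)) * Vc c \<omega>)) = expectation (\<lambda>\<omega>. f (small_noise m \<epsilon> \<omega>) * V \<omega>)" .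
  qed
  show ?thesis
    using Lim_transform_eventually[OF lim ev] unfolding limit_eq .
qed

definition limit_paths :: "'a \<times> 'b \<Rightarrow> cpath \<times> cpath" where
  "limit_paths p = (path_of (\<lambda>t. \<sigma> (X 1 (fst p)) * U1 t p), path_of (\<lambda>t. \<sigma> (X 1 (fst p)) * U2 t p))"

lemma limit_process_continuous:
  assumes "p \<in> space P"
  shows "continuous_on {0..} (\<lambda>t. \<sigma> (X 1 (fst p)) * U1 t p)" "continuous_on {0..} (\<lambda>t. \<sigma> (X 1 (fst p)) * U2 t p)"
  using U1.B_continuous[OF assms] U2.B_continuous[OF assms] by (auto intro: continuous_on_mult continuous_on_const)

lemma limit_paths_measurable: "limit_paths \<in> borel_measurable P"
proof -
  have "(\<lambda>p. \<sigma> (X 1 (fst p))) \<in> borel_measurable P"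
    by (rule measurable_compose[OF fst_measurable \<sigma>X_measurable]) simp
  then show ?thesis
    unfolding limit_paths_def[abs_def]
    by (intro borel_measurable_Pair measurable_path_of borel_measurable_times limit_process_continuous
        U1.B_measurable U2.B_measurable)
qed

lemma scaled_noise_measurable: "scaled_noise m \<in> borel_measurable P"
proof -
  have "(\<lambda>p. quantize m (\<sigma> (X 1 (fst p)))) \<in> borel_measurable P"
    by (intro measurable_compose[OF _ quantize_measurable] measurable_compose[OF fst_measurable \<sigma>X_measurable]) simp
  then show ?thesis
    unfolding scaled_noise_def[abs_def] scale2_def noise_def fst_conv snd_conv
    by (intro borel_measurable_Pair scale_measurable U1.path_after_measurable_M U2.path_after_measurable_M) auto
qed

text \<open>\<open>path_after\<close> subtracts the value at time 0, so this limit is obtained only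
  where that value is 0, which is almost everywhere. Rounding converges for each fixed coefficient,
  and the path is bounded on compacts.\<close>

lemma (in filtered_brownian_motion) scale_path_after_tendsto:
  assumes \<omega>: "\<omega> \<in> space M" and B0: "B 0 \<omega> = 0"
  shows "(\<lambda>m. scale (quantize m s) (path_after 0 1 (real m) \<omega>)) \<longlonglongrightarrow> path_of (\<lambda>t. s * B t \<omega>)"
proof (rule tendsto_cpathI)
  fix T e :: real assume T: "0 \<le> T" and e: "0 < e"
  have cont: "continuous_on {0..} (\<lambda>t. s * B t \<omega>)"
    by (intro continuous_on_mult continuous_on_const B_continuous[OF \<omega>])
  have "compact ((\<lambda>t. B t \<omega>) ` {0..T})"
    by (intro compact_continuous_image continuous_on_subset[OF B_continuous[OF \<omega>]]) auto
  then obtain K where "\<forall>x\<in>(\<lambda>t. B t \<omega>) ` {0..T}. norm x \<le> K"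
    using compact_imp_bounded bounded_iff by metis
  then have K: "\<bar>B t \<omega>\<bar> \<le> K" if "t \<in> {0..T}" for t using that by auto
  have K0: "0 \<le> K" using K[of 0] T by auto
  obtain n :: nat where n: "T \<le> real n" using real_arch_simple by blast
  have "eventually (\<lambda>m. dist (quantize m s) s < e / (K + 1)) sequentially"
    using quantize_tendsto e K0 by (intro tendstoD) auto
  then show "eventually (\<lambda>m. \<forall>t\<in>{0..T}. \<bar>at_time (scale (quantize m s) (path_after 0 1 (real m) \<omega>)) t
    - at_time (path_of (\<lambda>t. s * B t \<omega>)) t\<bar> \<le> e) sequentially"
    using eventually_ge_at_top[of n]
  proof eventually_elim
    case (elim m)
    show ?case
    proof
      fix t assume t: "t \<in> {0..T}"
      then have "min (max 0 t) (real m) = t" using n elim(2) by (auto simp: min_def max_def)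
      then have "at_time (scale (quantize m s) (path_after 0 1 (real m) \<omega>)) t - at_time (path_of (\<lambda>t. s * B t \<omega>)) t
        = (quantize m s - s) * B t \<omega>"
        using t \<omega> B0 by (simp add: at_time_scale at_time_path_after at_time_path_of[OF cont] left_diff_distrib max_absorb2)
      also have "\<bar>\<dots>\<bar> \<le> e / (K + 1) * K"
        unfolding abs_mult using elim(1) K[OF t] K0 e by (intro mult_mono) (auto simp: dist_real_def)
      also have "\<dots> \<le> e" using K0 e by (simp add: pos_divide_le_eq)
      finally show "\<bar>at_time (scale (quantize m s) (path_after 0 1 (real m) \<omega>)) t - at_time (path_of (\<lambda>t. s * B t \<omega>)) t\<bar> \<le> e" .
    qed
  qed
qed

lemma scaled_noise_tendsto: "AE p in P. (\<lambda>m. scaled_noise m p) \<longlonglongrightarrow> limit_paths p"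
proof -
  have "AE p in P. U1 0 p = 0" "AE p in P. U2 0 p = 0"
    using U1.bm U2.bm by (auto simp: brownian_motion_wrt_def)
  then show ?thesis
    using AE_space
  proof eventually_elim
    case (elim p)
    then show ?case
      unfolding scaled_noise_def scale2_def noise_def limit_paths_def fst_conv snd_conv
      by (intro tendsto_Pair U1.scale_path_after_tendsto U2.scale_path_after_tendsto)
  qed
qed

text \<open>The order of choices matters: m is fixed first, making the distance of the scaled noise
  from the limit and the bound of \<open>small_noise_approx\<close> contribute less than r/3 each;
  then \<epsilon> tends to 0 for this m.\<close>

lemma zoom_stable_lipschitz:
  fixes f :: "cpath \<times> cpath \<Rightarrow> real"
  assumes lip: "\<And>x y. \<bar>f x - f y\<bar> \<le> L * dist x y" and K: "\<And>x. \<bar>f x\<bar> \<le> K"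
    and V: "V \<in> borel_measurable M" "\<And>\<omega>. \<omega> \<in> space M \<Longrightarrow> \<bar>V \<omega>\<bar> \<le> K'"
  shows "((\<lambda>\<epsilon>. expectation (\<lambda>\<omega>. f (zoom_before \<epsilon> \<omega>, zoom_after \<epsilon> \<omega>) * V \<omega>)) \<longlongrightarrow>
    P.expectation (\<lambda>p. f (limit_paths p) * V (fst p))) (at_right 0)"
proof (rule tendstoI)
  fix r :: real assume r: "0 < r"
  \<comment> \<open>The assumption admits any real L; two distinct paths show that it cannot be
    negative.\<close>
  have L: "0 \<le> L"
  proof (rule ccontr)
    assume "\<not> 0 \<le> L"
    moreover define x y where "x = (path_of (\<lambda>_. 0), path_of (\<lambda>_. 0))" and "y = (path_of (\<lambda>_. 1), path_of (\<lambda>_. 1))"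
    have "path_of (\<lambda>_. 0) \<noteq> path_of (\<lambda>_. 1)" using at_time_path_of_const zero_neq_one by metis
    then have "0 < dist x y" by (simp add: x_def y_def)
    ultimately have "L * dist x y < 0" by (intro mult_neg_pos) auto
    then show False using lip[of x y] by linarith
  qed
  have cont: "continuous_on UNIV f"
  proof -
    have "lipschitz_on L UNIV f" by (rule lipschitz_onI) (use lip L in \<open>auto simp: dist_real_def\<close>)
    then show ?thesis by (rule lipschitz_on_continuous_on)
  qed
  have f_meas [measurable]: "f \<in> borel_measurable borel" by (rule borel_measurable_continuous_onI[OF cont])
  have K0: "0 \<le> K" using K[of undefined] by linarith
  have K'0: "0 \<le> K'" using V(2) not_empty by (meson abs_ge_zero all_not_in_conv order_trans)
  note [measurable] = V(1) zoom_before_measurable zoom_after_measurable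
  have lim1: "(\<lambda>m. P.expectation (\<lambda>p. f (scaled_noise m p) * V (fst p))) \<longlonglongrightarrow> P.expectation (\<lambda>p. f (limit_paths p) * V (fst p))"
  proof (rule integral_dominated_convergence[where w = "\<lambda>_. K * K'"])
    show "AE p in P. (\<lambda>m. f (scaled_noise m p) * V (fst p)) \<longlonglongrightarrow> f (limit_paths p) * V (fst p)"
      using scaled_noise_tendsto
    proof eventually_elim
      case (elim p)
      have "isCont f (limit_paths p)" using cont by (metis continuous_on_eq_continuous_at UNIV_I open_UNIV)
      from isCont_tendsto_compose[OF this elim] show ?case by (intro tendsto_mult tendsto_const)
    qed
    show "AE p in P. norm (f (scaled_noise m p) * V (fst p)) \<le> K * K'" for m
      unfolding real_norm_def abs_mult using K K0
      by (intro AE_I2 mult_mono V(2)) (auto simp: space_P)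
    show "(\<lambda>p. f (limit_paths p) * V (fst p)) \<in> borel_measurable P"
      by (intro borel_measurable_times measurable_compose[OF limit_paths_measurable f_meas] measurable_compose[OF fst_measurable V(1)])
    show "(\<lambda>p. f (scaled_noise m p) * V (fst p)) \<in> borel_measurable P" for m
      by (intro borel_measurable_times measurable_compose[OF scaled_noise_measurable f_meas] measurable_compose[OF fst_measurable V(1)])
  qed simp
  have lim2: "(\<lambda>m. K' * L * (34 / real m + 2 * prob {\<omega>\<in>space M. real m < \<sigma> (X 1 \<omega>)})) \<longlonglongrightarrow> K' * L * (0 + 2 * 0)"
  proof (intro tendsto_mult tendsto_add tendsto_const)
    show "(\<lambda>m. 34 / real m) \<longlonglongrightarrow> 0" by (rule lim_const_over_n)
    \<comment> \<open>The coefficient is finite at every sample point, so these events decrease to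
      the empty set.\<close>
    have "(\<lambda>m. prob {\<omega>\<in>space M. real m < \<sigma> (X 1 \<omega>)}) \<longlonglongrightarrow> prob (\<Inter>m. {\<omega>\<in>space M. real m < \<sigma> (X 1 \<omega>)})"
      using \<sigma>X_measurable[of 1] by (intro finite_Lim_measure_decseq) (auto simp: decseq_def)
    also have "(\<Inter>m. {\<omega>\<in>space M. real m < \<sigma> (X 1 \<omega>)}) = {}"
    proof -
      have "\<exists>m. \<not> real m < s" for s using real_arch_simple[of s] by (auto simp: not_less)
      then show ?thesis by blast
    qed
    finally show "(\<lambda>m. prob {\<omega>\<in>space M. real m < \<sigma> (X 1 \<omega>)}) \<longlonglongrightarrow> 0" by simp
  qed
  have r3: "0 < r / 3" "K' * L * (0 + 2 * 0) < r / 3" using \<open>0 < r\<close> by simp_all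
  have "eventually (\<lambda>m. 0 < m \<and> dist (P.expectation (\<lambda>p. f (scaled_noise m p) * V (fst p))) (P.expectation (\<lambda>p. f (limit_paths p) * V (fst p))) < r / 3
    \<and> K' * L * (34 / real m + 2 * prob {\<omega>\<in>space M. real m < \<sigma> (X 1 \<omega>)}) < r / 3) sequentially"
    by (intro eventually_conj eventually_gt_at_top tendstoD[OF lim1 r3(1)] order_tendstoD(2)[OF lim2 r3(2)])
  then obtain m where m: "0 < m"
    "dist (P.expectation (\<lambda>p. f (scaled_noise m p) * V (fst p))) (P.expectation (\<lambda>p. f (limit_paths p) * V (fst p))) < r / 3"
    "K' * L * (34 / real m + 2 * prob {\<omega>\<in>space M. real m < \<sigma> (X 1 \<omega>)}) < r / 3"
    by (auto simp: eventually_sequentially)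
  have "eventually (\<lambda>\<epsilon>. dist (expectation (\<lambda>\<omega>. f (small_noise m \<epsilon> \<omega>) * V \<omega>))
    (P.expectation (\<lambda>p. f (scaled_noise m p) * V (fst p))) < r / 3) (at_right 0)"
    by (rule tendstoD[OF small_noise_stable[OF m(1) cont K V] r3(1)])
  moreover have "eventually (\<lambda>\<epsilon>. 0 < \<epsilon> \<and> \<epsilon> * real m \<le> 1) (at_right 0)"
    using m(1) by (intro eventually_at_rightI[of 0 "1 / real m"]) (auto simp: field_simps)
  ultimately show "eventually (\<lambda>\<epsilon>. dist (expectation (\<lambda>\<omega>. f (zoom_before \<epsilon> \<omega>, zoom_after \<epsilon> \<omega>) * V \<omega>))
    (P.expectation (\<lambda>p. f (limit_paths p) * V (fst p))) < r) (at_right 0)"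
    using small_noise_approx[OF m(1)]
  proof eventually_elim
    case (elim \<epsilon>)
    let ?Z = "\<lambda>\<omega>. (zoom_before \<epsilon> \<omega>, zoom_after \<epsilon> \<omega>)" and ?S = "small_noise m \<epsilon>"
    have [measurable]: "?S \<in> borel_measurable M" using elim by (intro small_noise_measurable) auto
    have [measurable]: "?Z \<in> borel_measurable M" by measurable
    have int: "integrable M (\<lambda>\<omega>. f (Y \<omega>) * V \<omega>)" if [measurable]: "Y \<in> borel_measurable M" for Y
    proof (rule integrable_bounded_random_variable)
      show "(\<lambda>\<omega>. f (Y \<omega>) * V \<omega>) \<in> borel_measurable M" by measurable
      show "\<bar>f (Y \<omega>) * V \<omega>\<bar> \<le> K * K'" if "\<omega> \<in> space M" for \<omega>
        unfolding abs_mult using K0 by (intro mult_mono K V(2) that) auto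
    qed
    have dist_int: "integrable M (\<lambda>\<omega>. dist (?Z \<omega>) (?S \<omega>))"
    proof (rule integrable_bounded_random_variable)
      show "(\<lambda>\<omega>. dist (?Z \<omega>) (?S \<omega>)) \<in> borel_measurable M" by measurable
      have "dist (x1, y1) (x2, y2) \<le> 2" for x1 y1 x2 y2 :: cpath
        unfolding dist_Pair_Pair
        using sqrt_sum_squares_le_sum[of "dist x1 x2" "dist y1 y2"] dist_cpath_le_1[of x1 x2] dist_cpath_le_1[of y1 y2]
        by simp
      then show "\<bar>dist (?Z \<omega>) (?S \<omega>)\<bar> \<le> 2" for \<omega> by (cases "?S \<omega>") auto
    qed
    have "\<bar>expectation (\<lambda>\<omega>. f (?Z \<omega>) * V \<omega>) - expectation (\<lambda>\<omega>. f (?S \<omega>) * V \<omega>)\<bar>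
      = \<bar>expectation (\<lambda>\<omega>. f (?Z \<omega>) * V \<omega> - f (?S \<omega>) * V \<omega>)\<bar>"
      by (simp add: Bochner_Integration.integral_diff int)
    also have "\<dots> \<le> expectation (\<lambda>\<omega>. \<bar>f (?Z \<omega>) * V \<omega> - f (?S \<omega>) * V \<omega>\<bar>)"
      by (rule integral_abs_bound)
    also have "\<dots> \<le> expectation (\<lambda>\<omega>. K' * L * dist (?Z \<omega>) (?S \<omega>))"
    proof (rule integral_mono)
      show "integrable M (\<lambda>\<omega>. \<bar>f (?Z \<omega>) * V \<omega> - f (?S \<omega>) * V \<omega>\<bar>)"
        by (intro integrable_abs Bochner_Integration.integrable_diff int; measurable)
      show "integrable M (\<lambda>\<omega>. K' * L * dist (?Z \<omega>) (?S \<omega>))" using dist_int by (rule integrable_mult_right)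
      fix \<omega> assume "\<omega> \<in> space M"
      have "\<bar>f (?Z \<omega>) * V \<omega> - f (?S \<omega>) * V \<omega>\<bar> = \<bar>V \<omega>\<bar> * \<bar>f (?Z \<omega>) - f (?S \<omega>)\<bar>"
        by (simp add: abs_mult[symmetric] algebra_simps)
      also have "\<dots> \<le> K' * (L * dist (?Z \<omega>) (?S \<omega>))"
        using K'0 by (intro mult_mono V(2) \<open>\<omega> \<in> space M\<close> lip) auto
      finally show "\<bar>f (?Z \<omega>) * V \<omega> - f (?S \<omega>) * V \<omega>\<bar> \<le> K' * L * dist (?Z \<omega>) (?S \<omega>)" by (simp add: mult.assoc)
    qed
    also have "\<dots> = K' * L * expectation (\<lambda>\<omega>. dist (?Z \<omega>) (?S \<omega>))" by simp
    also have "\<dots> \<le> K' * L * (34 / real m + 2 * prob {\<omega>\<in>space M. real m < \<sigma> (X 1 \<omega>)})"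
      using elim K'0 L by (intro mult_left_mono) auto
    finally have "\<bar>expectation (\<lambda>\<omega>. f (?Z \<omega>) * V \<omega>) - expectation (\<lambda>\<omega>. f (?S \<omega>) * V \<omega>)\<bar> < r / 3" using m(3) by (rule le_less_trans)
    then show ?case using elim(1) m(2) unfolding dist_real_def by linarith
  qed
qed

text \<open>All paths are continuous, so both the zoomed paths and their limit factor through the
  continuous map \<open>G\<close> from pairs of paths, and a test function f on the Skorokhod side
  becomes the test function \<open>\<lambda>z. f (G z)\<close>.\<close>

theorem converges_stably:
  "converges_stably_at_0 M P
     (\<lambda>\<epsilon> \<omega>. (sample_path (\<lambda>t. zoomed X \<epsilon> (- t)) \<omega>, sample_path (zoomed X \<epsilon>) \<omega>))
     (\<lambda>p. (sample_path (\<lambda>t q. \<sigma> (X 1 (fst q)) * U1 t q) p, sample_path (\<lambda>t q. \<sigma> (X 1 (fst q)) * U2 t q) p))"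
proof -
  define G where "G = (\<lambda>(x, y). (to_cadlag x, to_cadlag y))"
  have G: "continuous_on UNIV G" unfolding G_def by (rule continuous_on_to_cadlag_pair)
  have G_meas: "G \<in> borel_measurable borel" by (rule borel_measurable_continuous_onI[OF G])
  let ?Z = "\<lambda>\<epsilon> \<omega>. (zoom_before \<epsilon> \<omega>, zoom_after \<epsilon> \<omega>)"
  have Z_meas: "?Z \<epsilon> \<in> borel_measurable M" for \<epsilon>
    by (intro borel_measurable_Pair zoom_before_measurable zoom_after_measurable)
  have Z_eq: "(sample_path (\<lambda>t. zoomed X \<epsilon> (- t)) \<omega>, sample_path (zoomed X \<epsilon>) \<omega>) = G (?Z \<epsilon> \<omega>)" if "\<omega> \<in> space M" for \<epsilon> \<omega>
    using that by (simp add: G_def zoom_before_def zoom_after_def sample_path_eq_to_cadlag zoomed_continuous zoomed_continuous_neg)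
  have Z0_eq: "(sample_path (\<lambda>t q. \<sigma> (X 1 (fst q)) * U1 t q) p, sample_path (\<lambda>t q. \<sigma> (X 1 (fst q)) * U2 t q) p) = G (limit_paths p)"
    if "p \<in> space P" for p
    using that by (simp add: G_def limit_paths_def sample_path_eq_to_cadlag limit_process_continuous)
  show ?thesis
    unfolding converges_stably_at_0_def
  proof (intro conjI allI impI)
    fix \<epsilon> :: real
    show "(\<lambda>\<omega>. (sample_path (\<lambda>t. zoomed X \<epsilon> (- t)) \<omega>, sample_path (zoomed X \<epsilon>) \<omega>)) \<in> borel_measurable M"
      by (subst measurable_cong[OF Z_eq]) (auto intro: measurable_compose[OF Z_meas G_meas])
  next
    show "(\<lambda>p. (sample_path (\<lambda>t q. \<sigma> (X 1 (fst q)) * U1 t q) p, sample_path (\<lambda>t q. \<sigma> (X 1 (fst q)) * U2 t q) p)) \<in> borel_measurable P"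
      by (subst measurable_cong[OF Z0_eq]) (auto intro: measurable_compose[OF limit_paths_measurable G_meas])
  next
    fix f :: "cadlag \<times> cadlag \<Rightarrow> real" and V :: "'a \<Rightarrow> real"
    assume fV: "continuous_on UNIV f \<and> bounded (range f) \<and> V \<in> borel_measurable M \<and> bounded (V ` space M)"
    then obtain K K' where "\<forall>y\<in>range f. norm y \<le> K" "\<forall>y\<in>V ` space M. norm y \<le> K'"
      unfolding bounded_iff by blast
    then have K: "\<bar>f x\<bar> \<le> K" and K': "\<omega> \<in> space M \<Longrightarrow> \<bar>V \<omega>\<bar> \<le> K'" for x \<omega>
      unfolding real_norm_def by blast+
    have "continuous_on UNIV (\<lambda>z. f (G z))"
      by (rule continuous_on_compose2[OF _ G]) (use fV in auto)
    then have "((\<lambda>\<epsilon>. expectation (\<lambda>\<omega>. f (G (?Z \<epsilon> \<omega>)) * V \<omega>)) \<longlongrightarrow> P.expectation (\<lambda>p. f (G (limit_paths p)) * V (fst p))) (at_right 0)"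
      by (intro stable_portmanteau[OF prob_space_axioms prob_space_P fst_measurable Z_meas limit_paths_measurable
            zoom_stable_lipschitz, where K = K and K' = K']) (use fV K K' in auto)
    moreover have "expectation (\<lambda>\<omega>. f (G (?Z \<epsilon> \<omega>)) * V \<omega>)
      = expectation (\<lambda>\<omega>. f (sample_path (\<lambda>t. zoomed X \<epsilon> (- t)) \<omega>, sample_path (zoomed X \<epsilon>) \<omega>) * V \<omega>)" for \<epsilon>
      by (intro Bochner_Integration.integral_cong refl) (simp add: Z_eq)
    moreover have "P.expectation (\<lambda>p. f (G (limit_paths p)) * V (fst p))
      = P.expectation (\<lambda>p. f (sample_path (\<lambda>t q. \<sigma> (X 1 (fst q)) * U1 t q) p, sample_path (\<lambda>t q. \<sigma> (X 1 (fst q)) * U2 t q) p) * V (fst p))"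
      by (intro Bochner_Integration.integral_cong refl) (simp add: Z0_eq)
    ultimately show "((\<lambda>\<epsilon>. \<integral>\<omega>. f (sample_path (\<lambda>t. zoomed X \<epsilon> (- t)) \<omega>, sample_path (zoomed X \<epsilon>) \<omega>) * V \<omega> \<partial>M) \<longlongrightarrow>
      (\<integral>p. f (sample_path (\<lambda>t q. \<sigma> (X 1 (fst q)) * U1 t q) p, sample_path (\<lambda>t q. \<sigma> (X 1 (fst q)) * U2 t q) p) * V (fst p) \<partial>P)) (at_right 0)"
      by simp
  qed
qed

end

theorem theorem5:
  fixes M :: "'a measure" and N :: "'b measure" and P :: "('a \<times> 'b) measure"
    and F :: "real \<Rightarrow> 'a measure"
    and X W :: "real \<Rightarrow> 'a \<Rightarrow> real"
    and \<mu> \<sigma> :: "real \<Rightarrow> real" and x0 :: real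
    and U1 U2 :: "real \<Rightarrow> 'a \<times> 'b \<Rightarrow> real"
  assumes "weak_solution M F \<mu> \<sigma> x0 X W"
    and "locally_bounded \<mu>"
    and "\<forall>x. 0 \<le> \<sigma> x"
    and "continuous_on (process_range M X) \<sigma>"
    and "\<forall>x\<in>process_range M X. 0 < \<sigma> x"
    and "is_extension M N P"
    and "standard_brownian_motion P U1"
    and "standard_brownian_motion P U2"
    and "prob_space.indep_sets P
           ((!) [sets (generated_by (space P) U1 {0..}),
                 sets (generated_by (space P) U2 {0..}),
                 {A \<times> space N | A. A \<in> sets M}]) {0, 1, 2}"
  shows "converges_stably_at_0 M P
           (\<lambda>\<epsilon> \<omega>. (sample_path (\<lambda>t. zoomed X \<epsilon> (- t)) \<omega>, sample_path (zoomed X \<epsilon>) \<omega>))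
           (\<lambda>p. (sample_path (\<lambda>t q. \<sigma> (X 1 (fst q)) * U1 t q) p,
                 sample_path (\<lambda>t q. \<sigma> (X 1 (fst q)) * U2 t q) p))"
proof -
  from assms(1) obtain J where uc: "usual_conditions M F" and bm: "brownian_motion_wrt M F W"
    and X: "adapted F X" "continuous_paths M X" "AE \<omega> in M. X 0 \<omega> = x0"
    and J: "ito_integral M F W (\<lambda>t \<omega>. \<sigma> (X t \<omega>)) J"
      "AE \<omega> in M. \<forall>t\<ge>0. (\<lambda>s. \<mu> (X s \<omega>)) absolutely_integrable_on {0..t} \<and>
        X t \<omega> = x0 + integral {0..t} (\<lambda>s. \<mu> (X s \<omega>)) + J t \<omega>"
    unfolding weak_solution_def by blast
  interpret prob_space M using uc by (simp add: usual_conditions_def)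
  interpret filtered_brownian_motion M F W
  proof
    show "subalgebra M (F t)" if "0 \<le> t" for t
      using uc that unfolding usual_conditions_def by blast
    show "sets (F s) \<subseteq> sets (F t)" if "0 \<le> s" "s \<le> t" for s t
      using uc that unfolding usual_conditions_def by blast
  qed (rule bm)
  have X_meas: "X t \<in> borel_measurable M" if "0 \<le> t" for t
    using X(1) measurable_F_M[OF that] that by (auto simp: adapted_def)
  have X_cont: "continuous_on {0..} (\<lambda>t. X t \<omega>)" if "\<omega> \<in> space M" for \<omega>
    using X(2) that by (auto simp: continuous_paths_def)
  \<comment> \<open>\<sigma> is continuous relative to the range, so \<open>\<sigma> (X t)\<close>
    is continuous in t along paths that never leave it.\<close>
  have "AE \<omega> in M. \<forall>t\<ge>0. X t \<omega> \<in> process_range M X"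
    by (rule AE_in_process_range[OF X_meas X_cont X(3)])
  then have "AE \<omega> in M. continuous_on {0..} (\<lambda>t. \<sigma> (X t \<omega>))"
    using AE_space
  proof eventually_elim
    case (elim \<omega>)
    show ?case
      by (rule continuous_on_compose2[OF assms(4) X_cont[OF elim(2)]]) (use elim(1) in auto)
  qed
  then interpret diffusion_extension M F W X J \<mu> \<sigma> x0 N P U1 U2
    by unfold_locales (use assms X J in blast)+
  show ?thesis by (rule converges_stably)
qed

end
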